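(* Let $\mathbb{X}\subseteq V_{3,2}\subseteq\mathbb{P}^9$ be a reduced subvariety. Then $\mathbb{X}$ is a complete intersection of type $(a_1,\dots,a_r)$, with $a_1\le\dots\le a_r$, if and only if $\mathbb{X}$ is one of the following: - $r=9$, $a_1=\dots=a_9=1$, that is, $\mathbb{X}$ is a reduced point; - $r=9$, $a_1=\dots=a_8=1$, $a_9=2$, that is, $\mathbb{X}$ is a set of two reduced points; - $r=9$, $a_1=\dots=a_7=1$, $a_8=2$, $a_9=b$ for any $b\ge2$, that is, $\mathbb{X}=\mathcal{C}\cap H_b$ for $\mathcal{C}\subseteq V_{3,2}$ a conic and $H_b$ a hypersurface of degree $b$; - $r=8$, $a_1=\dots=a_7=1$, $a_8=2$, that is, $\mathbb{X}$ is a conic.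
   Context: $\mathbb{K}$ is an algebraically closed field of characteristic $0$, and projective spaces are over $\mathbb{K}$. $V_{3,2}\subseteq\mathbb{P}^9$ is the image of the quadratic Veronese map $\nu_{3,2}:\mathbb{P}^3\to\mathbb{P}^9$ sending $[x_0,\dots,x_3]$ to the point whose coordinates are all monomials of degree $2$ in $x_0,\dots,x_3$. Varieties are non-empty reduced closed subschemes (not necessarily irreducible), and $\mathcal{I}(\mathbb{X})$ is the homogeneous (radical) ideal of $\mathbb{X}$ in the coordinate ring of $\mathbb{P}^9$. $\mathbb{X}$ is a complete intersection of type $(a_1,\dots,a_r)$ if $\mathcal{I}(\mathbb{X})=(f_1,\dots,f_r)$ with $f_i$ homogeneous of degree $a_i\ge1$ and $\operatorname{codim}\mathbb{X}=r$ in $\mathbb{P}^9$. The intersection $\mathcal{C}\cap H_b$ is scheme-theoretic (and zero-dimensional, since $r=9$ there). *)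

theory Defs
  imports
    "HOL-Analysis.Cartesian_Space"
    "HOL-Library.Extended_Nat"
    "HOL-Library.Numeral_Type"
    "HOL-Library.Poly_Mapping"
    "HOL-Library.Uprod"
    "HOL-Computational_Algebra.Polynomial"
begin

section \<open>Polynomials and ideals\<close>

text \<open>
  Polynomials over \<open>'k\<close> in variables indexed by a finite type \<open>'n\<close>: finitely supported
  coefficient functions on exponent vectors, with the convolution product of \<open>Poly_Mapping\<close>.
\<close>

type_synonym ('n, 'k) mpol = "('n \<Rightarrow>\<^sub>0 nat) \<Rightarrow>\<^sub>0 'k"

definition mpol_eval :: "('n::finite, 'k::comm_ring_1) mpol \<Rightarrow> 'k ^ 'n \<Rightarrow> 'k" where
  "mpol_eval F v =
    (\<Sum>m\<in>Poly_Mapping.keys F. Poly_Mapping.lookup F m * (\<Prod>i\<in>UNIV. v $ i ^ Poly_Mapping.lookup m i))"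

text \<open>The forms of degree \<open>d\<close>; as usual these include the zero polynomial.\<close>

definition homogeneous :: "nat \<Rightarrow> ('n::finite, 'k::comm_ring_1) mpol \<Rightarrow> bool" where
  "homogeneous d F \<longleftrightarrow> (\<forall>m\<in>Poly_Mapping.keys F. (\<Sum>i\<in>UNIV. Poly_Mapping.lookup m i) = d)"

text \<open>The ideal generated by a set is its span in the ring, regarded as a module over itself.\<close>

lemma module_mult_self: "module ((*) :: 'a::comm_ring_1 \<Rightarrow> 'a \<Rightarrow> 'a)"
  by unfold_locales (simp_all add: algebra_simps)

definition ideal_gen :: "'a::comm_ring_1 set \<Rightarrow> 'a set" where
  "ideal_gen S = module.span (*) S"

section \<open>Projective varieties\<close>

text \<open>
  Points of the projective space of a subspace \<open>W\<close> of \<open>'k ^ 'n\<close> are the one-dimensional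
  subspaces of \<open>W\<close>; in particular \<open>proj UNIV\<close> is projective space of dimension
  \<open>CARD('n) - 1\<close>. Closed sets and varieties are sets of such points.
\<close>

type_synonym ('n, 'k) point = "('k ^ 'n) set"

definition proj :: "('k::field ^ 'n::finite) set \<Rightarrow> ('n, 'k) point set" where
  "proj W = {L. vec.subspace L \<and> vec.dim L = 1 \<and> L \<subseteq> W}"

definition vanishes_at :: "('n::finite, 'k::field) mpol \<Rightarrow> ('n, 'k) point \<Rightarrow> bool" where
  "vanishes_at F L \<longleftrightarrow> (\<forall>v\<in>L - {0}. mpol_eval F v = 0)"

definition zariski_closed :: "('n::finite, 'k::field) point set \<Rightarrow> bool" where
  "zariski_closed Z \<longleftrightarrow>
    (\<exists>S. (\<forall>F\<in>S. \<exists>d. homogeneous d F) \<and> Z = {L \<in> proj UNIV. \<forall>F\<in>S. vanishes_at F L})"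

definition variety :: "('n::finite, 'k::field) point set \<Rightarrow> bool" where
  "variety X \<longleftrightarrow> zariski_closed X \<and> X \<noteq> {}"

definition vanishing_ideal :: "('n::finite, 'k::field) point set \<Rightarrow> ('n, 'k) mpol set" where
  "vanishing_ideal X = {F. \<forall>L\<in>X. vanishes_at F L}"

definition irreducible_closed :: "('n::finite, 'k::field) point set \<Rightarrow> bool" where
  "irreducible_closed Z \<longleftrightarrow> zariski_closed Z \<and> Z \<noteq> {} \<and>
    (\<forall>A B. zariski_closed A \<longrightarrow> zariski_closed B \<longrightarrow> Z = A \<union> B \<longrightarrow> Z = A \<or> Z = B)"

text \<open>Krull dimension of a closed set in the Zariski topology.\<close>

definition proj_dim :: "('n::finite, 'k::field) point set \<Rightarrow> enat" where
  "proj_dim X = Sup {enat n | n. \<exists>Z :: nat \<Rightarrow> ('n, 'k) point set.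
      (\<forall>i\<le>n. irreducible_closed (Z i) \<and> Z i \<subseteq> X) \<and> (\<forall>i<n. Z i \<subset> Z (Suc i))}"

definition has_codim :: "('n::finite, 'k::field) point set \<Rightarrow> nat \<Rightarrow> bool" where
  "has_codim X r \<longleftrightarrow> proj_dim X + enat r = enat (CARD('n) - 1)"

definition complete_intersection :: "('n::finite, 'k::field) point set \<Rightarrow> nat list \<Rightarrow> bool" where
  "complete_intersection X a \<longleftrightarrow>
    has_codim X (length a) \<and> (\<forall>i<length a. 1 \<le> a ! i) \<and>
    (\<exists>f. length f = length a \<and> (\<forall>i<length a. homogeneous (a ! i) (f ! i)) \<and>
      vanishing_ideal X = ideal_gen (set f))"

section \<open>Closed subschemes of projective space\<close>

text \<open>
  A closed subscheme is given by a homogeneous ideal, and two homogeneous ideals define the same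
  subscheme iff their saturations with respect to the irrelevant ideal agree. The
  scheme-theoretic intersection is defined by the sum of the ideals, and the reduced scheme
  structure on a closed set by its vanishing ideal.
\<close>

definition saturation :: "('n::finite, 'k::field) mpol set \<Rightarrow> ('n, 'k) mpol set" where
  "saturation J = {F. \<exists>k. \<forall>G. homogeneous k G \<longrightarrow> G * F \<in> J}"

definition same_subscheme :: "('n::finite, 'k::field) mpol set \<Rightarrow> ('n, 'k) mpol set \<Rightarrow> bool" where
  "same_subscheme I J \<longleftrightarrow> saturation I = saturation J"

definition scheme_inter ::
    "('n::finite, 'k::field) mpol set \<Rightarrow> ('n, 'k) mpol set \<Rightarrow> ('n, 'k) mpol set" where
  "scheme_inter I J = ideal_gen (I \<union> J)"

text \<open>
  A conic is a (reduced, possibly reducible) plane curve of degree two: the scheme cut out in a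
  plane by a quadric not containing that plane, provided that this scheme is reduced.
\<close>

definition conic :: "('n::finite, 'k::field) point set \<Rightarrow> bool" where
  "conic C \<longleftrightarrow> variety C \<and>
    (\<exists>W Q. vec.subspace W \<and> vec.dim W = 3 \<and>
      homogeneous 2 Q \<and> Q \<notin> vanishing_ideal (proj W) \<and>
      same_subscheme (vanishing_ideal C) (scheme_inter (vanishing_ideal (proj W)) (ideal_gen {Q})))"

section \<open>The quadratic Veronese variety of projective three-space\<close>

text \<open>
  Monomials of degree two in variables indexed by \<open>'i\<close> correspond to unordered pairs of indices
  (\<open>Upair i i\<close> is allowed), so the type \<open>4 uprod\<close> indexes the ten coordinates of the target.
\<close>

instance uprod :: (finite) finite
  by standard simp

lemma CARD_4_uprod: "CARD(4 uprod) = 10"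
  by (simp add: card_UNIV_uprod)

lift_definition upair_prod :: "('i \<Rightarrow> 'k::comm_monoid_mult) \<Rightarrow> 'i uprod \<Rightarrow> 'k"
  is "\<lambda>x (i, j). x i * x j"
  by (auto simp: mult.commute)

lemma upair_prod_Upair [simp]: "upair_prod x (Upair i j) = x i * x j"
  by transfer simp

definition veronese :: "'k::field ^ 4 \<Rightarrow> 'k ^ (4 uprod)" where
  "veronese x = (\<chi> p. upair_prod (($) x) p)"

definition veronese_variety :: "(4 uprod, 'k::field) point set" where
  "veronese_variety = {vec.span {veronese x} | x. x \<noteq> 0}"

end

theory Submission
  imports Defs
begin

text \<open>
  Let \<open>X\<close> be a complete intersection on the Veronese variety, \<open>N\<close> the span of the cone over \<open>X\<close> and
  \<open>n = dim N\<close>. At least \<open>10 - n\<close> generators are linear and there are at most 9 generators, so fewer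
  than \<open>n\<close> of them are quadrics; restricted to \<open>N\<close>, these span all quadrics vanishing on \<open>X\<close>, in
  particular the 2x2 minors of the symmetric matrix of coordinates. If the preimage of \<open>X\<close> in \<open>P\<^sup>3\<close>
  is not contained in a line, then at least \<open>n\<close> minors are linearly independent on \<open>N\<close>. Hence \<open>X\<close> lies on the
  image of a line, a smooth conic \<open>C\<close>; its closed subsets are \<open>C\<close> and the finite sets, and the
  degrees are read off from \<open>n \<le> 3\<close>. Conversely, every conic on the variety is the image of a line,
  and modulo the linear equations of its plane and one quadric each polynomial has the normal form
  \<open>A(y0, y1) + y2 B(y0, y1)\<close>; this determines the ideal of \<open>C\<close> and shows that the ideal of \<open>C\<close> plus
  one form is saturated.
\<close>

section \<open>Polynomial substitution\<close>

text \<open>The number of independent minors has two sources. If the preimage of \<open>X\<close>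
  spans a space of dimension d, each of the d(d-1)/2 pairs from a basis is detected by a minor, and
  this is at least d once d >= 3; each of the other n - d independent points of the cone accounts
  for one more. For d = 2 only one pair remains, and this is why lines survive. Vanishing ideals
  also contain polynomials that are not forms, so vanishing has to be controlled on whole cones.
  Square roots make the parametrisation of the conic reach every multiple of its points, and
  characteristic 0 separates even from odd parts and supplies infinitely many parameters. A
  hypersurface section is given only up to saturation, whereas a complete intersection needs
  generators of the vanishing ideal itself; saturatedness of the ideal of \<open>C\<close> plus one
  form closes this gap. For b = 2 there are two quadric generators, and neither is marked as the
  equation of the conic in its plane; a nonzero coefficient in a relation decides which one takes
  that role.\<close>

definition mpol_subst ::
    "('k::comm_ring_1 \<Rightarrow> 'r::comm_ring_1) \<Rightarrow> ('n::finite \<Rightarrow> 'r) \<Rightarrow> ('n, 'k) mpol \<Rightarrow> 'r" where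
  "mpol_subst \<phi> w F =
    (\<Sum>m\<in>Poly_Mapping.keys F. \<phi> (Poly_Mapping.lookup F m) * (\<Prod>i\<in>UNIV. w i ^ Poly_Mapping.lookup m i))"

lemma mpol_eval_subst: "mpol_eval F v = mpol_subst (\<lambda>c. c) (($) v) F"
  by (simp add: mpol_eval_def mpol_subst_def)

abbreviation mconst :: "'k::comm_ring_1 \<Rightarrow> ('n, 'k) mpol" where
  "mconst c \<equiv> Poly_Mapping.single 0 c"

definition mvar :: "'n \<Rightarrow> ('n, 'k::comm_ring_1) mpol" where
  "mvar i = Poly_Mapping.single (Poly_Mapping.single i 1) 1"

lemma mconst_mult: "mconst (a * b) = mconst a * mconst b"
  by (simp add: mult_single)

text \<open>A polynomial is the sum of its terms, and a term is a constant times powers of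
  variables. The rule is made for normal forms: the polynomials that have one form a subring, so
  only constants and variables have to be reduced by hand.\<close>

lemma mpol_induct [case_names const var add mult]:
  fixes F :: "('n::finite, 'k::comm_ring_1) mpol"
  assumes c: "\<And>c. P (mconst c)" and v: "\<And>i. P (mvar i)"
    and a: "\<And>F G. P F \<Longrightarrow> P G \<Longrightarrow> P (F + G)" and m: "\<And>F G. P F \<Longrightarrow> P G \<Longrightarrow> P (F * G)"
  shows "P F"
proof -
  have pw: "P (Poly_Mapping.single (Poly_Mapping.single i k) 1)" for i k
  proof (induction k)
    case 0
    then show ?case using c[of 1] by simp
  next
    case (Suc k)
    have "Poly_Mapping.single (Poly_Mapping.single i (Suc k)) (1::'k) =
        mvar i * Poly_Mapping.single (Poly_Mapping.single i k) 1"
      by (simp add: mvar_def mult_single flip: single_add)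
    then show ?case using m[OF v Suc.IH] by simp
  qed
  have mon: "P (Poly_Mapping.single (\<Sum>i\<in>A. Poly_Mapping.single i (f i)) 1)"
    if "finite A" for A and f :: "'n \<Rightarrow> nat"
    using that
  proof induction
    case empty
    then show ?case using c[of 1] by simp
  next
    case (insert x A)
    have "Poly_Mapping.single (\<Sum>i\<in>insert x A. Poly_Mapping.single i (f i)) (1::'k) =
        Poly_Mapping.single (Poly_Mapping.single x (f x)) 1 *
        Poly_Mapping.single (\<Sum>i\<in>A. Poly_Mapping.single i (f i)) 1"
      using insert by (simp add: mult_single)
    then show ?case using m[OF pw insert.IH] by simp
  qed
  have sm: "P (Poly_Mapping.single k c)" for k c
  proof -
    have "(\<Sum>i\<in>UNIV. Poly_Mapping.single i (Poly_Mapping.lookup k i)) = k"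
      by (rule poly_mapping_eqI) (simp add: lookup_sum lookup_single when_def)
    then have "P (Poly_Mapping.single k 1)" using mon[of UNIV "Poly_Mapping.lookup k"] by simp
    from m[OF c[of c] this] show ?thesis by (simp add: mult_single)
  qed
  have "P (\<Sum>k\<in>A. Poly_Mapping.single k (Poly_Mapping.lookup F k))" if "finite A" for A
    using that by induction (use c[of 0] a sm in auto)
  moreover have "(\<Sum>k\<in>Poly_Mapping.keys F. Poly_Mapping.single k (Poly_Mapping.lookup F k)) = F"
    by (rule poly_mapping_eqI) (auto simp: lookup_sum lookup_single when_def in_keys_iff)
  ultimately show ?thesis by (metis finite_keys)
qed

text \<open>The identity yields evaluation, the constants of \<open>'k poly\<close> yield
  restriction to curves, and \<open>mconst\<close> starts the chain of homomorphisms
  \<open>poly1\<close>, \<open>poly2\<close> in which normal forms are written.\<close>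

locale coeff_hom =
  fixes \<phi> :: "'k::comm_ring_1 \<Rightarrow> 'r::comm_ring_1"
  assumes hom_add: "\<phi> (a + b) = \<phi> a + \<phi> b"
    and hom_mult: "\<phi> (a * b) = \<phi> a * \<phi> b"
    and hom_one: "\<phi> 1 = 1"
begin

lemma hom_zero: "\<phi> 0 = 0"
  using hom_add[of 0 0] by simp

lemma hom_diff: "\<phi> (a - b) = \<phi> a - \<phi> b"
  using hom_add[of "a - b" b] by simp

lemma subst_superset:
  assumes "finite A" "Poly_Mapping.keys F \<subseteq> A"
  shows "mpol_subst \<phi> w F =
    (\<Sum>m\<in>A. \<phi> (Poly_Mapping.lookup F m) * (\<Prod>i\<in>UNIV. w i ^ Poly_Mapping.lookup m i))"
  unfolding mpol_subst_def
  by (rule sum.mono_neutral_left) (use assms in \<open>auto simp: in_keys_iff hom_zero\<close>)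

lemma subst_add: "mpol_subst \<phi> w (F + G) = mpol_subst \<phi> w F + mpol_subst \<phi> w G"
proof -
  let ?A = "Poly_Mapping.keys F \<union> Poly_Mapping.keys G"
  have "Poly_Mapping.keys (F + G) \<subseteq> ?A" by (rule keys_add)
  then show ?thesis
    by (simp add: subst_superset[of ?A] lookup_add hom_add distrib_right sum.distrib)
qed

lemma subst_single:
  "mpol_subst \<phi> w (Poly_Mapping.single m c) = \<phi> c * (\<Prod>i\<in>UNIV. w i ^ Poly_Mapping.lookup m i)"
  by (subst subst_superset[of "{m}"]) auto

lemma subst_zero: "mpol_subst \<phi> w 0 = 0"
  by (simp add: mpol_subst_def)

lemma subst_const: "mpol_subst \<phi> w (mconst c) = \<phi> c"
  by (simp add: subst_single)

lemma subst_var: "mpol_subst \<phi> w (mvar i) = w i"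
proof -
  have "(\<Prod>j\<in>UNIV. w j ^ Poly_Mapping.lookup (Poly_Mapping.single i (1::nat)) j) =
      (\<Prod>j\<in>UNIV. if j = i then w j else 1)"
    by (intro prod.cong refl) (simp add: lookup_single when_def)
  then show ?thesis by (simp add: mvar_def subst_single hom_one)
qed

lemma subst_sum: "mpol_subst \<phi> w (sum f A) = (\<Sum>a\<in>A. mpol_subst \<phi> w (f a))"
  by (induction A rule: infinite_finite_induct) (auto simp: subst_zero subst_add)

lemma subst_single_mult:
  "mpol_subst \<phi> w (Poly_Mapping.single m c * G) =
    mpol_subst \<phi> w (Poly_Mapping.single m c) * mpol_subst \<phi> w G"
proof -
  have G: "G = (\<Sum>k\<in>Poly_Mapping.keys G. Poly_Mapping.single k (Poly_Mapping.lookup G k))"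
    by (rule poly_mapping_eqI) (auto simp: lookup_sum lookup_single when_def in_keys_iff)
  have *: "mpol_subst \<phi> w (Poly_Mapping.single m c * Poly_Mapping.single k d) =
    mpol_subst \<phi> w (Poly_Mapping.single m c) * mpol_subst \<phi> w (Poly_Mapping.single k d)" for k d
    by (simp add: mult_single subst_single hom_mult lookup_add power_add prod.distrib mult_ac)
  show ?thesis
    by (subst (1 2) G) (simp add: sum_distrib_left subst_sum *)
qed

lemma subst_mult: "mpol_subst \<phi> w (F * G) = mpol_subst \<phi> w F * mpol_subst \<phi> w G"
proof -
  have F: "F = (\<Sum>k\<in>Poly_Mapping.keys F. Poly_Mapping.single k (Poly_Mapping.lookup F k))"
    by (rule poly_mapping_eqI) (auto simp: lookup_sum lookup_single when_def in_keys_iff)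
  show ?thesis
    by (subst (1 2) F) (simp add: sum_distrib_right subst_sum subst_single_mult)
qed

lemma subst_one: "mpol_subst \<phi> w 1 = 1"
  using subst_const[of w 1] by (simp add: hom_one)

lemma subst_minus: "mpol_subst \<phi> w (- F) = - mpol_subst \<phi> w F"
  using subst_add[of w F "- F"] by (simp add: subst_zero add_eq_0_iff)

lemma subst_diff: "mpol_subst \<phi> w (F - G) = mpol_subst \<phi> w F - mpol_subst \<phi> w G"
  using subst_add[of w F "- G"] by (simp add: subst_minus)

lemma subst_power: "mpol_subst \<phi> w (F ^ k) = mpol_subst \<phi> w F ^ k"
  by (induction k) (auto simp: subst_one subst_mult)

end

interpretation id_hom: coeff_hom "\<lambda>c::'k::comm_ring_1. c"
  by unfold_locales auto

interpretation pconst_hom: coeff_hom "\<lambda>c::'k::comm_ring_1. [:c:]"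
  by unfold_locales (auto simp: one_pCons)

interpretation mconst_hom: coeff_hom "mconst :: 'k::comm_ring_1 \<Rightarrow> ('n, 'k) mpol"
  by unfold_locales (auto simp: single_add mult_single)

lemma mpol_eval_add [simp]: "mpol_eval (F + G) v = mpol_eval F v + mpol_eval G v"
  and mpol_eval_mult [simp]: "mpol_eval (F * G) v = mpol_eval F v * mpol_eval G v"
  and mpol_eval_diff [simp]: "mpol_eval (F - G) v = mpol_eval F v - mpol_eval G v"
  and mpol_eval_power [simp]: "mpol_eval (F ^ k) v = mpol_eval F v ^ k"
  and mpol_eval_sum [simp]: "mpol_eval (sum f A) v = (\<Sum>a\<in>A. mpol_eval (f a) v)"
  and mpol_eval_zero [simp]: "mpol_eval 0 v = 0"
  and mpol_eval_one [simp]: "mpol_eval 1 v = 1"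
  and mpol_eval_const [simp]: "mpol_eval (mconst c) v = c"
  and mpol_eval_var [simp]: "mpol_eval (mvar i) v = v $ i"
  unfolding mpol_eval_subst
  by (simp_all only: id_hom.subst_add id_hom.subst_mult id_hom.subst_diff
      id_hom.subst_power id_hom.subst_sum id_hom.subst_zero id_hom.subst_one id_hom.subst_const
      id_hom.subst_var)

text \<open>The restriction of \<open>F\<close> to the curve with components \<open>w\<close>. It is
  kept as a polynomial in the parameter, so that degrees can be compared and the finiteness of its
  roots can be used.\<close>

definition mpol_path :: "('n::finite \<Rightarrow> 'k::comm_ring_1 poly) \<Rightarrow> ('n, 'k) mpol \<Rightarrow> 'k poly" where
  "mpol_path w F = mpol_subst (\<lambda>c. [:c:]) w F"

lemma mpol_path_mult: "mpol_path w (F * G) = mpol_path w F * mpol_path w G"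
  and mpol_path_sum: "mpol_path w (sum f A) = (\<Sum>a\<in>A. mpol_path w (f a))"
  by (simp_all add: mpol_path_def pconst_hom.subst_mult pconst_hom.subst_sum)

lemma poly_mpol_path: "poly (mpol_path w F) t = mpol_eval F (\<chi> i. poly (w i) t)"
  by (simp add: mpol_path_def mpol_subst_def mpol_eval_def poly_sum poly_prod)

section \<open>Forms\<close>

text \<open>Along the line through 0 and \<open>v\<close> each term of degree \<open>d\<close>
  contributes its value at \<open>v\<close> times the d-th power of the parameter. Degrees of forms
  thus become exponents in one variable.\<close>

lemma homogeneous_mpol_path:
  assumes "homogeneous d F"
  shows "mpol_path (\<lambda>i. [:0, v $ i:]) F = monom (mpol_eval F v) d"
proof -
  have lin: "[:0, c:] = monom c 1" for c :: 'b by (simp add: monom_altdef)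
  have "[:c:] * (\<Prod>i\<in>UNIV. [:0, v $ i:] ^ Poly_Mapping.lookup m i) =
      monom (c * (\<Prod>i\<in>UNIV. v $ i ^ Poly_Mapping.lookup m i)) d"
    if "m \<in> Poly_Mapping.keys F" for m c
  proof -
    have "(\<Prod>i\<in>A. monom (v $ i ^ Poly_Mapping.lookup m i) (Poly_Mapping.lookup m i)) =
        monom (\<Prod>i\<in>A. v $ i ^ Poly_Mapping.lookup m i) (\<Sum>i\<in>A. Poly_Mapping.lookup m i)"
      if "finite A" for A
      using that by induction (auto simp: mult_monom monom_0 one_pCons)
    moreover have "(\<Sum>i\<in>UNIV. Poly_Mapping.lookup m i) = d"
      using assms that by (auto simp: homogeneous_def)
    ultimately show ?thesis by (simp add: lin monom_power smult_monom)
  qed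
  then show ?thesis
    by (simp add: mpol_path_def mpol_subst_def mpol_eval_def monom_sum)
qed

lemma homogeneous_scale:
  assumes "homogeneous d F"
  shows "mpol_eval F (c *s v) = c ^ d * mpol_eval F v"
proof -
  have "mpol_eval F (c *s v) = poly (mpol_path (\<lambda>i. [:0, v $ i:]) F) c"
    by (simp add: poly_mpol_path vector_scalar_mult_def)
  then show ?thesis by (simp add: homogeneous_mpol_path[OF assms] poly_monom mult.commute)
qed

lemma homogeneous_zero [simp]: "homogeneous d 0"
  by (simp add: homogeneous_def)

lemma homogeneous_add: "homogeneous d F \<Longrightarrow> homogeneous d G \<Longrightarrow> homogeneous d (F + G)"
  using keys_add[of F G] by (auto simp: homogeneous_def)

lemma homogeneous_minus: "homogeneous d F \<Longrightarrow> homogeneous d (- F)"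
  by (auto simp: homogeneous_def in_keys_iff)

lemma homogeneous_diff: "homogeneous d F \<Longrightarrow> homogeneous d G \<Longrightarrow> homogeneous d (F - G)"
  using homogeneous_add[of d F "- G"] homogeneous_minus[of d G] by simp

lemma homogeneous_sum: "(\<And>i. i \<in> A \<Longrightarrow> homogeneous d (f i)) \<Longrightarrow> homogeneous d (sum f A)"
  by (induction A rule: infinite_finite_induct) (auto intro: homogeneous_add)

lemma homogeneous_mult:
  assumes "homogeneous d F" "homogeneous e G"
  shows "homogeneous (d + e) (F * G)"
  unfolding homogeneous_def
proof
  fix m assume "m \<in> Poly_Mapping.keys (F * G)"
  then obtain a b where "m = a + b" "a \<in> Poly_Mapping.keys F" "b \<in> Poly_Mapping.keys G"
    using keys_mult[of F G] by blast
  then show "(\<Sum>i\<in>UNIV. Poly_Mapping.lookup m i) = d + e"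
    using assms by (auto simp: homogeneous_def lookup_add sum.distrib)
qed

lemma homogeneous_const: "homogeneous 0 (mconst c)"
  by (simp add: homogeneous_def)

lemma homogeneous_var: "homogeneous 1 (mvar i :: ('n::finite, 'k::comm_ring_1) mpol)"
  by (simp add: mvar_def homogeneous_def lookup_single when_def)

lemma homogeneous_power: "homogeneous d F \<Longrightarrow> homogeneous (k * d) (F ^ k)"
  by (induction k) (use homogeneous_const[of 1] in \<open>auto intro: homogeneous_mult\<close>)

definition dot :: "'k::comm_ring_1 ^ 'n::finite \<Rightarrow> 'k ^ 'n \<Rightarrow> 'k" where
  "dot c v = (\<Sum>i\<in>UNIV. c $ i * v $ i)"

definition lin_form :: "'k::comm_ring_1 ^ 'n::finite \<Rightarrow> ('n, 'k) mpol" where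
  "lin_form c = (\<Sum>i\<in>UNIV. mconst (c $ i) * mvar i)"

lemma mpol_eval_lin_form [simp]: "mpol_eval (lin_form c) v = dot c v"
  by (simp add: lin_form_def dot_def)

lemma homogeneous_lin_form: "homogeneous 1 (lin_form c)"
  unfolding lin_form_def
  using homogeneous_mult[OF homogeneous_const homogeneous_var] by (intro homogeneous_sum) auto

lemma dot_add_right: "dot c (v + w) = dot c v + dot c w"
  and dot_add_left: "dot (c + d) v = dot c v + dot d v"
  and dot_scale_right: "dot c (k *s v) = k * dot c v"
  and dot_scale_left: "dot (k *s c) v = k * dot c v"
  by (simp_all add: dot_def algebra_simps sum.distrib sum_distrib_left)

lemma dot_zero_right [simp]: "dot c 0 = 0"
  and dot_zero_left [simp]: "dot 0 c = 0"
  by (simp_all add: dot_def)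

lemma dot_diff_right: "dot c (v - w) = dot c v - dot c w"
  by (simp add: dot_def algebra_simps sum_subtractf)

lemma dot_sum_right: "dot c (sum f A) = (\<Sum>a\<in>A. dot c (f a))"
  by (induction A rule: infinite_finite_induct) (auto simp: dot_add_right)

lemma dot_sum_left: "dot (sum f A) c = (\<Sum>a\<in>A. dot (f a) c)"
  by (induction A rule: infinite_finite_induct) (auto simp: dot_add_left)

lemma dot_axis [simp]: "dot c (axis i 1) = c $ i"
  by (simp add: dot_def axis_def if_distrib cong: if_cong)

text \<open>An exponent vector of total degree one is a unit vector, so only coefficients of single
  variables occur.\<close>

lemma homogeneous_1_eval:
  assumes "homogeneous 1 F"
  obtains c where "\<And>v. mpol_eval F v = dot c v"
proof -
  have "\<exists>i. m = Poly_Mapping.single i 1" if "m \<in> Poly_Mapping.keys F" for m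
  proof -
    have s: "(\<Sum>i\<in>UNIV. Poly_Mapping.lookup m i) = 1"
      using assms that by (auto simp: homogeneous_def)
    then obtain i where "Poly_Mapping.lookup m i = 1" "\<And>j. j \<noteq> i \<Longrightarrow> Poly_Mapping.lookup m j = 0"
      using sum_eq_Suc0_iff[of "UNIV::'a set" "Poly_Mapping.lookup m"] by auto
    then have "m = Poly_Mapping.single i 1"
      by (intro poly_mapping_eqI) (auto simp: lookup_single when_def)
    then show ?thesis ..
  qed
  then have "Poly_Mapping.keys F \<subseteq> (\<lambda>i. Poly_Mapping.single i 1) ` UNIV" by auto
  then have "mpol_eval F v = (\<Sum>m\<in>(\<lambda>i. Poly_Mapping.single i 1) ` UNIV.
      Poly_Mapping.lookup F m * (\<Prod>i\<in>UNIV. v $ i ^ Poly_Mapping.lookup m i))" for v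
    unfolding mpol_eval_subst by (intro id_hom.subst_superset) auto
  also have "\<dots> v = (\<Sum>j\<in>UNIV. Poly_Mapping.lookup F (Poly_Mapping.single j 1) *
      (\<Prod>i\<in>UNIV. v $ i ^ Poly_Mapping.lookup (Poly_Mapping.single j (1::nat)) i))" for v
    by (subst sum.reindex) (auto intro!: injI simp: poly_mapping_eq_iff fun_eq_iff lookup_single when_def split: if_splits)
  also have "\<dots> v = (\<Sum>j\<in>UNIV. Poly_Mapping.lookup F (Poly_Mapping.single j 1) * v $ j)" for v
  proof (intro sum.cong refl arg_cong2[where f = "(*)"])
    fix j :: 'a
    have "(\<Prod>i\<in>UNIV. v $ i ^ Poly_Mapping.lookup (Poly_Mapping.single j (1::nat)) i) =
      (\<Prod>i\<in>UNIV. if i = j then v $ i else 1)"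
      by (intro prod.cong refl) (simp add: lookup_single when_def)
    then show "(\<Prod>i\<in>UNIV. v $ i ^ Poly_Mapping.lookup (Poly_Mapping.single j (1::nat)) i) = v $ j"
      by simp
  qed
  finally show thesis
    by (intro that[of "\<chi> j. Poly_Mapping.lookup F (Poly_Mapping.single j 1)"]) (simp add: dot_def)
qed

section \<open>Ideals\<close>

interpretation ring_mod: module "(*) :: 'a::comm_ring_1 \<Rightarrow> 'a \<Rightarrow> 'a"
  by (rule module_mult_self)

text \<open>With multiplication as scaling, this rule reassociates products to the left and would
  work against \<open>mult.assoc\<close>.\<close>

lemmas [simp del] = ring_mod.scale_scale

definition is_ideal :: "'a::comm_ring_1 set \<Rightarrow> bool" where
  "is_ideal I \<longleftrightarrow> ring_mod.subspace I"

lemma is_idealI: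
  "0 \<in> I \<Longrightarrow> (\<And>x y. x \<in> I \<Longrightarrow> y \<in> I \<Longrightarrow> x + y \<in> I) \<Longrightarrow> (\<And>c x. x \<in> I \<Longrightarrow> c * x \<in> I) \<Longrightarrow> is_ideal I"
  unfolding is_ideal_def by (rule ring_mod.subspaceI)

lemma ideal_zero: "is_ideal I \<Longrightarrow> 0 \<in> I"
  and ideal_add: "is_ideal I \<Longrightarrow> x \<in> I \<Longrightarrow> y \<in> I \<Longrightarrow> x + y \<in> I"
  and ideal_mult: "is_ideal I \<Longrightarrow> x \<in> I \<Longrightarrow> c * x \<in> I"
  and ideal_diff: "is_ideal I \<Longrightarrow> x \<in> I \<Longrightarrow> y \<in> I \<Longrightarrow> x - y \<in> I"
  and ideal_sum: "is_ideal I \<Longrightarrow> (\<And>x. x \<in> B \<Longrightarrow> f x \<in> I) \<Longrightarrow> sum f B \<in> I"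
  unfolding is_ideal_def
  by (auto intro: ring_mod.subspace_0 ring_mod.subspace_add ring_mod.subspace_scale
      ring_mod.subspace_diff ring_mod.subspace_sum)

lemma ideal_mult_right: "is_ideal I \<Longrightarrow> x \<in> I \<Longrightarrow> x * c \<in> I"
  using ideal_mult[of I x c] by (simp add: mult.commute)

lemma is_ideal_gen [simp]: "is_ideal (ideal_gen S)"
  by (simp add: is_ideal_def ideal_gen_def)

lemma ideal_gen_base: "x \<in> S \<Longrightarrow> x \<in> ideal_gen S"
  by (simp add: ideal_gen_def ring_mod.span_base)

lemma ideal_gen_minimal: "S \<subseteq> I \<Longrightarrow> is_ideal I \<Longrightarrow> ideal_gen S \<subseteq> I"
  by (simp add: ideal_gen_def is_ideal_def ring_mod.span_minimal)

lemma ideal_gen_singleton: "ideal_gen {H} = {c * H | c. True}"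
  by (auto simp: ideal_gen_def ring_mod.span_singleton)

lemma ideal_gen_Un_singleton:
  assumes "is_ideal I"
  shows "ideal_gen (I \<union> ideal_gen {H}) = {x + c * H | x c. x \<in> I}"
proof -
  have "ideal_gen I = I"
    using assms unfolding is_ideal_def ideal_gen_def by (simp only: ring_mod.span_eq_iff)
  moreover have "ideal_gen (ideal_gen {H}) = ideal_gen {H}"
    unfolding ideal_gen_def by (simp only: ring_mod.span_span)
  ultimately show ?thesis
    using ring_mod.span_Un[of I "ideal_gen {H}"] unfolding ideal_gen_def[symmetric]
    by (auto simp: ideal_gen_singleton)
qed

text \<open>The coefficients are indexed by positions, since generators may repeat and are paired
  with their degrees by position.\<close>

lemma ideal_gen_list_explicit:
  fixes f :: "'a::comm_ring_1 list"
  assumes "F \<in> ideal_gen (set f)"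
  obtains g where "F = (\<Sum>i<length f. g i * f ! i)"
proof -
  let ?J = "{\<Sum>i<length f. g i * f ! i | g. True}"
  have "is_ideal ?J"
  proof (rule is_idealI)
    show "0 \<in> ?J" by (intro CollectI exI[of _ "\<lambda>_. 0"] conjI TrueI) simp
  next
    fix x y assume "x \<in> ?J" "y \<in> ?J"
    then obtain g h where "x = (\<Sum>i<length f. g i * f ! i)" "y = (\<Sum>i<length f. h i * f ! i)" by auto
    then show "x + y \<in> ?J"
      by (intro CollectI exI[of _ "\<lambda>i. g i + h i"] conjI TrueI) (simp add: distrib_right sum.distrib)
  next
    fix c x assume "x \<in> ?J"
    then obtain g where "x = (\<Sum>i<length f. g i * f ! i)" by blast
    then have "c * x = (\<Sum>i<length f. (c * g i) * f ! i)"
      by (simp only: sum_distrib_left mult.assoc)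
    then show "c * x \<in> ?J" by (intro CollectI exI[of _ "\<lambda>i. c * g i"] conjI TrueI)
  qed
  moreover have "set f \<subseteq> ?J"
  proof
    fix x assume "x \<in> set f"
    then obtain j where "j < length f" "x = f ! j" by (auto simp: in_set_conv_nth)
    then have "x = (\<Sum>i<length f. (if i = j then 1 else 0) * f ! i)"
      by (simp add: sum.remove[of "{..<length f}" j])
    then show "x \<in> ?J" by (intro CollectI exI[of _ "\<lambda>i. if i = j then 1 else 0"] conjI TrueI)
  qed
  ultimately have "F \<in> ?J" using assms ideal_gen_minimal by blast
  then show thesis using that by auto
qed

text \<open>Comparing terms of degree \<open>d\<close> along the line through \<open>v\<close> leaves only generators of degree
  at most \<open>d\<close> that do not vanish at \<open>v\<close>, so the forms of degree \<open>d\<close> in an ideal are, on the common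
  zeros of the generators of lower degree, constant combinations of the generators of degree \<open>d\<close>.\<close>

lemma ideal_gen_degree:
  assumes F: "F \<in> ideal_gen (set f)" and d: "homogeneous d F"
    and len: "length f = length a" and hom: "\<forall>i<length a. homogeneous (a ! i) (f ! i)"
  shows "\<exists>k. \<forall>v. (\<forall>i<length a. a ! i < d \<longrightarrow> mpol_eval (f ! i) v = 0) \<longrightarrow>
    mpol_eval F v = (\<Sum>i\<in>{i. i < length a \<and> a ! i = d}. k i * mpol_eval (f ! i) v)"
proof -
  obtain g where g: "F = (\<Sum>i<length f. g i * f ! i)"
    using F by (rule ideal_gen_list_explicit)
  show ?thesis
  \<comment> \<open>Only the constant term of \<open>g i\<close> can meet a generator of degree
    exactly \<open>d\<close>. It is the value of \<open>g i\<close> at 0 and thus independent of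
    \<open>v\<close>.\<close>
  proof (intro exI[of _ "\<lambda>i. mpol_eval (g i) 0"] allI impI)
    fix v assume v: "\<forall>i<length a. a ! i < d \<longrightarrow> mpol_eval (f ! i) v = 0"
    let ?r = "mpol_path (\<lambda>i. [:0, v $ i:])"
    have c0: "coeff (?r G) 0 = mpol_eval G 0" for G
      by (simp add: poly_0_coeff_0[symmetric] poly_mpol_path zero_vec_def)
    have "mpol_eval F v = coeff (?r F) d" by (simp add: homogeneous_mpol_path[OF d])
    also have "\<dots> = (\<Sum>i<length a. coeff (?r (g i) * ?r (f ! i)) d)"
      by (simp add: g mpol_path_sum mpol_path_mult coeff_sum len)
    also have "\<dots> = (\<Sum>i<length a. if a ! i = d then mpol_eval (g i) 0 * mpol_eval (f ! i) v else 0)"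
    proof (rule sum.cong[OF refl])
      fix i assume "i \<in> {..<length a}"
      then have i: "i < length a" by simp
      have "coeff (?r (g i) * ?r (f ! i)) d =
        (if a ! i \<le> d then coeff (?r (g i)) (d - a ! i) * mpol_eval (f ! i) v else 0)"
        by (simp add: homogeneous_mpol_path[OF hom[rule_format, OF i]] mult.commute[of "?r (g i)"]
            coeff_monom_mult)
      then show "coeff (?r (g i) * ?r (f ! i)) d =
        (if a ! i = d then mpol_eval (g i) 0 * mpol_eval (f ! i) v else 0)"
        using v[rule_format, OF i] by (cases "a ! i" d rule: linorder_cases) (auto simp: c0)
    qed
    also have "\<dots> = (\<Sum>i\<in>{i. i < length a \<and> a ! i = d}. mpol_eval (g i) 0 * mpol_eval (f ! i) v)"
      by (simp add: sum.If_cases Int_def lessThan_def)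
    finally show "mpol_eval F v = \<dots>" .
  qed
qed

section \<open>Linear algebra\<close>

text \<open>Gaussian elimination: a pivot \<open>p\<close> in equation \<open>i\<close> removes one
  equation and one unknown at once, and the value of the removed unknown is read off from equation
  \<open>i\<close>. An equation without pivot is simply dropped.\<close>

lemma homogeneous_system_solution:
  fixes A :: "'i \<Rightarrow> 'j \<Rightarrow> 'k::field"
  assumes "finite I" "finite J" "card I < card J"
  obtains c j where "j \<in> J" "c j \<noteq> 0" "\<And>i. i \<in> I \<Longrightarrow> (\<Sum>j\<in>J. A i j * c j) = 0"
proof -
  have "\<exists>c. (\<exists>j\<in>J. c j \<noteq> 0) \<and> (\<forall>i\<in>I. (\<Sum>j\<in>J. A i j * c j) = 0)"
    using assms
  proof (induction I arbitrary: J A)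
    case empty
    then obtain j where "j \<in> J" by fastforce
    then show ?case by (intro exI[of _ "\<lambda>_. 1"]) auto
  next
    case (insert i I)
    show ?case
    proof (cases "\<forall>j\<in>J. A i j = 0")
      case True
      from insert.prems insert.hyps have "card I < card J" by simp
      from insert.IH[OF insert.prems(1) this, of A] True show ?thesis by auto
    next
      case False
      then obtain p where p: "p \<in> J" "A i p \<noteq> 0" by auto
      define J' where "J' = J - {p}"
      have J: "J = insert p J'" "p \<notin> J'" "finite J'"
        using p insert.prems by (auto simp: J'_def)
      have "card I < card J'" using insert J by simp
      from insert.IH[OF J(3) this, of "\<lambda>k j. A k j - A k p / A i p * A i j"]
      obtain c j where c: "j \<in> J'" "c j \<noteq> 0"
        "\<And>k. k \<in> I \<Longrightarrow> (\<Sum>j\<in>J'. (A k j - A k p / A i p * A i j) * c j) = 0" by auto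
      define d where "d = (\<lambda>j. if j = p then - (\<Sum>j\<in>J'. A i j * c j) / A i p else c j)"
      have s: "(\<Sum>j\<in>J. A k j * d j) = A k p * (- (\<Sum>j\<in>J'. A i j * c j) / A i p) + (\<Sum>j\<in>J'. A k j * c j)"
        for k
      proof -
        have "(\<Sum>j\<in>J'. A k j * d j) = (\<Sum>j\<in>J'. A k j * c j)"
          using J by (intro sum.cong) (auto simp: d_def)
        then show ?thesis using J by (simp add: d_def)
      qed
      have "(\<Sum>j\<in>J. A k j * d j) = 0" if "k \<in> insert i I" for k
      proof (cases "k = i")
        case True
        have "x * (- y / x) + y = 0" if "x \<noteq> 0" for x y :: 'k using that by simp
        then show ?thesis using p unfolding True s by blast
      next
        case False
        have "(\<Sum>j\<in>J'. (A k j - A k p / A i p * A i j) * c j) =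
          (\<Sum>j\<in>J'. A k j * c j) - A k p / A i p * (\<Sum>j\<in>J'. A i j * c j)"
          by (simp only: left_diff_distrib sum_subtractf sum_distrib_left mult.assoc)
        then have "(\<Sum>j\<in>J'. A k j * c j) = A k p / A i p * (\<Sum>j\<in>J'. A i j * c j)"
          using c(3)[of k] that False by simp
        then show ?thesis unfolding s by simp
      qed
      moreover have "j \<in> J" "d j \<noteq> 0" using c J by (auto simp: d_def)
      ultimately show ?thesis by blast
    qed
  qed
  then show thesis using that by blast
qed

lemma dual_basis:
  fixes T :: "('k::field ^ 'n::finite) set"
  assumes "vec.independent T"
  obtains \<phi> where "\<And>s t. s \<in> T \<Longrightarrow> t \<in> T \<Longrightarrow> dot (\<phi> s) t = (if s = t then 1 else 0)"
proof -
  have "\<exists>c. \<forall>t\<in>T. dot c t = (if s = t then 1 else 0)" for s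
  proof -
    \<comment> \<open>The Kronecker delta is extended as a linear map into \<open>'k ^ 'n\<close>,
      with the all-ones vector in place of the scalar 1. Any single coordinate \<open>k\<close> of
      this map is then the functional sought.\<close>
    obtain g where g: "Vector_Spaces.linear (*s) (*s) g"
      "\<And>t. t \<in> T \<Longrightarrow> g t = (if s = t then (1 :: 'k ^ 'n) else 0)"
      using vec.linear_independent_extend[OF assms, of "\<lambda>t. if s = t then 1 else 0"] by auto
    define k :: 'n where "k = undefined"
    have "dot (\<chi> i. g (axis i 1) $ k) t = g t $ k" for t
      using linear_componentwise[OF g(1), of t k] by (simp add: dot_def mult.commute)
    then show ?thesis using g(2)
      by (intro exI[of _ "\<chi> i. g (axis i 1) $ k"]) auto
  qed
  then show thesis using that by metis
qed

lemma dual_basis_expansion: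
  assumes d: "\<And>s t. s \<in> T \<Longrightarrow> t \<in> T \<Longrightarrow> dot (\<phi> s) t = (if s = t then 1 else 0)"
    and "finite T" "v \<in> vec.span T"
  shows "v = (\<Sum>t\<in>T. dot (\<phi> t) v *s t)"
proof -
  obtain u where u: "v = (\<Sum>t\<in>T. u t *s t)"
    using assms(2,3) by (auto simp: vec.span_finite)
  have "dot (\<phi> s) v = u s" if "s \<in> T" for s
    using that assms(2) by (simp add: u dot_sum_right dot_scale_right d if_distrib[where f = "(*) a" for a] cong: sum.cong if_cong)
  then show ?thesis by (simp add: u)
qed

lemma independent_if_dual:
  assumes d: "\<And>s t. s \<in> T \<Longrightarrow> t \<in> T \<Longrightarrow> dot (\<phi> s) t = (if s = t then 1 else 0)"
    and "finite T"
  shows "vec.independent T"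
proof (rule vec.independent_if_scalars_zero[OF assms(2)])
  fix f x assume z: "(\<Sum>x\<in>T. f x *s x) = 0" and x: "x \<in> T"
  have "dot (\<phi> x) (\<Sum>x\<in>T. f x *s x) = f x"
    using x assms(2) by (simp add: dot_sum_right dot_scale_right d if_distrib[where f = "(*) a" for a] cong: sum.cong if_cong)
  then show "f x = 0" by (simp add: z)
qed

lemma vec_finite_independent: "vec.independent (T :: ('k::field ^ 'n::finite) set) \<Longrightarrow> finite T"
  by (rule vec.finiteI_independent)

lemma subspace_annihilated: "vec.subspace {v. dot c v = 0}"
  by (rule vec.subspaceI) (auto simp: dot_add_right dot_scale_right)

lemma dot_span_zero:
  assumes "\<And>t. t \<in> T \<Longrightarrow> dot c t = 0" "v \<in> vec.span T"
  shows "dot c v = 0"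
proof -
  have "T \<subseteq> {v. dot c v = 0}" using assms(1) by blast
  then have "vec.span T \<subseteq> {v. dot c v = 0}" by (rule vec.span_minimal[OF _ subspace_annihilated])
  then show ?thesis using assms(2) by blast
qed

lemma vec_separate:
  assumes "vec.subspace N" "u \<notin> N"
  obtains c where "\<And>v. v \<in> N \<Longrightarrow> dot c v = 0" "dot c u = 1"
proof -
  obtain T where T: "T \<subseteq> N" "vec.independent T" "N \<subseteq> vec.span T"
    by (rule vec.basis_exists[of N])
  have "vec.span T = N"
    using T(3) vec.span_minimal[OF T(1) assms(1)] by (rule subset_antisym[rotated])
  then have u: "u \<notin> vec.span T" using assms by simp
  then have "u \<notin> T" by (auto intro: vec.span_base)
  obtain \<phi> where d: "\<And>s t. s \<in> insert u T \<Longrightarrow> t \<in> insert u T \<Longrightarrow> dot (\<phi> s) t = (if s = t then 1 else 0)"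
    using dual_basis[OF vec.independent_insertI[OF u T(2)]] by blast
  show thesis
  proof (rule that[of "\<phi> u"])
    fix v assume "v \<in> N"
    with \<open>vec.span T = N\<close> have "v \<in> vec.span T" by simp
    then show "dot (\<phi> u) v = 0"
      by (rule dot_span_zero[rotated]) (use d \<open>u \<notin> T\<close> in auto)
  qed (simp add: d)
qed

lemma vec_extend_basis:
  fixes W :: "('k::field ^ 'n::finite) set"
  assumes "vec.subspace W"
  obtains T B where "T \<subseteq> B" "vec.independent B" "vec.span B = UNIV" "vec.span T = W"
    "card (B - T) = CARD('n) - vec.dim W" "vec.independent T"
proof -
  obtain T where T: "T \<subseteq> W" "vec.independent T" "W \<subseteq> vec.span T" "card T = vec.dim W"
    by (rule vec.basis_exists[of W])
  obtain B where B: "T \<subseteq> B" "vec.independent B" "UNIV \<subseteq> vec.span B"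
    by (rule vec.maximal_independent_subset_extend[OF subset_UNIV T(2)])
  have "card B = CARD('n)"
    using vec.basis_card_eq_dim[of B UNIV] B by (simp add: card_cart_basis)
  then have "card (B - T) = CARD('n) - vec.dim W"
    using B(1) T(4) finite_subset[OF B(1) vec_finite_independent[OF B(2)]]
    by (simp add: card_Diff_subset)
  moreover have "vec.span T = W"
    using T(3) vec.span_minimal[OF T(1) assms] by (rule subset_antisym[rotated])
  moreover have "vec.span B = UNIV" using B(3) by (rule top.extremum_uniqueI)
  ultimately show thesis
    using that[of T B] B(1,2) T(2) by blast
qed

lemma dot_ext: "(\<And>v. dot c v = dot d v) \<Longrightarrow> c = d"
  by (metis dot_axis vec_eq_iff)

text \<open>In a basis adapted to \<open>W\<close>, the dual vectors of the basis elements outside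
  \<open>W\<close> do this. The exact length matters: these vectors become the linear generators of
  a complete intersection.\<close>

lemma annihilator_generators:
  fixes W :: "('k::field ^ 'n::finite) set"
  assumes "vec.subspace W"
  obtains cs where "length cs = CARD('n) - vec.dim W" "\<And>c w. c \<in> set cs \<Longrightarrow> w \<in> W \<Longrightarrow> dot c w = 0"
    "\<And>c. (\<And>w. w \<in> W \<Longrightarrow> dot c w = 0) \<Longrightarrow> c \<in> vec.span (set cs)"
proof -
  obtain T B where B: "T \<subseteq> B" "vec.independent B" "vec.span B = UNIV" "vec.span T = W"
    "card (B - T) = CARD('n) - vec.dim W"
    using vec_extend_basis[OF assms] by metis
  have fin: "finite B" using B vec_finite_independent by blast
  obtain \<phi> where d: "\<And>s t. s \<in> B \<Longrightarrow> t \<in> B \<Longrightarrow> dot (\<phi> s) t = (if s = t then 1 else 0)"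
    using dual_basis[OF B(2)] by blast
  obtain xs where xs: "set xs = B - T" "distinct xs" using finite_distinct_list[of "B - T"] fin by auto
  show thesis
  proof (rule that[of "map \<phi> xs"])
    show "length (map \<phi> xs) = CARD('n) - vec.dim W"
      using B(5) xs distinct_card[of xs] by simp
    show "dot c w = 0" if c: "c \<in> set (map \<phi> xs)" and w: "w \<in> W" for c w
    proof -
      obtain b where b: "b \<in> B - T" "c = \<phi> b" using c xs by auto
      show ?thesis
      proof (rule dot_span_zero[of T])
        show "dot c t = 0" if "t \<in> T" for t using that b B(1) by (subst b(2), subst d) auto
        show "w \<in> vec.span T" using w B(4) by simp
      qed
    qed
    show "c \<in> vec.span (set (map \<phi> xs))" if c: "\<And>w. w \<in> W \<Longrightarrow> dot c w = 0" for c
    proof -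
      have "dot c v = dot (\<Sum>b\<in>B. dot c b *s \<phi> b) v" for v
      proof -
        have "v = (\<Sum>b\<in>B. dot (\<phi> b) v *s b)"
          using dual_basis_expansion[OF d fin, of v] B by simp
        then have "dot c v = dot c (\<Sum>b\<in>B. dot (\<phi> b) v *s b)" by simp
        then show ?thesis
          by (simp add: dot_sum_right dot_sum_left dot_scale_right dot_scale_left mult.commute)
      qed
      then have "c = (\<Sum>b\<in>B. dot c b *s \<phi> b)" by (rule dot_ext)
      also have "\<dots> = (\<Sum>b\<in>B - T. dot c b *s \<phi> b)"
      proof (rule sum.mono_neutral_right[OF fin])
        show "\<forall>b\<in>B - (B - T). dot c b *s \<phi> b = 0"
          using c B(4) by (auto intro: vec.span_base)
      qed auto
      also have "\<dots> \<in> vec.span (set (map \<phi> xs))"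
        by (intro vec.span_sum vec.span_scale vec.span_base) (use xs in auto)
      finally show ?thesis .
    qed
  qed
qed

text \<open>With fewer equations than the codimension of \<open>N\<close>, some nonzero combination
  of basis vectors complementary to \<open>N\<close> would solve them all, although it does not lie
  in \<open>N\<close>.\<close>

lemma dim_common_zeros:
  fixes N :: "('k::field ^ 'n::finite) set"
  assumes "vec.subspace N" "finite I" "\<And>v. (\<And>i. i \<in> I \<Longrightarrow> dot (c i) v = 0) \<Longrightarrow> v \<in> N"
  shows "CARD('n) \<le> card I + vec.dim N"
proof (rule ccontr)
  assume *: "\<not> ?thesis"
  obtain T B where B: "T \<subseteq> B" "vec.independent B" "vec.span B = UNIV" "vec.span T = N"
    "card (B - T) = CARD('n) - vec.dim N"
    using vec_extend_basis[OF assms(1)] by metis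
  have fin: "finite B" using B vec_finite_independent by blast
  obtain \<phi> where d: "\<And>s t. s \<in> B \<Longrightarrow> t \<in> B \<Longrightarrow> dot (\<phi> s) t = (if s = t then 1 else 0)"
    using dual_basis[OF B(2)] by blast
  have "card I < card (B - T)" using * B(5) by simp
  then obtain g b where g: "b \<in> B - T" "g b \<noteq> 0" "\<And>i. i \<in> I \<Longrightarrow> (\<Sum>b\<in>B - T. dot (c i) b * g b) = 0"
    using homogeneous_system_solution[OF assms(2) finite_Diff[OF fin], of T "\<lambda>i. dot (c i)"] by blast
  let ?u = "\<Sum>b\<in>B - T. g b *s b"
  have "?u \<in> N"
    by (rule assms(3)) (use g(3) in \<open>simp add: dot_sum_right dot_scale_right mult.commute\<close>)
  then have "dot (\<phi> b) ?u = 0"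
    using dot_span_zero[of T "\<phi> b"] B g d by fastforce
  moreover have "dot (\<phi> b) ?u = (\<Sum>x\<in>B - T. if x = b then g b else 0)"
    using g(1) by (auto simp: dot_sum_right dot_scale_right d intro!: sum.cong)
  ultimately show False using g fin by simp
qed

section \<open>Closed sets and their dimension\<close>

lemma span_singleton_nonzero:
  "w \<in> vec.span {v :: 'k::field ^ 'n::finite} - {0} \<longleftrightarrow> v \<noteq> 0 \<and> (\<exists>c. c \<noteq> 0 \<and> w = c *s v)"
  by (auto simp: vec.span_singleton)

lemma span_singleton_scale:
  "c \<noteq> 0 \<Longrightarrow> vec.span {c *s v} = vec.span {v :: 'k::field ^ 'n::finite}"
  by (rule vec.span_eq[THEN iffD2])
    (auto simp: vec.span_singleton intro: range_eqI[of _ _ "inverse c"])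

lemma span_singleton_eqD:
  assumes "vec.span {v} = vec.span {w :: 'k::field ^ 'n::finite}" "v \<noteq> 0"
  obtains c where "c \<noteq> 0" "v = c *s w"
proof -
  have "v \<in> vec.span {w} - {0}" using assms by (auto simp flip: assms(1) intro: vec.span_base)
  then show thesis using that by (auto simp only: span_singleton_nonzero)
qed

lemma span_singleton_mem:
  assumes "w \<in> vec.span {v :: 'k::field ^ 'n::finite}" "w \<noteq> 0"
  shows "vec.span {w} = vec.span {v}"
  using assms span_singleton_nonzero[of w v] span_singleton_scale by auto

lemma proj_iff:
  assumes "vec.subspace (W :: ('k::field ^ 'n::finite) set)"
  shows "L \<in> proj W \<longleftrightarrow> (\<exists>v. v \<noteq> 0 \<and> v \<in> W \<and> L = vec.span {v})"
proof
  assume "L \<in> proj W"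
  then have L: "vec.subspace L" "vec.dim L = 1" "L \<subseteq> W" by (auto simp: proj_def)
  obtain B where B: "B \<subseteq> L" "vec.independent B" "L \<subseteq> vec.span B" "card B = vec.dim L"
    by (rule vec.basis_exists[of L])
  then obtain v where v: "B = {v}" using L by (auto simp: card_1_singleton_iff)
  have "L = vec.span {v}"
    using B v L(1) vec.span_minimal[of B L] by auto
  moreover have "v \<noteq> 0" using B v by simp
  ultimately show "\<exists>v. v \<noteq> 0 \<and> v \<in> W \<and> L = vec.span {v}" using B v L by blast
next
  assume "\<exists>v. v \<noteq> 0 \<and> v \<in> W \<and> L = vec.span {v}"
  then obtain v where v: "v \<noteq> 0" "v \<in> W" "L = vec.span {v}" by blast
  have "vec.span {v} \<subseteq> W" by (rule vec.span_minimal) (use v assms in auto)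
  then show "L \<in> proj W" using v by (auto simp: proj_def)
qed

lemma proj_UNIV_iff: "L \<in> proj UNIV \<longleftrightarrow> (\<exists>v::'k::field ^ 'n::finite. v \<noteq> 0 \<and> L = vec.span {v})"
  by (simp add: proj_iff)

lemma proj_UNIV_E:
  assumes "L \<in> proj UNIV"
  obtains v :: "'k::field ^ 'n::finite" where "v \<noteq> 0" "L = vec.span {v}"
  using assms by (auto simp: proj_UNIV_iff)

text \<open>The multiples \<open>c *s v\<close> matter because \<open>F\<close> need not be a form;
  for forms one representative is enough, see \<open>vanishes_at_form\<close>.\<close>

lemma vanishes_at_span:
  "v \<noteq> 0 \<Longrightarrow> vanishes_at F (vec.span {v}) \<longleftrightarrow> (\<forall>c. c \<noteq> 0 \<longrightarrow> mpol_eval F (c *s v) = 0)"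
  unfolding vanishes_at_def by (auto simp only: span_singleton_nonzero Ball_def)

lemma vanishes_at_form:
  assumes "homogeneous d F" "v \<noteq> 0"
  shows "vanishes_at F (vec.span {v}) \<longleftrightarrow> mpol_eval F v = 0"
  unfolding vanishes_at_span[OF assms(2)] homogeneous_scale[OF assms(1)]
  using one_neq_zero by auto

lemma vanishing_idealD:
  assumes "F \<in> vanishing_ideal X" "vec.span {v} \<in> X" "v \<noteq> 0"
  shows "mpol_eval F v = 0"
proof -
  have "vanishes_at F (vec.span {v})" using assms by (simp add: vanishing_ideal_def)
  then have "mpol_eval F (1 *s v) = 0" unfolding vanishes_at_span[OF assms(3)] using one_neq_zero by blast
  then show ?thesis by simp
qed

lemma vanishes_at_mult: "vanishes_at F L \<or> vanishes_at G L \<Longrightarrow> vanishes_at (F * G) L"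
  by (auto simp: vanishes_at_def)

lemma is_ideal_vanishing_ideal [simp]: "is_ideal (vanishing_ideal X)"
  by (rule is_idealI) (auto simp: vanishing_ideal_def vanishes_at_def)

lemma zariski_closed_subset: "zariski_closed X \<Longrightarrow> X \<subseteq> proj UNIV"
  by (auto simp: zariski_closed_def)

lemma zariski_closed_mem:
  assumes "zariski_closed X" "v \<noteq> 0"
    and "\<And>d F. homogeneous d F \<Longrightarrow> F \<in> vanishing_ideal X \<Longrightarrow> mpol_eval F v = 0"
  shows "vec.span {v} \<in> X"
proof -
  obtain S where S: "\<forall>F\<in>S. \<exists>d. homogeneous d F" "X = {L \<in> proj UNIV. \<forall>F\<in>S. vanishes_at F L}"
    using assms(1) by (auto simp: zariski_closed_def)
  have "vanishes_at F (vec.span {v})" if F: "F \<in> S" for F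
  proof -
    obtain d where d: "homogeneous d F" using S F by blast
    moreover have "F \<in> vanishing_ideal X" using F S(2) by (auto simp: vanishing_ideal_def)
    ultimately show ?thesis using assms(2,3) by (simp add: vanishes_at_form)
  qed
  moreover have "vec.span {v} \<in> proj UNIV" using assms(2) by (auto simp: proj_UNIV_iff)
  ultimately show ?thesis using S(2) by blast
qed

lemma zariski_closed_subset_iff:
  assumes "zariski_closed X" "Y \<subseteq> proj UNIV" "vanishing_ideal X \<subseteq> vanishing_ideal Y"
  shows "Y \<subseteq> X"
proof
  fix L assume "L \<in> Y"
  then have "L \<in> proj UNIV" using assms(2) by blast
  then obtain v where v: "v \<noteq> 0" "L = vec.span {v}" using proj_UNIV_E by metis
  show "L \<in> X" unfolding v
    by (rule zariski_closed_mem) (use assms v \<open>L \<in> Y\<close> vanishing_idealD in blast)+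
qed

lemma zariski_closed_empty [simp]: "zariski_closed ({} :: ('n::finite, 'k::field) point set)"
  unfolding zariski_closed_def
proof (intro exI[of _ "{1}"] conjI ballI)
  show "\<exists>d. homogeneous d F" if "F \<in> {1}" for F :: "('n, 'k) mpol"
    using that homogeneous_const[of 1] by auto
  show "{} = {L \<in> proj UNIV. \<forall>F\<in>{1 :: ('n, 'k) mpol}. vanishes_at F L}"
    using vanishes_at_form[of 0 "1 :: ('n, 'k) mpol"] homogeneous_const[of 1]
    by (auto simp: proj_UNIV_iff)
qed

lemma zariski_closed_Un:
  assumes "zariski_closed A" "zariski_closed B"
  shows "zariski_closed (A \<union> B)"
proof -
  obtain S where S: "\<forall>F\<in>S. \<exists>d. homogeneous d F" "A = {L \<in> proj UNIV. \<forall>F\<in>S. vanishes_at F L}"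
    using assms(1) by (auto simp: zariski_closed_def)
  obtain T where T: "\<forall>F\<in>T. \<exists>d. homogeneous d F" "B = {L \<in> proj UNIV. \<forall>F\<in>T. vanishes_at F L}"
    using assms(2) by (auto simp: zariski_closed_def)
  let ?P = "{F * G | F G. F \<in> S \<and> G \<in> T}"
  have "\<exists>d. homogeneous d F" if "F \<in> ?P" for F
    using that S(1) T(1) homogeneous_mult by blast
  moreover have "A \<union> B = {L \<in> proj UNIV. \<forall>F\<in>?P. vanishes_at F L}"
  proof (intro subset_antisym subsetI)
    fix L assume "L \<in> A \<union> B"
    then have "L \<in> proj UNIV" "(\<forall>F\<in>S. vanishes_at F L) \<or> (\<forall>G\<in>T. vanishes_at G L)"
      unfolding S(2) T(2) by blast+
    then show "L \<in> {L \<in> proj UNIV. \<forall>F\<in>?P. vanishes_at F L}"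
      by (auto intro!: vanishes_at_mult)
  next
    fix L assume "L \<in> {L \<in> proj UNIV. \<forall>F\<in>?P. vanishes_at F L}"
    then have L: "L \<in> proj UNIV" "\<And>F. F \<in> ?P \<Longrightarrow> vanishes_at F L" by simp_all
    obtain v where v: "v \<noteq> 0" "L = vec.span {v}" using proj_UNIV_E[OF L(1)] by metis
    show "L \<in> A \<union> B"
    proof (rule ccontr)
      assume "L \<notin> A \<union> B"
      then obtain F G where FG: "F \<in> S" "G \<in> T" "\<not> vanishes_at F L" "\<not> vanishes_at G L"
        using L(1) unfolding S(2) T(2) by blast
      obtain d e where de: "homogeneous d F" "homogeneous e G" using S(1) T(1) FG by blast
      have "vanishes_at (F * G) L" by (rule L(2)) (use FG in blast)
      then show False
        using FG(3,4) v vanishes_at_form[OF homogeneous_mult[OF de] v(1)]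
          vanishes_at_form[OF de(1) v(1)] vanishes_at_form[OF de(2) v(1)] by simp
    qed
  qed
  ultimately show ?thesis unfolding zariski_closed_def by blast
qed

lemma zariski_closed_point:
  assumes "p \<in> proj UNIV"
  shows "zariski_closed {p}"
proof -
  obtain v where v: "v \<noteq> 0" "p = vec.span {v}" using proj_UNIV_E[OF assms] by metis
  let ?S = "{lin_form c | c. dot c v = 0}"
  have "\<exists>d. homogeneous d F" if "F \<in> ?S" for F using that homogeneous_lin_form by blast
  moreover have "{p} = {L \<in> proj UNIV. \<forall>F\<in>?S. vanishes_at F L}"
  proof (intro subset_antisym subsetI)
    fix L assume "L \<in> {p}"
    then show "L \<in> {L \<in> proj UNIV. \<forall>F\<in>?S. vanishes_at F L}"
      using v assms by (auto simp: vanishes_at_form[OF homogeneous_lin_form])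
  next
    fix L assume "L \<in> {L \<in> proj UNIV. \<forall>F\<in>?S. vanishes_at F L}"
    then have L: "L \<in> proj UNIV" "\<And>F. F \<in> ?S \<Longrightarrow> vanishes_at F L" by simp_all
    obtain w where w: "w \<noteq> 0" "L = vec.span {w}" using proj_UNIV_E[OF L(1)] by metis
    have *: "dot c w = 0" if "dot c v = 0" for c
    proof -
      have "vanishes_at (lin_form c) L" by (rule L(2)) (use that in blast)
      then show ?thesis using w vanishes_at_form[OF homogeneous_lin_form w(1)] by simp
    qed
    have "w \<in> vec.span {v}"
    proof (rule ccontr)
      assume "w \<notin> vec.span {v}"
      then obtain c where "\<And>u. u \<in> vec.span {v} \<Longrightarrow> dot c u = 0" "dot c w = 1"
        using vec_separate[OF vec.subspace_span] by blast
      then show False using *[of c] vec.span_base[of v "{v}"] by simp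
    qed
    then show "L \<in> {p}" using v w span_singleton_mem by simp
  qed
  ultimately show ?thesis unfolding zariski_closed_def by blast
qed

lemma zariski_closed_finite:
  "finite A \<Longrightarrow> A \<subseteq> proj UNIV \<Longrightarrow> zariski_closed A"
proof (induction A rule: finite_induct)
  case (insert p A)
  then show ?case using zariski_closed_Un[OF zariski_closed_point[of p], of A] by simp
qed simp

section \<open>Irreducible closed sets and Krull dimension\<close>

lemma irreducible_closed_finite:
  assumes "irreducible_closed Z" "finite Z"
  obtains p where "Z = {p}"
proof -
  obtain p where p: "p \<in> Z" using assms by (auto simp: irreducible_closed_def)
  have sub: "Z \<subseteq> proj UNIV" using assms zariski_closed_subset by (auto simp: irreducible_closed_def)
  have "zariski_closed {p}" using p sub by (intro zariski_closed_point) auto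
  moreover have "zariski_closed (Z - {p})" using assms sub by (intro zariski_closed_finite) auto
  moreover have "Z = {p} \<union> (Z - {p})" using p by auto
  ultimately have "Z = {p} \<or> Z = Z - {p}" using assms(1) unfolding irreducible_closed_def by metis
  then show thesis using p that by blast
qed

lemma irreducible_closed_point: "p \<in> proj UNIV \<Longrightarrow> irreducible_closed {p}"
  using zariski_closed_point by (auto simp: irreducible_closed_def singleton_Un_iff)

lemma proj_dim_finite:
  fixes X :: "('n::finite, 'k::field) point set"
  assumes "finite X" "X \<noteq> {}" "X \<subseteq> proj UNIV"
  shows "proj_dim X = 0"
proof -
  obtain p where p: "p \<in> X" using assms by auto
  have "{enat n | n. \<exists>Z :: nat \<Rightarrow> ('n, 'k) point set.
      (\<forall>i\<le>n. irreducible_closed (Z i) \<and> Z i \<subseteq> X) \<and> (\<forall>i<n. Z i \<subset> Z (Suc i))} = {0}"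
  proof (intro subset_antisym subsetI)
    fix e assume "e \<in> {enat n | n. \<exists>Z :: nat \<Rightarrow> ('n, 'k) point set.
      (\<forall>i\<le>n. irreducible_closed (Z i) \<and> Z i \<subseteq> X) \<and> (\<forall>i<n. Z i \<subset> Z (Suc i))}"
    then obtain n and Z :: "nat \<Rightarrow> ('n, 'k) point set" where Z: "e = enat n"
      "\<And>i. i \<le> n \<Longrightarrow> irreducible_closed (Z i) \<and> Z i \<subseteq> X" "\<And>i. i < n \<Longrightarrow> Z i \<subset> Z (Suc i)" by blast
    have "n = 0"
    proof (rule ccontr)
      assume n: "n \<noteq> 0"
      then have Z1: "irreducible_closed (Z 1)" "Z 1 \<subseteq> X" "irreducible_closed (Z 0)" "Z 0 \<subset> Z 1"
        using Z(2)[of 1] Z(2)[of 0] Z(3)[of 0] by auto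
      obtain q where "Z 1 = {q}" using irreducible_closed_finite[OF Z1(1)] Z1(2) assms(1) finite_subset by blast
      then show False using Z1(3,4) by (auto simp: irreducible_closed_def)
    qed
    then show "e \<in> {0}" using Z(1) by (simp add: zero_enat_def)
  next
    fix e :: enat assume "e \<in> {0}"
    then show "e \<in> {enat n | n. \<exists>Z :: nat \<Rightarrow> ('n, 'k) point set.
      (\<forall>i\<le>n. irreducible_closed (Z i) \<and> Z i \<subseteq> X) \<and> (\<forall>i<n. Z i \<subset> Z (Suc i))}"
      using p assms(3) irreducible_closed_point[of p]
      by (intro CollectI exI[of _ 0] exI[of _ "\<lambda>_. {p}"] conjI) (auto simp: zero_enat_def)
  qed
  then show ?thesis unfolding proj_dim_def by simp
qed

text \<open>Two proper closed subsets are finite and cannot cover the infinite set \<open>X\<close>,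
  so \<open>X\<close> is irreducible. Below it a chain has room for a single point only, since a
  finite irreducible set is a point.\<close>

lemma proj_dim_curve:
  fixes X :: "('n::finite, 'k::field) point set"
  assumes "zariski_closed X" "infinite X"
    and fin: "\<And>Z. zariski_closed Z \<Longrightarrow> Z \<subset> X \<Longrightarrow> finite Z"
  shows "proj_dim X = 1"
proof -
  have "X \<noteq> {}" using assms(2) by auto
  then obtain p where p: "p \<in> X" by auto
  have sub: "X \<subseteq> proj UNIV" using assms(1) by (rule zariski_closed_subset)
  have irr: "irreducible_closed X"
    unfolding irreducible_closed_def
  proof (intro conjI allI impI)
    fix A B assume AB: "zariski_closed A" "zariski_closed B" "X = A \<union> B"
    show "X = A \<or> X = B"
    proof (rule ccontr)
      assume "\<not> ?thesis"
      then have "A \<subset> X" "B \<subset> X" using AB(3) by auto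
      then have "finite A" "finite B" using fin AB by auto
      then show False using AB(3) assms(2) by simp
    qed
  qed (use assms p in auto)
  let ?D = "{enat n | n. \<exists>Z :: nat \<Rightarrow> ('n, 'k) point set.
      (\<forall>i\<le>n. irreducible_closed (Z i) \<and> Z i \<subseteq> X) \<and> (\<forall>i<n. Z i \<subset> Z (Suc i))}"
  have "e \<le> 1" if "e \<in> ?D" for e
  proof -
    from that obtain n and Z :: "nat \<Rightarrow> ('n, 'k) point set" where Z: "e = enat n"
      "\<And>i. i \<le> n \<Longrightarrow> irreducible_closed (Z i) \<and> Z i \<subseteq> X" "\<And>i. i < n \<Longrightarrow> Z i \<subset> Z (Suc i)" by blast
    have "n \<le> 1"
    proof (rule ccontr)
      assume n: "\<not> n \<le> 1"
      then have Z1: "irreducible_closed (Z 1)" "irreducible_closed (Z 0)" "Z 0 \<subset> Z 1" "Z 1 \<subset> Z 2" "Z 2 \<subseteq> X"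
        using Z(2)[of 0] Z(2)[of 1] Z(2)[of 2] Z(3)[of 0] Z(3)[of 1] by (auto simp: numeral_2_eq_2)
      have "finite (Z 1)" using fin[of "Z 1"] Z1 by (auto simp: irreducible_closed_def)
      then obtain q where "Z 1 = {q}" using irreducible_closed_finite[OF Z1(1)] by blast
      then show False using Z1(2,3) by (auto simp: irreducible_closed_def)
    qed
    then show ?thesis using Z(1) by (simp add: one_enat_def)
  qed
  moreover have "1 \<in> ?D"
  proof -
    let ?Z = "\<lambda>i::nat. if i = 0 then {p} else X"
    have "X \<noteq> {p}" using assms(2) by auto
    then have "(\<forall>i\<le>1. irreducible_closed (?Z i) \<and> ?Z i \<subseteq> X) \<and> (\<forall>i<1. ?Z i \<subset> ?Z (Suc i))"
      using p sub irr irreducible_closed_point[of p] by auto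
    then have "\<exists>Z :: nat \<Rightarrow> ('n, 'k) point set.
        (\<forall>i\<le>1. irreducible_closed (Z i) \<and> Z i \<subseteq> X) \<and> (\<forall>i<1. Z i \<subset> Z (Suc i))"
      by (rule exI[of _ ?Z])
    then show ?thesis by (intro CollectI exI[of _ 1] conjI) (simp_all only: one_enat_def)
  qed
  ultimately have "Sup ?D = 1" by (intro antisym Sup_least Sup_upper) auto
  then show ?thesis unfolding proj_dim_def .
qed

section \<open>Saturation\<close>

lemma saturation_superset: "is_ideal I \<Longrightarrow> I \<subseteq> saturation I"
  by (auto simp: saturation_def intro: ideal_mult)

text \<open>At each point some coordinate is nonzero, and its k-th power is a form of degree
  \<open>k\<close> that can be cancelled there.\<close>

lemma saturation_vanishing_ideal [simp]:
  fixes X :: "('n::finite, 'k::field) point set"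
  shows "saturation (vanishing_ideal X) = vanishing_ideal X"
proof (intro subset_antisym saturation_superset is_ideal_vanishing_ideal subsetI)
  fix F assume "F \<in> saturation (vanishing_ideal X)"
  then obtain k where k: "\<And>G. homogeneous k G \<Longrightarrow> G * F \<in> vanishing_ideal X"
    by (auto simp: saturation_def)
  show "F \<in> vanishing_ideal X"
    unfolding vanishing_ideal_def vanishes_at_def
  proof (intro CollectI ballI)
    fix L v assume v: "L \<in> X" "v \<in> L - {0}"
    then obtain i where i: "v $ i \<noteq> 0" by (auto simp: vec_eq_iff)
    have "homogeneous k (mvar i ^ k :: ('n, 'k) mpol)"
      using homogeneous_power[of 1 "mvar i" k] homogeneous_var[of i] by simp
    from k[OF this] have "mpol_eval (mvar i ^ k * F) v = 0"
      using v by (simp only: vanishing_ideal_def vanishes_at_def mem_Collect_eq)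
    then show "mpol_eval F v = 0" using i by simp
  qed
qed

section \<open>Minors of the symmetric matrix of coordinates\<close>

lemma veronese_Upair: "veronese x $ Upair i j = x $ i * x $ j"
  by (simp add: veronese_def)

lemma uprod_vec_eqI: "(\<And>i j. v $ Upair i j = w $ Upair i j) \<Longrightarrow> v = w"
  unfolding vec_eq_iff by (metis uprod_exhaust)

lemma veronese_scale: "veronese (c *s x) = c\<^sup>2 *s veronese x"
  by (rule uprod_vec_eqI) (simp add: veronese_Upair power2_eq_square)

lemma veronese_zero [simp]: "veronese 0 = 0"
  by (rule uprod_vec_eqI) (simp add: veronese_Upair)

lemma veronese_eq_0_iff [simp]: "veronese x = 0 \<longleftrightarrow> x = 0"
proof
  assume *: "veronese x = 0"
  have "x $ i = 0" for i
    using veronese_Upair[of x i i] by (simp add: *)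
  then show "x = 0" by (simp add: vec_eq_iff)
qed simp

text \<open>The polarisation of \<open>veronese\<close>: its coordinate at \<open>Upair i j\<close>
  is x_i y_j + x_j y_i, so it is bilinear and symmetric.\<close>

definition sym_prod :: "'k::field ^ 4 \<Rightarrow> 'k ^ 4 \<Rightarrow> 'k ^ (4 uprod)" where
  "sym_prod x y = veronese (x + y) - veronese x - veronese y"

lemma veronese_comb:
  "veronese (s *s x + t *s y) = s\<^sup>2 *s veronese x + t\<^sup>2 *s veronese y + (s * t) *s sym_prod x y"
  by (rule uprod_vec_eqI) (simp add: sym_prod_def veronese_Upair power2_eq_square algebra_simps)

lemma veronese_sum:
  assumes "finite T"
  shows "veronese (\<Sum>t\<in>T. f t *s t) $ Upair i j = (\<Sum>a\<in>T. \<Sum>b\<in>T. f a * f b * (a $ i * b $ j))"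
  using assms by (simp add: veronese_Upair sum_product mult_ac)

text \<open>Coefficients of the linear form with value \<open>\<phi>(x) \<psi>(x)\<close> at \<open>veronese x\<close>.\<close>

definition quad :: "'k::field ^ 4 \<Rightarrow> 'k ^ 4 \<Rightarrow> 'k ^ (4 uprod)" where
  "quad \<phi> \<psi> = (\<chi> p. \<Sum>a\<in>UNIV. \<Sum>b\<in>UNIV. if Upair a b = p then \<phi> $ a * \<psi> $ b else 0)"

lemma dot_quad: "dot (quad \<phi> \<psi>) v = (\<Sum>a\<in>UNIV. \<Sum>b\<in>UNIV. \<phi> $ a * \<psi> $ b * v $ Upair a b)"
proof -
  have "dot (quad \<phi> \<psi>) v =
      (\<Sum>p\<in>UNIV. \<Sum>a\<in>UNIV. \<Sum>b\<in>UNIV. (if Upair a b = p then \<phi> $ a * \<psi> $ b * v $ p else 0))"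
    unfolding dot_def quad_def
    by (intro sum.cong refl) (simp only: vec_lambda_beta sum_distrib_right, intro sum.cong refl, simp)
  also have "\<dots> = (\<Sum>a\<in>UNIV. \<Sum>p\<in>UNIV. \<Sum>b\<in>UNIV. (if Upair a b = p then \<phi> $ a * \<psi> $ b * v $ p else 0))"
    by (rule sum.swap)
  also have "\<dots> = (\<Sum>a\<in>UNIV. \<Sum>b\<in>UNIV. \<Sum>p\<in>UNIV. (if Upair a b = p then \<phi> $ a * \<psi> $ b * v $ p else 0))"
    by (intro sum.cong refl sum.swap)
  finally show ?thesis by simp
qed

lemma dot_quad_veronese: "dot (quad \<phi> \<psi>) (veronese x) = dot \<phi> x * dot \<psi> x"
  unfolding dot_quad by (simp add: dot_def sum_product veronese_Upair mult_ac)

lemma dot_quad_sym_prod: "dot (quad \<phi> \<psi>) (sym_prod x y) = dot \<phi> x * dot \<psi> y + dot \<phi> y * dot \<psi> x"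
  by (simp add: sym_prod_def dot_diff_right dot_quad_veronese dot_add_right algebra_simps)

text \<open>A point of the target is a symmetric matrix, read as the bilinear form with value
  \<open>dot (quad \<phi> \<psi>) v\<close> on a pair of functionals. This is its 2x2 minor with
  rows \<alpha>, \<beta> and columns \<gamma>, \<delta>, in arbitrary coordinates; on
  \<open>veronese x\<close> the matrix has rank one.\<close>

definition minor :: "'k::field ^ 4 \<Rightarrow> 'k ^ 4 \<Rightarrow> 'k ^ 4 \<Rightarrow> 'k ^ 4 \<Rightarrow> (4 uprod, 'k) mpol" where
  "minor \<alpha> \<beta> \<gamma> \<delta> = lin_form (quad \<alpha> \<gamma>) * lin_form (quad \<beta> \<delta>) - lin_form (quad \<alpha> \<delta>) * lin_form (quad \<beta> \<gamma>)"

lemma homogeneous_minor: "homogeneous 2 (minor \<alpha> \<beta> \<gamma> \<delta>)"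
  unfolding minor_def
  using homogeneous_mult[OF homogeneous_lin_form homogeneous_lin_form]
  by (intro homogeneous_diff) (simp_all add: numeral_2_eq_2)

lemma minor_veronese: "mpol_eval (minor \<alpha> \<beta> \<gamma> \<delta>) (veronese x) = 0"
  by (simp add: minor_def dot_quad_veronese)

text \<open>Cauchy-Binet: the matrix is a sum of two rank-one matrices, so its 2x2 block is a
  product of two 2x2 matrices and the determinant factors. With functionals dual to a basis this
  detects a chosen pair of basis vectors.\<close>

lemma minor_veronese_add:
  "mpol_eval (minor \<alpha> \<beta> \<gamma> \<delta>) (veronese x + veronese y) =
    (dot \<alpha> x * dot \<beta> y - dot \<alpha> y * dot \<beta> x) * (dot \<gamma> x * dot \<delta> y - dot \<gamma> y * dot \<delta> x)"
  by (simp add: minor_def dot_quad_veronese dot_add_right algebra_simps)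

lemma veronese_variety_E:
  assumes "L \<in> veronese_variety"
  obtains x where "x \<noteq> 0" "L = vec.span {veronese x}"
  using assms by (auto simp: veronese_variety_def)

lemma veronese_variety_subset: "veronese_variety \<subseteq> (proj UNIV :: (4 uprod, 'k::field) point set)"
  by (auto simp: veronese_variety_def proj_UNIV_iff intro!: exI[of _ "veronese _"])

lemma minor_in_vanishing_ideal:
  assumes "X \<subseteq> veronese_variety"
  shows "minor \<alpha> \<beta> \<gamma> \<delta> \<in> vanishing_ideal X"
  unfolding vanishing_ideal_def
proof (intro CollectI ballI)
  fix L assume "L \<in> X"
  then obtain x where "x \<noteq> 0" "L = vec.span {veronese x}" using assms veronese_variety_E by blast
  then show "vanishes_at (minor \<alpha> \<beta> \<gamma> \<delta>) L"
    by (simp add: vanishes_at_form[OF homogeneous_minor] minor_veronese)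
qed

section \<open>Normal forms of polynomials\<close>

text \<open>Mapping the coefficients and then substituting \<open>y\<close> is again a homomorphism,
  so the construction can be iterated to reach polynomials in two variables.\<close>

lemma (in coeff_hom) poly_map_hom: "coeff_hom (\<lambda>p. poly (map_poly \<phi> p) y)"
proof
  have pC: "poly (map_poly \<phi> (pCons a p)) y = \<phi> a + y * poly (map_poly \<phi> p) y" for a p
    by (simp add: map_poly_pCons hom_zero)
  show add: "poly (map_poly \<phi> (p + q)) y = poly (map_poly \<phi> p) y + poly (map_poly \<phi> q) y" for p q
    by (induction p q rule: poly_induct2) (simp_all add: pC hom_add algebra_simps)
  have smult: "poly (map_poly \<phi> (smult a q)) y = \<phi> a * poly (map_poly \<phi> q) y" for a q
    by (induction q) (simp_all add: pC hom_mult algebra_simps)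
  show "poly (map_poly \<phi> (p * q)) y = poly (map_poly \<phi> p) y * poly (map_poly \<phi> q) y" for p q
    by (induction p) (simp_all add: pC add smult hom_zero algebra_simps)
  show "poly (map_poly \<phi> 1) y = 1"
    by (simp add: one_pCons pC hom_one)
qed

definition poly1 :: "('n, 'k::comm_ring_1) mpol \<Rightarrow> 'k poly \<Rightarrow> ('n, 'k) mpol" where
  "poly1 Y p = poly (map_poly mconst p) Y"

text \<open>The outer variable of \<open>A\<close> becomes \<open>Z\<close>, while its coefficients
  are polynomials in \<open>Y\<close>.\<close>

definition poly2 :: "('n, 'k::comm_ring_1) mpol \<Rightarrow> ('n, 'k) mpol \<Rightarrow> 'k poly poly \<Rightarrow> ('n, 'k) mpol" where
  "poly2 Y Z A = poly (map_poly (poly1 Y) A) Z"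

interpretation poly1_hom: coeff_hom "poly1 Y :: 'k::comm_ring_1 poly \<Rightarrow> ('n, 'k) mpol"
  unfolding poly1_def by (rule mconst_hom.poly_map_hom)

interpretation poly2_hom: coeff_hom "poly2 Y Z :: 'k::comm_ring_1 poly poly \<Rightarrow> ('n, 'k) mpol"
  unfolding poly2_def by (rule poly1_hom.poly_map_hom)

lemma poly1_pCons [simp]: "poly1 Y (pCons a p) = mconst a + Y * poly1 Y p"
  by (simp add: poly1_def map_poly_pCons)

lemma poly2_pCons [simp]: "poly2 Y Z (pCons a p) = poly1 Y a + Z * poly2 Y Z p"
  by (simp add: poly2_def map_poly_pCons poly1_hom.hom_zero)

lemma poly1_0 [simp]: "poly1 Y 0 = 0"
  by (rule poly1_hom.hom_zero)

lemma poly2_0 [simp]: "poly2 Y Z 0 = 0"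
  by (rule poly2_hom.hom_zero)

lemma mpol_eval_poly1 [simp]: "mpol_eval (poly1 Y p) v = poly p (mpol_eval Y v)"
  by (induction p) simp_all

lemma mpol_eval_poly2 [simp]:
  "mpol_eval (poly2 Y Z A) v = poly (poly A [:mpol_eval Z v:]) (mpol_eval Y v)"
  by (induction A) simp_all

text \<open>For fixed \<open>b\<close> an extra factor X covers the argument 0, so the polynomial in
  \<open>a\<close> is zero. Then \<open>A\<close> has the infinitely many roots
  \<open>[:b:]\<close>.\<close>

lemma poly2_eq_0:
  fixes A :: "'k::field_char_0 poly poly"
  assumes "\<And>a b. a \<noteq> 0 \<Longrightarrow> b \<noteq> 0 \<Longrightarrow> poly (poly A [:b:]) a = 0"
  shows "A = 0"
proof (rule ccontr)
  assume A: "A \<noteq> 0"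
  have "poly A [:b:] = 0" if "b \<noteq> 0" for b
  proof -
    have "poly (poly A [:b:] * [:0, 1:]) a = 0" for a
      using assms[of a b] that by (cases "a = 0") auto
    then have "poly A [:b:] * [:0, 1:] = 0" using poly_all_0_iff_0 by blast
    then show ?thesis by simp
  qed
  then have "(\<lambda>b. [:b:]) ` (UNIV - {0}) \<subseteq> {x. poly A x = 0}" by auto
  then have "finite ((\<lambda>b. [:b:]) ` (UNIV - {0 :: 'k}))"
    using poly_roots_finite[OF A] finite_subset by blast
  then have "finite (UNIV - {0 :: 'k})"
    by (rule finite_imageD) (auto intro: inj_onI)
  then show False using infinite_UNIV_char_0[where 'a = 'k] by simp
qed

lemma poly1_eq_0:
  fixes p :: "'k::field_char_0 poly"
  assumes "\<And>a. a \<noteq> 0 \<Longrightarrow> poly p a = 0"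
  shows "p = 0"
proof -
  have "poly (p * [:0, 1:]) a = 0" for a
    using assms[of a] by (cases "a = 0") auto
  then have "p * [:0, 1:] = 0" using poly_all_0_iff_0 by blast
  then show ?thesis by simp
qed

lemma lin_form_diff: "lin_form (c - d) = lin_form c - lin_form d"
  by (simp add: lin_form_def single_diff algebra_simps sum_subtractf)

lemma lin_form_add: "lin_form (c + d) = lin_form c + lin_form d"
  by (simp add: lin_form_def single_add algebra_simps sum.distrib)

lemma lin_form_scale: "lin_form (k *s c) = mconst k * lin_form c"
  by (simp add: lin_form_def mconst_mult sum_distrib_left mult.assoc)

lemma lin_form_zero [simp]: "lin_form 0 = 0"
  by (simp add: lin_form_def)

lemma lin_form_axis: "lin_form (axis i 1) = mvar i"
proof -
  have "lin_form (axis i 1) = (\<Sum>j\<in>UNIV. if j = i then mvar j else 0)"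
    unfolding lin_form_def by (intro sum.cong refl) (simp add: axis_def)
  then show ?thesis by simp
qed

lemma lin_form_in_span:
  assumes "is_ideal J" "\<And>c. c \<in> set cs \<Longrightarrow> lin_form c \<in> J" "c \<in> vec.span (set cs)"
  shows "lin_form c \<in> J"
proof -
  have "vec.subspace {c. lin_form c \<in> J}"
    by (rule vec.subspaceI)
      (use assms(1) in \<open>auto simp: lin_form_add lin_form_scale ideal_add ideal_mult ideal_zero\<close>)
  then have "vec.span (set cs) \<subseteq> {c. lin_form c \<in> J}"
    using assms(2) by (intro vec.span_minimal) auto
  then show ?thesis using assms(3) by blast
qed

lemma normal_form_mult:
  assumes "is_ideal J" "F - N \<in> J" "G - M \<in> J"
  shows "F * G - N * M \<in> J"
proof -
  have "F * G - N * M = F * (G - M) + M * (F - N)" by (simp add: algebra_simps)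
  then show ?thesis using assms by (simp add: ideal_add ideal_mult)
qed

text \<open>The relation replaces \<open>Y2 * Y2\<close> by \<open>Y0 * Y1\<close>, so the
  polynomials congruent to an expression linear in \<open>Y2\<close> are closed under products. The
  coordinates belong to them by the last assumption.\<close>

lemma normal_form_quadric:
  fixes J :: "('n::finite, 'k::field) mpol set"
  assumes J: "is_ideal J" "Y0 * Y1 - Y2 * Y2 \<in> J"
    and v: "\<And>i. \<exists>a b c. mvar i - (mconst a * Y0 + mconst b * Y1 + mconst c * Y2) \<in> J"
  shows "\<exists>A B. F - (poly2 Y0 Y1 A + Y2 * poly2 Y0 Y1 B) \<in> J"
proof (induction F rule: mpol_induct)
  case (const c)
  show ?case
    by (intro exI[of _ "[:[:c:]:]"] exI[of _ 0]) (simp add: ideal_zero[OF J(1)])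
next
  case (var i)
  from v[of i] obtain a b c where "mvar i - (mconst a * Y0 + mconst b * Y1 + mconst c * Y2) \<in> J"
    by blast
  then show ?case
    by (intro exI[of _ "[:[:0, a:], [:b:]:]"] exI[of _ "[:[:c:]:]"]) (simp add: mult_ac)
next
  case (add F G)
  then obtain A B A' B' where
    "F - (poly2 Y0 Y1 A + Y2 * poly2 Y0 Y1 B) \<in> J" "G - (poly2 Y0 Y1 A' + Y2 * poly2 Y0 Y1 B') \<in> J"
    by blast
  then have "(F - (poly2 Y0 Y1 A + Y2 * poly2 Y0 Y1 B)) + (G - (poly2 Y0 Y1 A' + Y2 * poly2 Y0 Y1 B')) \<in> J"
    by (rule ideal_add[OF J(1)])
  then show ?case
    by (intro exI[of _ "A + A'"] exI[of _ "B + B'"]) (simp add: poly2_hom.hom_add algebra_simps)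
next
  case (mult F G)
  then obtain A B A' B' where
    "F - (poly2 Y0 Y1 A + Y2 * poly2 Y0 Y1 B) \<in> J" "G - (poly2 Y0 Y1 A' + Y2 * poly2 Y0 Y1 B') \<in> J"
    by blast
  from normal_form_mult[OF J(1) this]
  have *: "F * G - (poly2 Y0 Y1 A + Y2 * poly2 Y0 Y1 B) * (poly2 Y0 Y1 A' + Y2 * poly2 Y0 Y1 B') \<in> J" .
  \<comment> \<open>The product of the two parts containing \<open>Y2\<close> returns to the part
    without \<open>Y2\<close> with the factor \<open>Y0 * Y1\<close>, which this polynomial
    represents.\<close>
  have U: "poly2 Y0 Y1 ([:[:0, 1:]:] * [:0, 1:]) = Y0 * Y1"
    by (simp add: poly2_hom.hom_mult)
  have "F * G - (poly2 Y0 Y1 (A * A' + [:[:0, 1:]:] * [:0, 1:] * (B * B')) + Y2 * poly2 Y0 Y1 (A * B' + B * A'))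
    = F * G - (poly2 Y0 Y1 A + Y2 * poly2 Y0 Y1 B) * (poly2 Y0 Y1 A' + Y2 * poly2 Y0 Y1 B')
      - (poly2 Y0 Y1 B * poly2 Y0 Y1 B') * (Y0 * Y1 - Y2 * Y2)"
    unfolding poly2_hom.hom_add poly2_hom.hom_mult[of _ _ _ "B * B'"] U
    by (simp add: poly2_hom.hom_mult algebra_simps)
  also have "\<dots> \<in> J" by (intro ideal_diff[OF J(1) *] ideal_mult[OF J(1)] J(2))
  finally show ?case by blast
qed

section \<open>Conics on the Veronese variety\<close>

lemma quad_commute: "quad \<phi> \<psi> = quad \<psi> \<phi>"
proof (rule dot_ext)
  fix v
  have "dot (quad \<phi> \<psi>) v = (\<Sum>b\<in>UNIV. \<Sum>a\<in>UNIV. \<phi> $ a * \<psi> $ b * v $ Upair a b)"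
    unfolding dot_quad by (rule sum.swap)
  also have "\<dots> = dot (quad \<psi> \<phi>) v"
    unfolding dot_quad by (intro sum.cong refl) (metis Upair_inject mult.commute)
  finally show "dot (quad \<phi> \<psi>) v = dot (quad \<psi> \<phi>) v" .
qed

text \<open>The conic is the image of the line through \<open>x0\<close> and \<open>x1\<close>. On its plane the linear forms
  \<open>y0\<close>, \<open>y1\<close>, \<open>y2\<close> are coordinates with values \<open>s\<^sup>2\<close>, \<open>t\<^sup>2\<close>, \<open>s * t\<close> at the image of \<open>s x0 + t x1\<close>.\<close>

locale veronese_conic =
  fixes x0 x1 \<phi>0 \<phi>1 :: "'k::{alg_closed_field, field_char_0} ^ 4"
  assumes dual: "dot \<phi>0 x0 = 1" "dot \<phi>0 x1 = 0" "dot \<phi>1 x0 = 0" "dot \<phi>1 x1 = 1"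
begin

definition y0 where "y0 = quad \<phi>0 \<phi>0"
definition y1 where "y1 = quad \<phi>1 \<phi>1"
definition y2 where "y2 = quad \<phi>0 \<phi>1"

definition plane :: "('k ^ (4 uprod)) set" where
  "plane = vec.span {veronese x0, veronese x1, sym_prod x0 x1}"

definition cone :: "'k \<Rightarrow> 'k \<Rightarrow> 'k ^ (4 uprod)" where
  "cone s t = veronese (s *s x0 + t *s x1)"

definition Cset :: "(4 uprod, 'k) point set" where
  "Cset = {vec.span {cone s t} | s t. s \<noteq> 0 \<or> t \<noteq> 0}"

abbreviation qform :: "(4 uprod, 'k) mpol" where
  "qform \<equiv> lin_form y0 * lin_form y1 - lin_form y2 * lin_form y2"

lemma qform_minor: "qform = minor \<phi>0 \<phi>1 \<phi>0 \<phi>1"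
  by (simp add: minor_def y0_def y1_def y2_def quad_commute[of \<phi>1 \<phi>0])

lemma homogeneous_qform: "homogeneous 2 qform"
  unfolding qform_minor by (rule homogeneous_minor)

lemma dot_y [simp]:
  "dot y0 (veronese x0) = 1" "dot y0 (veronese x1) = 0" "dot y0 (sym_prod x0 x1) = 0"
  "dot y1 (veronese x0) = 0" "dot y1 (veronese x1) = 1" "dot y1 (sym_prod x0 x1) = 0"
  "dot y2 (veronese x0) = 0" "dot y2 (veronese x1) = 0" "dot y2 (sym_prod x0 x1) = 1"
  by (simp_all add: y0_def y1_def y2_def dot_quad_veronese dot_quad_sym_prod dual)

lemma subspace_plane [simp]: "vec.subspace plane"
  by (simp add: plane_def)

lemma plane_base: "veronese x0 \<in> plane" "veronese x1 \<in> plane" "sym_prod x0 x1 \<in> plane"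
  unfolding plane_def by (auto intro: vec.span_base)

lemma cone_expand: "cone s t = s\<^sup>2 *s veronese x0 + t\<^sup>2 *s veronese x1 + (s * t) *s sym_prod x0 x1"
  unfolding cone_def by (rule veronese_comb)

lemma dot_cone [simp]: "dot y0 (cone s t) = s\<^sup>2" "dot y1 (cone s t) = t\<^sup>2" "dot y2 (cone s t) = s * t"
  by (simp_all add: cone_expand dot_add_right dot_scale_right)

lemma cone_in_plane: "cone s t \<in> plane"
  unfolding cone_expand
  by (intro vec.subspace_add[OF subspace_plane] vec.subspace_scale[OF subspace_plane] plane_base)

lemma cone_eq_0_iff: "cone s t = 0 \<longleftrightarrow> s = 0 \<and> t = 0"
proof
  assume "cone s t = 0"
  then have "s\<^sup>2 = 0" "t\<^sup>2 = 0" using dot_cone[of s t] by (simp_all del: dot_cone)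
  then show "s = 0 \<and> t = 0" by simp
qed (simp add: cone_expand)

lemma cone_scale: "c\<^sup>2 *s cone s t = cone (c * s) (c * t)"
proof -
  have "(c * s) *s x0 + (c * t) *s x1 = c *s (s *s x0 + t *s x1)"
    by (simp add: vector_add_ldistrib vector_smult_assoc)
  then show ?thesis by (simp add: cone_def veronese_scale)
qed

lemma plane_expand:
  assumes "v \<in> plane"
  shows "v = dot y0 v *s veronese x0 + dot y1 v *s veronese x1 + dot y2 v *s sym_prod x0 x1"
proof -
  from assms obtain a b c where "v - a *s veronese x0 - b *s veronese x1 - c *s sym_prod x0 x1 = 0"
    unfolding plane_def by (auto simp: vec.span_breakdown_eq)
  then have v: "v = a *s veronese x0 + b *s veronese x1 + c *s sym_prod x0 x1"
    by (simp add: algebra_simps)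
  show ?thesis by (simp add: v dot_add_right dot_scale_right)
qed

lemma dim_plane: "vec.dim plane = 3"
proof -
  let ?B = "{veronese x0, veronese x1, sym_prod x0 x1}"
  have ne: "veronese x0 \<noteq> veronese x1" "veronese x0 \<noteq> sym_prod x0 x1" "veronese x1 \<noteq> sym_prod x0 x1"
    using dot_y by (metis zero_neq_one)+
  define \<psi> where "\<psi> w = (if w = veronese x0 then y0 else if w = veronese x1 then y1 else y2)" for w
  have "vec.independent ?B"
    by (rule independent_if_dual[of _ \<psi>]) (use ne in \<open>auto simp: \<psi>_def\<close>)
  then show ?thesis unfolding plane_def vec.dim_span
    using ne by (simp add: vec.dim_eq_card_independent)
qed

text \<open>A square root of the first coordinate gives \<open>s\<close>, and \<open>t\<close> is
  then the third coordinate divided by \<open>s\<close>. If the first coordinate is 0, the equation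
  kills the third as well, and a root of the second suffices.\<close>

lemma cone_if_qform:
  assumes "v \<in> plane" "mpol_eval qform v = 0"
  obtains s t where "v = cone s t"
proof -
  let ?a = "dot y0 v" and ?b = "dot y1 v" and ?c = "dot y2 v"
  have q: "?a * ?b = ?c * ?c" using assms(2) by simp
  have v: "v = ?a *s veronese x0 + ?b *s veronese x1 + ?c *s sym_prod x0 x1"
    by (rule plane_expand[OF assms(1)])
  show thesis
  proof (cases "?a = 0")
    case True
    obtain t where t: "t ^ 2 = ?b" using nth_root_exists[of 2 ?b] by auto
    have "v = cone 0 t" unfolding cone_expand using v True q t by simp
    then show thesis by (rule that)
  next
    case False
    obtain s where s: "s ^ 2 = ?a" using nth_root_exists[of 2 ?a] by auto
    have "s \<noteq> 0" using s False by auto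
    have "(?c / s)\<^sup>2 = ?b"
      using q False by (simp add: power_divide s power2_eq_square[of ?c] field_simps)
    moreover have "s * (?c / s) = ?c" using \<open>s \<noteq> 0\<close> by simp
    ultimately have "v = cone s (?c / s)" unfolding cone_expand using v s by simp
    then show thesis by (rule that)
  qed
qed

lemma Cset_cone: "s \<noteq> 0 \<or> t \<noteq> 0 \<Longrightarrow> vec.span {cone s t} \<in> Cset"
  by (auto simp: Cset_def)

lemma Cset_E:
  assumes "L \<in> Cset"
  obtains s t where "s \<noteq> 0 \<or> t \<noteq> 0" "L = vec.span {cone s t}" "cone s t \<noteq> 0"
  using assms by (auto simp: Cset_def cone_eq_0_iff)

lemma Cset_if_qform:
  assumes "v \<in> plane" "mpol_eval qform v = 0" "v \<noteq> 0"
  shows "vec.span {v} \<in> Cset"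
  using cone_if_qform[OF assms(1,2)] assms(3) Cset_cone cone_eq_0_iff by metis

lemma Cset_subset_proj: "Cset \<subseteq> proj plane"
proof
  fix L assume "L \<in> Cset"
  then obtain s t where "L = vec.span {cone s t}" "cone s t \<noteq> 0" by (rule Cset_E)
  then show "L \<in> proj plane"
    using cone_in_plane[of s t] unfolding proj_iff[OF subspace_plane] by blast
qed

lemma Cset_subset_UNIV: "Cset \<subseteq> proj UNIV"
  using Cset_subset_proj by (auto simp: proj_def)

lemma Cset_subset_veronese: "Cset \<subseteq> veronese_variety"
proof
  fix L assume "L \<in> Cset"
  then obtain s t where "L = vec.span {cone s t}" "cone s t \<noteq> 0" by (rule Cset_E)
  then show "L \<in> veronese_variety" unfolding veronese_variety_def cone_def by auto
qed

text \<open>A multiple \<open>c *s cone s t\<close> is again \<open>cone (e * s) (e * t)\<close>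
  with \<open>e\<close> a square root of \<open>c\<close>. Hence the parametrisation covers the
  whole cone over the conic, and even polynomials that are not forms are tested on it alone.\<close>

lemma vanishing_ideal_Cset:
  "F \<in> vanishing_ideal Cset \<longleftrightarrow> (\<forall>s t. s \<noteq> 0 \<or> t \<noteq> 0 \<longrightarrow> mpol_eval F (cone s t) = 0)"
proof (intro iffI allI impI)
  fix s t :: 'k assume "F \<in> vanishing_ideal Cset" "s \<noteq> 0 \<or> t \<noteq> 0"
  then show "mpol_eval F (cone s t) = 0"
    using vanishing_idealD[OF _ Cset_cone, of F s t] by (auto simp: cone_eq_0_iff)
next
  assume *: "\<forall>s t. s \<noteq> 0 \<or> t \<noteq> 0 \<longrightarrow> mpol_eval F (cone s t) = 0"
  show "F \<in> vanishing_ideal Cset"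
    unfolding vanishing_ideal_def
  proof (intro CollectI ballI)
    fix L assume "L \<in> Cset"
    then obtain s t where L: "s \<noteq> 0 \<or> t \<noteq> 0" "L = vec.span {cone s t}" "cone s t \<noteq> 0" by (rule Cset_E)
    have "mpol_eval F (c *s cone s t) = 0" if "c \<noteq> 0" for c
    proof -
      obtain e where e: "e ^ 2 = c" using nth_root_exists[of 2 c] by auto
      then have "e \<noteq> 0" using that by auto
      have "c *s cone s t = cone (e * s) (e * t)" using cone_scale[of e s t] e by simp
      then show ?thesis using * L(1) \<open>e \<noteq> 0\<close> by simp
    qed
    then show "vanishes_at F L" using L(2,3) by (simp add: vanishes_at_span)
  qed
qed

lemma qform_in_vanishing_ideal: "qform \<in> vanishing_ideal Cset"
  by (simp add: vanishing_ideal_Cset power2_eq_square)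

lemma lin_form_in_vanishing_ideal:
  "(\<And>w. w \<in> plane \<Longrightarrow> dot c w = 0) \<Longrightarrow> lin_form c \<in> vanishing_ideal Cset"
  by (simp add: vanishing_ideal_Cset cone_in_plane)

text \<open>Exactly the memberships used in the reduction to normal form. They hold for the
  vanishing ideal and are easily checked for ideals given by generators, so both can be
  compared.\<close>

definition conic_ideal :: "(4 uprod, 'k) mpol set \<Rightarrow> bool" where
  "conic_ideal J \<longleftrightarrow> is_ideal J \<and> qform \<in> J \<and> (\<forall>c. (\<forall>w\<in>plane. dot c w = 0) \<longrightarrow> lin_form c \<in> J)"

lemma conic_ideal_Cset: "conic_ideal (vanishing_ideal Cset)"
  by (simp add: conic_ideal_def qform_in_vanishing_ideal lin_form_in_vanishing_ideal)

lemma coordinates_mod_plane: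
  assumes "conic_ideal J"
  shows "\<exists>a b c. mvar i - (mconst a * lin_form y0 + mconst b * lin_form y1 + mconst c * lin_form y2) \<in> J"
proof -
  \<comment> \<open>The i-th coordinate minus its expansion in the coordinates of the plane, which
    is zero on the plane.\<close>
  let ?d = "axis i 1 - (veronese x0 $ i) *s y0 - (veronese x1 $ i) *s y1 - (sym_prod x0 x1 $ i) *s y2"
  have "dot ?d w = 0" if "w \<in> plane" for w
  proof -
    have "dot (axis i 1) w = w $ i"
      by (simp add: dot_def axis_def if_distrib if_distribR cong: if_cong)
    moreover have "w $ i = dot y0 w * veronese x0 $ i + dot y1 w * veronese x1 $ i + dot y2 w * sym_prod x0 x1 $ i"
      by (subst plane_expand[OF that]) simp
    moreover have "dot ?d w = dot (axis i 1) w - (veronese x0 $ i) * dot y0 w - (veronese x1 $ i) * dot y1 w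
        - (sym_prod x0 x1 $ i) * dot y2 w"
      by (simp only: diff_conv_add_uminus vector_sneg_minus1[symmetric] dot_add_left) 
        (simp add: dot_def sum_negf sum_distrib_left mult.assoc)
    ultimately show ?thesis by (simp add: mult.commute)
  qed
  then have "lin_form ?d \<in> J" using assms by (simp add: conic_ideal_def)
  then have "mvar i - (mconst (veronese x0 $ i) * lin_form y0 + mconst (veronese x1 $ i) * lin_form y1
      + mconst (sym_prod x0 x1 $ i) * lin_form y2) \<in> J"
    by (simp only: lin_form_diff lin_form_add lin_form_scale lin_form_axis diff_diff_eq)
  then show ?thesis by blast
qed

definition nf :: "'k poly poly \<Rightarrow> 'k poly poly \<Rightarrow> (4 uprod, 'k) mpol" where
  "nf A B = poly2 (lin_form y0) (lin_form y1) A + lin_form y2 * poly2 (lin_form y0) (lin_form y1) B"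

text \<open>The two summands are the even and the odd part in \<open>s\<close>.\<close>

lemma nf_unique:
  assumes "nf A B \<in> vanishing_ideal Cset"
  shows "A = 0" "B = 0"
proof -
  have *: "poly (poly A [:t\<^sup>2:]) (s\<^sup>2) = 0 \<and> poly (poly B [:t\<^sup>2:]) (s\<^sup>2) = 0" if "s \<noteq> 0" "t \<noteq> 0" for s t
  proof -
    let ?A = "poly (poly A [:t\<^sup>2:]) (s\<^sup>2)" and ?B = "poly (poly B [:t\<^sup>2:]) (s\<^sup>2)"
    have "?A + s * t * ?B = 0" "?A - s * t * ?B = 0"
      using assms[unfolded vanishing_ideal_Cset nf_def, rule_format, of s t]
        assms[unfolded vanishing_ideal_Cset nf_def, rule_format, of "- s" t] that by auto
    then have "2 * ?A = 0" "2 * (s * t * ?B) = 0" by algebra+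
    then show ?thesis using that by simp
  qed
  have sq: "\<exists>s. s ^ 2 = a" for a :: 'k using nth_root_exists[of 2 a] by auto
  have "poly (poly A [:b:]) a = 0 \<and> poly (poly B [:b:]) a = 0" if "a \<noteq> 0" "b \<noteq> 0" for a b
  proof -
    obtain s t where st: "s ^ 2 = a" "t ^ 2 = b" using sq by metis
    then have "s \<noteq> 0" "t \<noteq> 0" using that by auto
    from *[OF this] show ?thesis using st by simp
  qed
  then show "A = 0" "B = 0" using poly2_eq_0 by blast+
qed

lemma nf_exists:
  assumes J: "conic_ideal J"
  obtains A B where "F - nf A B \<in> J"
proof -
  have "is_ideal J" "qform \<in> J" using J by (simp_all add: conic_ideal_def)
  from normal_form_quadric[OF this coordinates_mod_plane[OF J], of F] show thesis
    using that unfolding nf_def by blast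
qed

text \<open>An element of the vanishing ideal has a normal form modulo \<open>J\<close>. That form
  vanishes on the conic as well, so it is zero by uniqueness.\<close>

lemma ideal_eq_vanishing_ideal_Cset:
  assumes J: "conic_ideal J"
    and sub: "J \<subseteq> vanishing_ideal Cset"
  shows "J = vanishing_ideal Cset"
proof (rule subset_antisym[OF sub subsetI])
  fix F assume F: "F \<in> vanishing_ideal Cset"
  obtain A B where AB: "F - nf A B \<in> J" by (rule nf_exists[OF J])
  have "F - (F - nf A B) \<in> vanishing_ideal Cset"
    by (rule ideal_diff[OF is_ideal_vanishing_ideal F subsetD[OF sub AB]])
  then have "A = 0" "B = 0" using nf_unique[of A B] by simp_all
  then show "F \<in> J" using AB by (simp add: nf_def)
qed

text \<open>Take parameters where \<open>F\<close> is nonzero and parameters where \<open>G\<close>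
  is nonzero, and join them by a line. Along it both become polynomials in one variable, nonzero at
  0 and at 1 respectively, and such polynomials have no zero divisors.\<close>

lemma vanishing_ideal_Cset_prime:
  assumes "F * G \<in> vanishing_ideal Cset"
  shows "F \<in> vanishing_ideal Cset \<or> G \<in> vanishing_ideal Cset"
proof (rule ccontr)
  assume "\<not> ?thesis"
  then obtain a b c d where F: "a \<noteq> 0 \<or> b \<noteq> 0" "mpol_eval F (cone a b) \<noteq> 0"
    and G: "mpol_eval G (cone c d) \<noteq> 0"
    unfolding vanishing_ideal_Cset by blast
  define S T where "S = [:a, c - a:]" and "T = [:b, d - b:]"
  define w where "w = (\<lambda>i. S\<^sup>2 * [:veronese x0 $ i:] + T\<^sup>2 * [:veronese x1 $ i:] + S * T * [:sym_prod x0 x1 $ i:])"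
  have w: "(\<chi> i. poly (w i) r) = cone (poly S r) (poly T r)" for r
    by (simp add: vec_eq_iff w_def cone_expand)
  \<comment> \<open>The line of parameters may pass through (0, 0), where nothing is known about
    \<open>F * G\<close>. The factors \<open>S\<close> and \<open>T\<close> vanish there, and they
    are not both the zero polynomial.\<close>
  have "poly (mpol_path w F * mpol_path w G * S) r = 0" "poly (mpol_path w F * mpol_path w G * T) r = 0" for r
    using assms[unfolded vanishing_ideal_Cset, rule_format, of "poly S r" "poly T r"]
    by (auto simp: poly_mpol_path w)
  then have "mpol_path w F * mpol_path w G * S = 0" "mpol_path w F * mpol_path w G * T = 0"
    using poly_all_0_iff_0 by blast+
  moreover have "S \<noteq> 0 \<or> T \<noteq> 0" using F(1) by (auto simp: S_def T_def)
  ultimately consider "mpol_path w F = 0" | "mpol_path w G = 0" by auto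
  then show False
  proof cases
    case 1
    then have "poly (mpol_path w F) 0 = 0" by simp
    then show False using F(2) by (simp add: poly_mpol_path w S_def T_def)
  next
    case 2
    then have "poly (mpol_path w G) 1 = 0" by simp
    then show False using G by (simp add: poly_mpol_path w S_def T_def)
  qed
qed

lemma lin_form_y_notin: "lin_form y0 \<notin> vanishing_ideal Cset" "lin_form y1 \<notin> vanishing_ideal Cset"
  by (auto simp: vanishing_ideal_Cset intro!: exI[of _ 1])

lemma vanishing_ideal_Cset_prime_power:
  assumes "G ^ k * F \<in> vanishing_ideal Cset" "G \<notin> vanishing_ideal Cset"
  shows "F \<in> vanishing_ideal Cset"
  using assms(1)
proof (induction k)
  case (Suc k)
  then have "G * (G ^ k * F) \<in> vanishing_ideal Cset" by (simp add: mult.assoc)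
  then show ?case using vanishing_ideal_Cset_prime Suc.IH assms(2) by blast
qed simp

section \<open>Closed subsets and dimension of the conic\<close>

lemma zariski_closed_Cset: "zariski_closed Cset"
  unfolding zariski_closed_def
proof (intro exI[of _ "insert qform {lin_form c | c. \<forall>w\<in>plane. dot c w = 0}"] conjI subset_antisym subsetI)
  show "\<forall>F\<in>insert qform {lin_form c | c. \<forall>w\<in>plane. dot c w = 0}. \<exists>d. homogeneous d F"
    using homogeneous_qform homogeneous_lin_form by blast
next
  fix L assume L: "L \<in> Cset"
  have "vanishes_at F L" if "F \<in> vanishing_ideal Cset" for F
    using that L by (simp add: vanishing_ideal_def)
  then show "L \<in> {L \<in> proj UNIV. \<forall>F\<in>insert qform {lin_form c | c. \<forall>w\<in>plane. dot c w = 0}. vanishes_at F L}"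
    using L Cset_subset_UNIV qform_in_vanishing_ideal lin_form_in_vanishing_ideal by auto
next
  fix L assume L: "L \<in> {L \<in> proj UNIV. \<forall>F\<in>insert qform {lin_form c | c. \<forall>w\<in>plane. dot c w = 0}. vanishes_at F L}"
  then have "L \<in> proj UNIV" by blast
  then obtain v where v: "v \<noteq> 0" "L = vec.span {v}" using proj_UNIV_E by metis
  have "mpol_eval qform v = 0"
    using L v vanishes_at_form[OF homogeneous_qform v(1)] by auto
  moreover have "v \<in> plane"
  proof (rule ccontr)
    assume "v \<notin> plane"
    then obtain c where c: "\<And>u. u \<in> plane \<Longrightarrow> dot c u = 0" "dot c v = 1"
      using vec_separate[OF subspace_plane] by blast
    then have "vanishes_at (lin_form c) L" using L by blast
    then show False using c(2) v vanishes_at_form[OF homogeneous_lin_form v(1), of c] by simp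
  qed
  ultimately show "L \<in> Cset" unfolding v(2) using Cset_if_qform v(1) by blast
qed

lemma cone_span_inj:
  assumes "vec.span {cone s 1} = vec.span {cone t 1}"
  shows "s = t"
proof -
  have "cone s 1 \<noteq> 0" by (simp add: cone_eq_0_iff)
  then obtain c where c: "cone s 1 = c *s cone t 1" using span_singleton_eqD[OF assms] by blast
  have "dot y1 (cone s 1) = c * dot y1 (cone t 1)" "dot y2 (cone s 1) = c * dot y2 (cone t 1)"
    unfolding c by (simp_all only: dot_scale_right)
  then show ?thesis by simp
qed

lemma infinite_Cset: "infinite Cset"
proof
  assume "finite Cset"
  moreover have "(\<lambda>s. vec.span {cone s 1}) ` UNIV \<subseteq> Cset" using Cset_cone by auto
  ultimately have "finite ((\<lambda>s. vec.span {cone s 1}) ` UNIV)" by (rule finite_subset[rotated])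
  then have "finite (UNIV :: 'k set)"
    by (rule finite_imageD) (use cone_span_inj in \<open>auto intro: injI\<close>)
  then show False using infinite_UNIV_char_0 by blast
qed

text \<open>For fixed nonzero \<open>c\<close> the curve formed by the vectors
  \<open>cone r c\<close> meets every point of the conic except the one with t = 0. A polynomial
  vanishing on \<open>Z\<close> therefore has infinitely many zeros along it. All values of
  \<open>c\<close> are needed, as the polynomial need not be a form.\<close>

lemma infinite_closed_eq_Cset:
  assumes "zariski_closed Z" "infinite Z" "Z \<subseteq> Cset"
  shows "Z = Cset"
proof (rule subset_antisym[OF assms(3)])
  have "F \<in> vanishing_ideal Cset" if F: "F \<in> vanishing_ideal Z" for F
  proof -
    have "mpol_eval F (cone r c) = 0" if "c \<noteq> 0" for r c
    proof -
      define w where "w = (\<lambda>i. [:0, 1:]\<^sup>2 * [:veronese x0 $ i:] + [:c\<^sup>2 * veronese x1 $ i:] + [:0, c:] * [:sym_prod x0 x1 $ i:])"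
      have w: "(\<chi> i. poly (w i) r) = cone r c" for r
        by (simp add: vec_eq_iff w_def cone_expand power2_eq_square algebra_simps)
      let ?R = "{r. poly (mpol_path w F) r = 0}"
      have "mpol_path w F = 0"
      proof (rule ccontr)
        assume "mpol_path w F \<noteq> 0"
        then have fin: "finite ?R" by (rule poly_roots_finite)
        have "Z \<subseteq> insert (vec.span {veronese x0}) ((\<lambda>r. vec.span {cone r c}) ` ?R)"
        proof
          fix L assume L: "L \<in> Z"
          then have "L \<in> Cset" using assms(3) by blast
          then obtain s t where st: "s \<noteq> 0 \<or> t \<noteq> 0" "L = vec.span {cone s t}" by (rule Cset_E)
          show "L \<in> insert (vec.span {veronese x0}) ((\<lambda>r. vec.span {cone r c}) ` ?R)"
          proof (cases "t = 0")
            case True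
            then have "cone s t = s\<^sup>2 *s veronese x0" by (simp add: cone_expand)
            then show ?thesis using st True span_singleton_scale[of "s\<^sup>2" "veronese x0"] by simp
          next
            case False
            have "cone s t = (t / c)\<^sup>2 *s cone (c * s / t) c" unfolding cone_scale using False that by simp
            then have L': "L = vec.span {cone (c * s / t) c}"
              using st(2) False that span_singleton_scale[of "(t / c)\<^sup>2" "cone (c * s / t) c"] by simp
            have "mpol_eval F (cone (c * s / t) c) = 0"
              using vanishing_idealD[OF F] L L' cone_eq_0_iff[of "c * s / t" c] that by simp
            then show ?thesis using L' by (auto simp: poly_mpol_path w)
          qed
        qed
        then show False using assms(2) fin finite_subset by blast
      qed
      then show ?thesis using poly_mpol_path[of w F r] by (simp add: w)
    qed
    \<comment> \<open>The factor \<open>y1\<close> has the value \<open>t\<^sup>2\<close>, which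
      covers the point with t = 0; primeness removes it again.\<close>
    then have "lin_form y1 * F \<in> vanishing_ideal Cset" by (auto simp: vanishing_ideal_Cset)
    then show ?thesis using vanishing_ideal_Cset_prime lin_form_y_notin by blast
  qed
  then have "vanishing_ideal Z \<subseteq> vanishing_ideal Cset" by blast
  then show "Cset \<subseteq> Z" by (rule zariski_closed_subset_iff[OF assms(1) Cset_subset_UNIV])
qed

lemma proj_dim_Cset: "proj_dim Cset = 1"
  by (rule proj_dim_curve[OF zariski_closed_Cset infinite_Cset])
    (use infinite_closed_eq_Cset in blast)

section \<open>Scheme structure of the conic and of its hypersurface sections\<close>

lemma scheme_inter_plane:
  "scheme_inter (vanishing_ideal (proj plane)) (ideal_gen {qform}) = vanishing_ideal Cset"
  unfolding scheme_inter_def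
proof (rule ideal_eq_vanishing_ideal_Cset)
  have "lin_form c \<in> vanishing_ideal (proj plane)" if "\<forall>w\<in>plane. dot c w = 0" for c
    unfolding vanishing_ideal_def
    by (auto simp: proj_iff vanishes_at_form[OF homogeneous_lin_form] that)
  then show "conic_ideal (ideal_gen (vanishing_ideal (proj plane) \<union> ideal_gen {qform}))"
    by (simp add: conic_ideal_def ideal_gen_base)
  have "vanishing_ideal (proj plane) \<subseteq> vanishing_ideal Cset"
    using Cset_subset_proj by (auto simp: vanishing_ideal_def)
  moreover have "ideal_gen {qform} \<subseteq> vanishing_ideal Cset"
    by (intro ideal_gen_minimal is_ideal_vanishing_ideal) (simp add: qform_in_vanishing_ideal)
  ultimately show "ideal_gen (vanishing_ideal (proj plane) \<union> ideal_gen {qform}) \<subseteq> vanishing_ideal Cset"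
    by (intro ideal_gen_minimal) auto
qed

lemma conic_Cset: "conic Cset"
  unfolding conic_def variety_def same_subscheme_def
proof (intro conjI exI[of _ plane] exI[of _ qform])
  show "zariski_closed Cset" by (rule zariski_closed_Cset)
  show "Cset \<noteq> {}" using infinite_Cset by auto
  show "homogeneous 2 qform" by (rule homogeneous_qform)
  show "saturation (vanishing_ideal Cset) =
      saturation (scheme_inter (vanishing_ideal (proj plane)) (ideal_gen {qform}))"
    by (simp add: scheme_inter_plane)
  show "qform \<notin> vanishing_ideal (proj plane)"
  proof
    let ?v = "veronese x0 + veronese x1"
    assume "qform \<in> vanishing_ideal (proj plane)"
    moreover have "mpol_eval qform ?v = 1" by (simp add: dot_add_right)
    moreover from this have "?v \<noteq> 0" by auto
    moreover have "?v \<in> plane" by (intro vec.subspace_add subspace_plane plane_base)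
    ultimately show False using vanishing_idealD[of qform "proj plane" ?v] by (auto simp: proj_iff)
  qed
qed (simp_all add: dim_plane)

text \<open>Multiplying by the powers of \<open>y0\<close> and \<open>y1\<close> only: if \<open>y0^k F = A H\<close> and \<open>y1^k F = B H\<close>
  modulo the prime ideal of the conic, then \<open>y1^k A = y0^k B\<close>, so the normal form of \<open>B\<close> is divisible by
  \<open>y1^k\<close>, and the quotient times \<open>H\<close> is \<open>F\<close>.\<close>

lemma saturation_hypersurface_section:
  assumes H: "H \<notin> vanishing_ideal Cset"
  shows "saturation (scheme_inter (vanishing_ideal Cset) (ideal_gen {H})) =
    scheme_inter (vanishing_ideal Cset) (ideal_gen {H})"
  unfolding scheme_inter_def
proof (intro subset_antisym saturation_superset is_ideal_gen subsetI)
  let ?C = "vanishing_ideal Cset"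
  let ?U = "[:[:0, 1:]:] :: 'k poly poly" and ?V = "[:0, 1:] :: 'k poly poly"
  have C: "is_ideal ?C" by simp
  note expl = ideal_gen_Un_singleton[OF C, of H]
  fix F assume "F \<in> saturation (ideal_gen (?C \<union> ideal_gen {H}))"
  then obtain k where k: "\<And>G. homogeneous k G \<Longrightarrow> G * F \<in> ideal_gen (?C \<union> ideal_gen {H})"
    by (auto simp: saturation_def)
  have "homogeneous k (lin_form c ^ k)" for c :: "'k ^ (4 uprod)"
    using homogeneous_power[OF homogeneous_lin_form, of k c] by simp
  then have "lin_form c ^ k * F \<in> ideal_gen (?C \<union> ideal_gen {H})" for c by (rule k)
  then have "\<exists>x A. lin_form c ^ k * F = x + A * H \<and> x \<in> ?C" for c unfolding expl by blast
  then obtain x A x' B where A: "lin_form y0 ^ k * F = x + A * H" "x \<in> ?C"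
    and B: "lin_form y1 ^ k * F = x' + B * H" "x' \<in> ?C" by metis
  obtain A0 A1 where nA: "A - nf A0 A1 \<in> ?C"
    by (rule nf_exists[OF conic_ideal_Cset])
  obtain B0 B1 where nB: "B - nf B0 B1 \<in> ?C"
    by (rule nf_exists[OF conic_ideal_Cset])
  have "(lin_form y1 ^ k * A - lin_form y0 ^ k * B) * H =
      lin_form y1 ^ k * (lin_form y0 ^ k * F - x) - lin_form y0 ^ k * (lin_form y1 ^ k * F - x')"
    unfolding A(1) B(1) by (simp add: algebra_simps)
  also have "\<dots> = lin_form y0 ^ k * x' - lin_form y1 ^ k * x" by (simp add: algebra_simps)
  also have "\<dots> \<in> ?C" by (intro ideal_diff[OF C] ideal_mult[OF C] A(2) B(2))
  finally have "lin_form y1 ^ k * A - lin_form y0 ^ k * B \<in> ?C"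
    using vanishing_ideal_Cset_prime H by blast
  \<comment> \<open>Replacing \<open>A\<close> and \<open>B\<close> by their normal forms turns the
    congruence, by uniqueness, into two identities between polynomials in two variables.\<close>
  from ideal_diff[OF C this ideal_diff[OF C ideal_mult[OF C nA] ideal_mult[OF C nB]]]
  have "lin_form y1 ^ k * A - lin_form y0 ^ k * B
      - (lin_form y1 ^ k * (A - nf A0 A1) - lin_form y0 ^ k * (B - nf B0 B1)) \<in> ?C" .
  moreover have pw: "poly2 (lin_form y0) (lin_form y1) (?V ^ k) = lin_form y1 ^ k"
    "poly2 (lin_form y0) (lin_form y1) (?U ^ k) = lin_form y0 ^ k" for k
    by (induction k) (simp_all add: poly2_hom.hom_mult poly2_hom.hom_one poly1_hom.hom_one del: mult_pCons_left mult_pCons_right)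
  ultimately have "nf (?V ^ k * A0 - ?U ^ k * B0) (?V ^ k * A1 - ?U ^ k * B1) \<in> ?C"
    by (simp add: nf_def poly2_hom.hom_mult poly2_hom.hom_diff pw algebra_simps
        del: mult_pCons_left mult_pCons_right)
  from nf_unique[OF this] have eq: "?V ^ k * A0 = ?U ^ k * B0" "?V ^ k * A1 = ?U ^ k * B1" by simp_all
  \<comment> \<open>\<open>?U ^ k\<close> lies in the coefficient ring and only multiplies each
    coefficient of \<open>D\<close> by a nonzero element. Divisibility by a power of the outer
    variable means that the low coefficients vanish, and this is unaffected.\<close>
  have "?V ^ k dvd D" if "?V ^ k * E = ?U ^ k * D" for D E
  proof -
    have V: "?V ^ k = monom 1 k" by (simp add: monom_altdef)
    have "?U ^ k = [:[:0, 1:] ^ k:]" by (induction k) (simp_all add: one_pCons)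
    then have "?V ^ k dvd smult ([:0, 1:] ^ k) D" using that by (metis dvd_triv_left mult_pCons_left pCons_0_0 add.right_neutral mult_zero_left)
    then show ?thesis unfolding V monom_1_dvd_iff' by simp
  qed
  with eq obtain B0' B1' where B': "B0 = ?V ^ k * B0'" "B1 = ?V ^ k * B1'"
    by (metis dvdE)
  have "nf B0 B1 = lin_form y1 ^ k * nf B0' B1'"
    unfolding B' by (simp only: nf_def poly2_hom.hom_mult pw) (simp add: algebra_simps)
  then have "lin_form y1 ^ k * (F - nf B0' B1' * H) = x' + (B - nf B0 B1) * H"
    by (simp add: right_diff_distrib B(1) flip: mult.assoc) (simp add: algebra_simps)
  also have "\<dots> \<in> ?C" by (intro ideal_add[OF C] ideal_mult_right[OF C] B(2) nB)
  finally have "F - nf B0' B1' * H \<in> ?C"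
    using vanishing_ideal_Cset_prime_power lin_form_y_notin by blast
  moreover have "F = (F - nf B0' B1' * H) + nf B0' B1' * H" by simp
  ultimately show "F \<in> ideal_gen (?C \<union> ideal_gen {H})" unfolding expl by blast
qed

text \<open>The mixed term of \<open>cone s t\<close> has the nonzero coefficient
  \<open>s * t\<close>, so a third point of the conic recovers
  \<open>sym_prod x0 x1\<close>.\<close>

lemma plane_subset:
  assumes "vec.subspace N" "veronese x0 \<in> N" "veronese x1 \<in> N" "cone s t \<in> N" "s \<noteq> 0" "t \<noteq> 0"
  shows "plane \<subseteq> N"
proof -
  have "sym_prod x0 x1 = inverse (s * t) *s (cone s t - s\<^sup>2 *s veronese x0 - t\<^sup>2 *s veronese x1)"
    using assms(5,6) by (simp add: cone_expand field_simps)
  also have "\<dots> \<in> N" using assms by (intro vec.subspace_scale vec.subspace_diff) auto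
  finally show ?thesis unfolding plane_def using assms by (intro vec.span_minimal) auto
qed

end

section \<open>Quadrics through few points of the Veronese variety\<close>

text \<open>The inequality d(d-1)/2 >= d starts at d = 3. Its failure at d = 2 is what admits the
  points of a line.\<close>

lemma card_pairs_ge:
  assumes "3 \<le> card T" "card T \<le> 4"
  shows "card T \<le> card {e. e \<subseteq> T \<and> card e = 2}"
proof -
  have "finite T" using assms by (intro card_ge_0_finite) simp
  then have "card {e. e \<subseteq> T \<and> card e = 2} = card T choose 2" by (rule n_subsets)
  moreover have "card T = 3 \<or> card T = 4" using assms by auto
  ultimately show ?thesis by (auto simp: choose_two)
qed

text \<open>If the functionals \<phi> are dual to \<open>T\<close>, then the squares
  \<open>quad (\<phi> s) (\<phi> s)\<close> are dual to the image of \<open>T\<close>.\<close>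

lemma veronese_image_independent:
  fixes T :: "('k::field ^ 4) set"
  assumes "vec.independent T"
  shows "inj_on veronese T" "vec.independent (veronese ` T)"
proof -
  have finT: "finite T" using assms by (rule vec_finite_independent)
  obtain \<phi> where \<phi>: "\<And>s t. s \<in> T \<Longrightarrow> t \<in> T \<Longrightarrow> dot (\<phi> s) t = (if s = t then 1 else 0)"
    using dual_basis[OF assms] by blast
  show inj: "inj_on veronese T"
  proof (rule inj_onI)
    fix s t assume st: "s \<in> T" "t \<in> T" "veronese s = veronese t"
    then have "dot (quad (\<phi> s) (\<phi> s)) (veronese t) = 1"
      by (simp flip: st(3) add: dot_quad_veronese \<phi>)
    then show "s = t" using st by (simp add: dot_quad_veronese \<phi> split: if_splits)
  qed
  show "vec.independent (veronese ` T)"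
  proof (rule independent_if_dual[where \<phi> = "\<lambda>w. quad (\<phi> (inv_into T veronese w)) (\<phi> (inv_into T veronese w))"])
    fix v w assume "v \<in> veronese ` T" "w \<in> veronese ` T"
    then obtain s t where st: "s \<in> T" "t \<in> T" "v = veronese s" "w = veronese t" by blast
    have "veronese s = veronese t \<longleftrightarrow> s = t" using inj st by (auto dest: inj_onD)
    then show "dot (quad (\<phi> (inv_into T veronese v)) (\<phi> (inv_into T veronese v))) w = (if v = w then 1 else 0)"
      using st inj by (simp add: dot_quad_veronese \<phi>)
  qed (use finT in simp)
qed

text \<open>Suppose the points span a space of dimension at least three, and choose a basis \<open>T\<close> of it among
  them. For fewer than \<open>dim\<close> quadrics there is a nonzero linear functional combining evaluations
  at the sums of two points of \<open>T\<close> (coefficients \<open>\<delta>\<close>) and at the sums of a point of \<open>T\<close> with one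
  of the remaining points (coefficients \<open>\<gamma>\<close>, not depending on the point of \<open>T\<close>) that kills them all.
  Minors in the coordinates dual to \<open>T\<close> detect first \<open>\<gamma>\<close> and then \<open>\<delta>\<close>.\<close>

lemma dim_le_2_if_few_quadrics:
  fixes P :: "('k::field ^ 4) set" and f :: "'i \<Rightarrow> (4 uprod, 'k) mpol"
  assumes I: "finite I" "card I < vec.dim (veronese ` P)"
    and comb: "\<And>\<alpha> \<beta> \<gamma> \<delta>. \<exists>\<kappa>. \<forall>v\<in>vec.span (veronese ` P).
      mpol_eval (minor \<alpha> \<beta> \<gamma> \<delta>) v = (\<Sum>i\<in>I. \<kappa> i * mpol_eval (f i) v)"
  shows "vec.dim P \<le> 2"
proof (rule ccontr)
  assume "\<not> ?thesis"
  then have d3: "3 \<le> vec.dim P" by simp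
  obtain T where T: "T \<subseteq> P" "vec.independent T" "P \<subseteq> vec.span T" "card T = vec.dim P"
    by (rule vec.basis_exists[of P])
  have finT: "finite T" using T(2) by (rule vec_finite_independent)
  have "vec.dim P \<le> 4"
    using dim_subset_UNIV_cart_gen[of P] by simp
  then have pairs: "card T \<le> card {e. e \<subseteq> T \<and> card e = 2}" using d3 T(4) by (intro card_pairs_ge) auto
  obtain \<phi> where \<phi>: "\<And>s t. s \<in> T \<Longrightarrow> t \<in> T \<Longrightarrow> dot (\<phi> s) t = (if s = t then 1 else 0)"
    using dual_basis[OF T(2)] by metis
  note inj = veronese_image_independent(1)[OF T(2)]
  from veronese_image_independent(2)[OF T(2)]
  obtain B where B: "veronese ` T \<subseteq> B" "B \<subseteq> veronese ` P" "vec.independent B" "veronese ` P \<subseteq> vec.span B"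
    by (rule vec.maximal_independent_subset_extend[OF image_mono[OF T(1)]])
  have finB: "finite B" using B(3) by (rule vec_finite_independent)
  define K where "K = B - veronese ` T"
  have finK: "finite K" using finB by (simp add: K_def)
  have "card B = vec.dim (veronese ` P)" using B by (intro vec.basis_card_eq_dim)
  moreover have "card K = card B - card T"
    unfolding K_def using B(1) finT by (simp add: card_Diff_subset card_image[OF inj])
  moreover have "card T \<le> card B" using card_mono[OF finB B(1)] by (simp add: card_image[OF inj])
  \<comment> \<open>The pairs number at least \<open>card T\<close> and \<open>K\<close> has the
    remaining \<open>card B - card T\<close> elements. Together there are at least
    \<open>card B\<close> unknowns, more than the \<open>card I\<close> equations.\<close>
  ultimately have cardJ: "card I < card ({e. e \<subseteq> T \<and> card e = 2} <+> K)"
    using pairs I(2) finT finK by (subst card_Plus) auto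
  let ?E = "{e. e \<subseteq> T \<and> card e = 2}"
  have finE: "finite ?E" using finT by simp
  have "\<exists>x. x \<in> P \<and> veronese x = k" if "k \<in> K" for k using that B(2) K_def by blast
  then obtain g where g: "\<And>k. k \<in> K \<Longrightarrow> g k \<in> P" "\<And>k. k \<in> K \<Longrightarrow> veronese (g k) = k" by metis
  define A where "A i j = (case j of Inl e \<Rightarrow> mpol_eval (f i) (\<Sum>x\<in>e. veronese x)
    | Inr k \<Rightarrow> \<Sum>t\<in>T. mpol_eval (f i) (veronese t + k))" for i j
  obtain c j where j: "j \<in> ?E <+> K" "c j \<noteq> 0" and c: "\<And>i. i \<in> I \<Longrightarrow> (\<Sum>j\<in>?E <+> K. A i j * c j) = 0"
    by (rule homogeneous_system_solution[OF I(1) finite_Plus[OF finE finK] cardJ, of A]) blast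
  define \<delta> where "\<delta> e = c (Inl e)" for e
  define \<gamma> where "\<gamma> k = c (Inr k)" for k
  define \<Lambda> where "\<Lambda> F = (\<Sum>e\<in>?E. F (\<Sum>x\<in>e. veronese x) * \<delta> e) + (\<Sum>k\<in>K. (\<Sum>t\<in>T. F (veronese t + k)) * \<gamma> k)"
    for F :: "'k ^ (4 uprod) \<Rightarrow> 'k"
  have \<Lambda>f: "\<Lambda> (mpol_eval (f i)) = 0" if "i \<in> I" for i
    using c[OF that] by (simp add: sum.Plus[OF finE finK] A_def \<Lambda>_def \<delta>_def \<gamma>_def)
  have \<Lambda>minor: "\<Lambda> (mpol_eval (minor \<alpha> \<beta> \<alpha>' \<beta>')) = 0" for \<alpha> \<beta> \<alpha>' \<beta>'
  proof -
    obtain \<kappa> where \<kappa>: "\<And>v. v \<in> vec.span (veronese ` P) \<Longrightarrow>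
      mpol_eval (minor \<alpha> \<beta> \<alpha>' \<beta>') v = (\<Sum>i\<in>I. \<kappa> i * mpol_eval (f i) v)"
      using comb[of \<alpha> \<beta> \<alpha>' \<beta>'] by blast
    have TP: "veronese t \<in> vec.span (veronese ` P)" if "t \<in> T" for t
      using that T(1) by (intro vec.span_base) auto
    have 1: "mpol_eval (minor \<alpha> \<beta> \<alpha>' \<beta>') (\<Sum>x\<in>e. veronese x) =
        (\<Sum>i\<in>I. \<kappa> i * mpol_eval (f i) (\<Sum>x\<in>e. veronese x))" if "e \<in> ?E" for e
      by (intro \<kappa> vec.span_sum TP) (use that in auto)
    have 2: "mpol_eval (minor \<alpha> \<beta> \<alpha>' \<beta>') (veronese t + k) =
        (\<Sum>i\<in>I. \<kappa> i * mpol_eval (f i) (veronese t + k))" if "t \<in> T" "k \<in> K" for t k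
      by (intro \<kappa> vec.span_add TP vec.span_base) (use that B(2) K_def in auto)
    have "\<Lambda> (mpol_eval (minor \<alpha> \<beta> \<alpha>' \<beta>')) =
        (\<Sum>e\<in>?E. \<Sum>i\<in>I. \<kappa> i * (mpol_eval (f i) (\<Sum>x\<in>e. veronese x) * \<delta> e)) +
        (\<Sum>k\<in>K. \<Sum>t\<in>T. \<Sum>i\<in>I. \<kappa> i * (mpol_eval (f i) (veronese t + k) * \<gamma> k))"
      unfolding \<Lambda>_def sum_distrib_right
      by (intro arg_cong2[where f = "(+)"] sum.cong refl) (simp_all only: 1 2 sum_distrib_right mult.assoc)
    also have "(\<Sum>k\<in>K. \<Sum>t\<in>T. \<Sum>i\<in>I. \<kappa> i * (mpol_eval (f i) (veronese t + k) * \<gamma> k)) =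
        (\<Sum>k\<in>K. \<Sum>i\<in>I. \<Sum>t\<in>T. \<kappa> i * (mpol_eval (f i) (veronese t + k) * \<gamma> k))"
      by (intro sum.cong refl sum.swap)
    also have "\<dots> = (\<Sum>i\<in>I. \<Sum>k\<in>K. \<Sum>t\<in>T. \<kappa> i * (mpol_eval (f i) (veronese t + k) * \<gamma> k))"
      by (rule sum.swap)
    also have "(\<Sum>e\<in>?E. \<Sum>i\<in>I. \<kappa> i * (mpol_eval (f i) (\<Sum>x\<in>e. veronese x) * \<delta> e)) =
        (\<Sum>i\<in>I. \<Sum>e\<in>?E. \<kappa> i * (mpol_eval (f i) (\<Sum>x\<in>e. veronese x) * \<delta> e))"
      by (rule sum.swap)
    finally have "\<Lambda> (mpol_eval (minor \<alpha> \<beta> \<alpha>' \<beta>')) = (\<Sum>i\<in>I. \<kappa> i * \<Lambda> (mpol_eval (f i)))"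
      by (simp add: \<Lambda>_def sum.distrib distrib_left sum_distrib_left sum_distrib_right)
    then show ?thesis using \<Lambda>f by simp
  qed
  have edge: "mpol_eval (minor \<alpha> \<beta> \<alpha>' \<beta>') (\<Sum>x\<in>e. veronese x) =
      (dot \<alpha> x * dot \<beta> y - dot \<alpha> y * dot \<beta> x) * (dot \<alpha>' x * dot \<beta>' y - dot \<alpha>' y * dot \<beta>' x)"
    if "e = {x, y}" "x \<noteq> y" for \<alpha> \<beta> \<alpha>' \<beta>' e x y
    using that by (simp add: minor_veronese_add)
  have \<gamma>0: "(\<Sum>k\<in>K. \<gamma> k * (dot (\<phi> b) (g k) * dot (\<phi> b') (g k))) = 0" if b: "b \<in> T" "b' \<in> T" "b \<noteq> b'" for b b'
  proof -
    have "card {b, b'} < card T" using b d3 T(4) by simp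
    then have "T - {b, b'} \<noteq> {}" by (metis Diff_eq_empty_iff card_mono finite.emptyI finite.insertI not_less)
    then obtain i where i: "i \<in> T" "i \<noteq> b" "i \<noteq> b'" by blast
    \<comment> \<open>At the sum of two basis points the two factors would require the pair to be
      both {i, b} and {i, b'}, so every pair term vanishes. At \<open>veronese t + k\<close> only t
      = i contributes, and it isolates an off-diagonal entry of \<open>k\<close>.\<close>
    let ?D = "mpol_eval (minor (\<phi> i) (\<phi> b) (\<phi> i) (\<phi> b'))"
    have "?D (\<Sum>x\<in>e. veronese x) = 0" if e: "e \<in> ?E" for e
    proof -
      obtain x y where xy: "e = {x, y}" "x \<noteq> y" using e by (auto simp: card_2_iff)
      then have "x \<in> T" "y \<in> T" using e by auto
      then show ?thesis unfolding edge[OF xy] using xy(2) b i by (auto simp: \<phi>)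
    qed
    moreover have "(\<Sum>t\<in>T. ?D (veronese t + k)) = dot (\<phi> b) (g k) * dot (\<phi> b') (g k)" if k: "k \<in> K" for k
    proof -
      have "?D (veronese t + k) = (if t = i then dot (\<phi> b) (g k) * dot (\<phi> b') (g k) else 0)"
        if t: "t \<in> T" for t
      proof -
        have "?D (veronese t + veronese (g k)) = (if t = i then dot (\<phi> b) (g k) * dot (\<phi> b') (g k) else 0)"
          unfolding minor_veronese_add using t b i by (auto simp: \<phi>)
        then show ?thesis by (simp add: g(2)[OF k])
      qed
      then show ?thesis using finT i by simp
    qed
    ultimately have "\<Lambda> ?D = (\<Sum>k\<in>K. dot (\<phi> b) (g k) * dot (\<phi> b') (g k) * \<gamma> k)"
      unfolding \<Lambda>_def by simp
    then show ?thesis using \<Lambda>minor by (simp add: mult_ac)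
  qed
  \<comment> \<open>As a symmetric matrix in the basis \<open>T\<close> the left side is diagonal by
    the previous step. It thus lies in the span of the image of \<open>T\<close>, and independence
    of \<open>B\<close> forces all coefficients \<gamma> to be 0.\<close>
  have "(\<Sum>k\<in>K. \<gamma> k *s k) = (\<Sum>t\<in>T. (\<Sum>k\<in>K. \<gamma> k * (dot (\<phi> t) (g k) * dot (\<phi> t) (g k))) *s veronese t)"
  proof (rule uprod_vec_eqI)
    fix i j
    have "k $ Upair i j = (\<Sum>a\<in>T. \<Sum>b\<in>T. dot (\<phi> a) (g k) * dot (\<phi> b) (g k) * (a $ i * b $ j))" if "k \<in> K" for k
    proof -
      have "g k = (\<Sum>t\<in>T. dot (\<phi> t) (g k) *s t)"
        by (rule dual_basis_expansion[OF \<phi> finT]) (use g(1)[OF that] T(3) in auto)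
      then show ?thesis using veronese_sum[OF finT] g(2)[OF that] by metis
    qed
    then have "(\<Sum>k\<in>K. \<gamma> k *s k) $ Upair i j =
      (\<Sum>k\<in>K. \<Sum>a\<in>T. \<Sum>b\<in>T. \<gamma> k * (dot (\<phi> a) (g k) * dot (\<phi> b) (g k)) * (a $ i * b $ j))"
      by (simp add: sum_component sum_distrib_left mult.assoc)
    also have "\<dots> = (\<Sum>a\<in>T. \<Sum>k\<in>K. \<Sum>b\<in>T. \<gamma> k * (dot (\<phi> a) (g k) * dot (\<phi> b) (g k)) * (a $ i * b $ j))"
      by (rule sum.swap)
    also have "\<dots> = (\<Sum>a\<in>T. \<Sum>b\<in>T. \<Sum>k\<in>K. \<gamma> k * (dot (\<phi> a) (g k) * dot (\<phi> b) (g k)) * (a $ i * b $ j))"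
      by (intro sum.cong refl sum.swap)
    also have "\<dots> = (\<Sum>a\<in>T. \<Sum>b\<in>T. if b = a then
        (\<Sum>k\<in>K. \<gamma> k * (dot (\<phi> a) (g k) * dot (\<phi> a) (g k))) * (a $ i * a $ j) else 0)"
    proof (intro sum.cong refl)
      fix a b assume ab: "a \<in> T" "b \<in> T"
      have "(\<Sum>k\<in>K. \<gamma> k * (dot (\<phi> a) (g k) * dot (\<phi> b) (g k)) * (a $ i * b $ j)) =
        (\<Sum>k\<in>K. \<gamma> k * (dot (\<phi> a) (g k) * dot (\<phi> b) (g k))) * (a $ i * b $ j)"
        by (rule sum_distrib_right[symmetric])
      then show "(\<Sum>k\<in>K. \<gamma> k * (dot (\<phi> a) (g k) * dot (\<phi> b) (g k)) * (a $ i * b $ j)) =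
        (if b = a then (\<Sum>k\<in>K. \<gamma> k * (dot (\<phi> a) (g k) * dot (\<phi> a) (g k))) * (a $ i * a $ j) else 0)"
        using \<gamma>0[OF ab] by auto
    qed
    finally show "(\<Sum>k\<in>K. \<gamma> k *s k) $ Upair i j =
      (\<Sum>t\<in>T. (\<Sum>k\<in>K. \<gamma> k * (dot (\<phi> t) (g k) * dot (\<phi> t) (g k))) *s veronese t) $ Upair i j"
      using finT by (simp add: sum_component veronese_Upair)
  qed
  then have rel: "(\<Sum>k\<in>K. \<gamma> k *s k) \<in> vec.span (veronese ` T)"
    by (simp add: vec.span_sum vec.span_scale vec.span_base)
  obtain \<theta> where \<theta>: "\<And>s t. s \<in> B \<Longrightarrow> t \<in> B \<Longrightarrow> dot (\<theta> s) t = (if s = t then 1 else 0)"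
    using dual_basis[OF B(3)] by metis
  have \<gamma>: "\<gamma> k = 0" if k: "k \<in> K" for k
  proof -
    have "dot (\<theta> k) (\<Sum>k\<in>K. \<gamma> k *s k) = 0"
    proof (rule dot_span_zero[OF _ rel])
      fix t assume t: "t \<in> veronese ` T"
      then have "t \<in> B" "k \<in> B" "t \<noteq> k" using B(1) k K_def by auto
      then show "dot (\<theta> k) t = 0" by (simp add: \<theta>)
    qed
    moreover have "dot (\<theta> k) (\<Sum>k\<in>K. \<gamma> k *s k) = (\<Sum>x\<in>K. if x = k then \<gamma> x else 0)"
      unfolding dot_sum_right dot_scale_right
      by (intro sum.cong refl) (use k K_def \<theta> in auto)
    ultimately show ?thesis using finK k by simp
  qed
  have \<delta>: "\<delta> e = 0" if e: "e \<in> ?E" for e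
  proof -
    obtain b b' where b: "e = {b, b'}" "b \<noteq> b'" using e by (auto simp: card_2_iff)
    then have bT: "b \<in> T" "b' \<in> T" using e by auto
    \<comment> \<open>A principal minor: at a pair sum it is the square of a determinant, 1 for the
      pair \<open>e\<close> and 0 for all others.\<close>
    let ?D = "mpol_eval (minor (\<phi> b) (\<phi> b') (\<phi> b) (\<phi> b'))"
    have "?D (\<Sum>x\<in>e'. veronese x) = (if e' = e then 1 else 0)" if e': "e' \<in> ?E" for e'
    proof -
      obtain x y where xy: "e' = {x, y}" "x \<noteq> y" using e' by (auto simp: card_2_iff)
      then have xyT: "x \<in> T" "y \<in> T" using e' by auto
      have "e' = e \<longleftrightarrow> x = b \<and> y = b' \<or> x = b' \<and> y = b"
        unfolding xy(1) b(1) by (rule doubleton_eq_iff)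
      then show ?thesis unfolding edge[OF xy] using xy(2) b(2) bT xyT by (auto simp: \<phi>)
    qed
    then have "\<Lambda> ?D = (\<Sum>e'\<in>?E. if e' = e then \<delta> e' else 0)"
      unfolding \<Lambda>_def using \<gamma> by (intro trans[OF arg_cong2[where f = "(+)"] add.right_neutral] sum.cong sum.neutral) auto
    also have "\<dots> = \<delta> e" using e finE by simp
    finally show ?thesis using \<Lambda>minor by simp
  qed
  show False using j \<gamma> \<delta> by (auto simp: \<gamma>_def \<delta>_def)
qed

section \<open>Generators of low degree\<close>

lemma vanishes_on_span:
  assumes F: "homogeneous 1 F" "F \<in> vanishing_ideal X" and v: "v \<in> vec.span (\<Union>X)"
  shows "mpol_eval F v = 0"
proof -
  obtain c where c: "\<And>v. mpol_eval F v = dot c v" using homogeneous_1_eval[OF F(1)] by blast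
  show ?thesis unfolding c
  proof (rule dot_span_zero[OF _ v])
    fix t assume "t \<in> \<Union>X"
    then obtain L where L: "L \<in> X" "t \<in> L" by blast
    show "dot c t = 0"
    proof (cases "t = 0")
      case False
      then have "mpol_eval F t = 0" using F(2) L by (auto simp: vanishing_ideal_def vanishes_at_def)
      then show ?thesis by (simp add: c)
    qed simp
  qed
qed

locale ideal_generators =
  fixes X :: "('n::finite, 'k::field) point set" and a :: "nat list" and f :: "('n, 'k) mpol list"
  assumes len: "length f = length a"
    and pos: "i < length a \<Longrightarrow> 1 \<le> a ! i"
    and hom: "i < length a \<Longrightarrow> homogeneous (a ! i) (f ! i)"
    and gen: "vanishing_ideal X = ideal_gen (set f)"
begin

definition deg_idx :: "nat \<Rightarrow> nat set" where
  "deg_idx d = {i. i < length a \<and> a ! i = d}"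

lemma finite_deg_idx [simp]: "finite (deg_idx d)"
  by (simp add: deg_idx_def)

lemma generator_in_ideal: "i < length a \<Longrightarrow> f ! i \<in> vanishing_ideal X"
  by (simp add: gen ideal_gen_base len)

lemma generator_linear:
  assumes "i < length a" "a ! i = 1" "v \<in> vec.span (\<Union>X)"
  shows "mpol_eval (f ! i) v = 0"
  using vanishes_on_span[OF _ generator_in_ideal assms(3)] hom assms by metis

lemma linear_in_ideal:
  assumes "F \<in> vanishing_ideal X" "homogeneous 1 F"
  obtains k where "\<And>v. mpol_eval F v = (\<Sum>i\<in>deg_idx 1. k i * mpol_eval (f ! i) v)"
proof -
  have "\<forall>i<length a. homogeneous (a ! i) (f ! i)" using hom by blast
  from ideal_gen_degree[OF assms(1)[unfolded gen] assms(2) len this]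
  obtain k where k: "\<And>v. \<forall>i<length a. a ! i < 1 \<longrightarrow> mpol_eval (f ! i) v = 0 \<Longrightarrow>
    mpol_eval F v = (\<Sum>i\<in>{i. i < length a \<and> a ! i = 1}. k i * mpol_eval (f ! i) v)"
    by blast
  show thesis
  proof (rule that)
    fix v show "mpol_eval F v = (\<Sum>i\<in>deg_idx 1. k i * mpol_eval (f ! i) v)"
      unfolding deg_idx_def by (rule k) (use pos in force)
  qed
qed

text \<open>Generators of degree below two are linear and vanish on the span of the cone, so there
  only the quadric generators contribute.\<close>

lemma quadric_in_ideal:
  assumes "F \<in> vanishing_ideal X" "homogeneous 2 F"
  obtains k where "\<And>v. v \<in> vec.span (\<Union>X) \<Longrightarrow>
    mpol_eval F v = (\<Sum>i\<in>deg_idx 2. k i * mpol_eval (f ! i) v)"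
proof -
  have "\<forall>i<length a. homogeneous (a ! i) (f ! i)" using hom by blast
  from ideal_gen_degree[OF assms(1)[unfolded gen] assms(2) len this]
  obtain k where k: "\<And>v. \<forall>i<length a. a ! i < 2 \<longrightarrow> mpol_eval (f ! i) v = 0 \<Longrightarrow>
    mpol_eval F v = (\<Sum>i\<in>{i. i < length a \<and> a ! i = 2}. k i * mpol_eval (f ! i) v)"
    by blast
  show thesis
  proof (rule that)
    fix v assume v: "v \<in> vec.span (\<Union>X)"
    show "mpol_eval F v = (\<Sum>i\<in>deg_idx 2. k i * mpol_eval (f ! i) v)"
      unfolding deg_idx_def
    proof (rule k, intro allI impI)
      fix i assume i: "i < length a" "a ! i < 2"
      then have "a ! i = 1" using pos[of i] by simp
      with i v show "mpol_eval (f ! i) v = 0" by (intro generator_linear) auto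
    qed
  qed
qed

text \<open>A linear form vanishing on \<open>X\<close> is a constant combination of the linear
  generators. So a common zero of these cannot be separated from the span of the cone by a linear
  form.\<close>

lemma card_linear_generators: "CARD('n) \<le> card (deg_idx 1) + vec.dim (vec.span (\<Union>X))"
proof -
  have "\<exists>c. \<forall>v. mpol_eval (f ! i) v = dot c v" if "i \<in> deg_idx 1" for i
  proof -
    have "homogeneous 1 (f ! i)" using that hom[of i] by (simp add: deg_idx_def)
    then show ?thesis using homogeneous_1_eval[of "f ! i"] by blast
  qed
  then obtain c where c: "\<And>i v. i \<in> deg_idx 1 \<Longrightarrow> mpol_eval (f ! i) v = dot (c i) v" by metis
  show ?thesis
  proof (rule dim_common_zeros[OF vec.subspace_span finite_deg_idx])
    fix v assume v: "\<And>i. i \<in> deg_idx 1 \<Longrightarrow> dot (c i) v = 0"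
    show "v \<in> vec.span (\<Union>X)"
    proof (rule ccontr)
      assume "v \<notin> vec.span (\<Union>X)"
      then obtain d where d: "\<And>u. u \<in> vec.span (\<Union>X) \<Longrightarrow> dot d u = 0" "dot d v = 1"
        using vec_separate[OF vec.subspace_span] by blast
      have "lin_form d \<in> vanishing_ideal X"
        using d(1) by (auto simp: vanishing_ideal_def vanishes_at_def intro!: vec.span_base)
      then obtain k where "\<And>v. mpol_eval (lin_form d) v = (\<Sum>i\<in>deg_idx 1. k i * mpol_eval (f ! i) v)"
        using linear_in_ideal[OF _ homogeneous_lin_form, of d] by blast
      from this[of v] have "dot d v = 0" by (simp add: c v)
      then show False using d(2) by simp
    qed
  qed
qed

lemma card_deg_idx_le: "card (deg_idx 1) + card (deg_idx 2) \<le> length a"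
proof -
  have "card (deg_idx 1 \<union> deg_idx 2) = card (deg_idx 1) + card (deg_idx 2)"
    by (rule card_Un_disjoint) (auto simp: deg_idx_def)
  moreover have "card (deg_idx 1 \<union> deg_idx 2) \<le> card {..<length a}"
    by (rule card_mono) (auto simp: deg_idx_def)
  ultimately show ?thesis by simp
qed

end

section \<open>Conics, points and pairs of points\<close>

lemma veronese_span_independent:
  fixes x y :: "'k::field ^ 4"
  assumes "x \<noteq> 0" "y \<noteq> 0" "vec.span {veronese x} \<noteq> vec.span {veronese y}"
  shows "x \<noteq> y" "vec.independent {x, y}"
proof -
  show "x \<noteq> y" using assms(3) by auto
  have "x \<notin> vec.span {y}"
  proof
    assume "x \<in> vec.span {y}"
    then obtain c where "c \<noteq> 0" "x = c *s y" using assms(1) span_singleton_nonzero[of x y] by auto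
    then have "veronese x = c\<^sup>2 *s veronese y" "c\<^sup>2 \<noteq> 0" by (simp_all add: veronese_scale)
    then show False using assms(3) span_singleton_scale[of "c\<^sup>2" "veronese y"] by simp
  qed
  then show "vec.independent {x, y}"
    using assms(2) vec.independent_insertI[of x "{y}"] by simp
qed

lemma veronese_conic_exists:
  fixes x y :: "'k::{alg_closed_field, field_char_0} ^ 4"
  assumes "x \<noteq> y" "vec.independent {x, y}"
  obtains \<phi> \<psi> where "veronese_conic x y \<phi> \<psi>"
proof -
  obtain \<phi> where \<phi>: "\<And>s t. s \<in> {x, y} \<Longrightarrow> t \<in> {x, y} \<Longrightarrow> dot (\<phi> s) t = (if s = t then 1 else 0)"
    using dual_basis[OF assms(2)] by blast
  have "veronese_conic x y (\<phi> x) (\<phi> y)"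
    by unfold_locales (use \<phi> assms(1) in auto)
  then show thesis by (rule that)
qed

text \<open>The mixed forms \<open>quad (\<phi> s) (\<phi> t)\<close> vanish on the image of
  \<open>T\<close>, hence on its span, so at most one of the values \<open>dot (\<phi> t) x\<close>
  is nonzero. Images of independent points thus span a space that contains no further point of the
  variety.\<close>

lemma veronese_in_span_independent:
  fixes x :: "'k::field ^ 4"
  assumes T: "vec.independent T" and x: "x \<noteq> 0" "veronese x \<in> vec.span (veronese ` T)"
  shows "\<exists>t\<in>T. vec.span {veronese x} = vec.span {veronese t}"
proof -
  have finT: "finite T" using T by (rule vec_finite_independent)
  obtain \<phi> where \<phi>: "\<And>s t. s \<in> T \<Longrightarrow> t \<in> T \<Longrightarrow> dot (\<phi> s) t = (if s = t then 1 else 0)"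
    using dual_basis[OF T] by blast
  let ?S = "{v. v = (\<Sum>t\<in>T. dot (quad (\<phi> t) (\<phi> t)) v *s veronese t)}"
  have sub: "vec.subspace ?S"
  proof (rule vec.subspaceI)
    fix c x assume "x \<in> ?S"
    then have "c *s x = c *s (\<Sum>t\<in>T. dot (quad (\<phi> t) (\<phi> t)) x *s veronese t)"
      by (intro arg_cong[where f = "(*s) c"]) simp
    also have "\<dots> = (\<Sum>t\<in>T. dot (quad (\<phi> t) (\<phi> t)) (c *s x) *s veronese t)"
      by (simp add: dot_scale_right vec.scale_sum_right)
    finally show "c *s x \<in> ?S" by simp
  qed (auto simp: dot_add_right vec.scale_left_distrib sum.distrib)
  have "veronese s \<in> ?S" if s: "s \<in> T" for s
  proof -
    have "(\<Sum>t\<in>T. dot (quad (\<phi> t) (\<phi> t)) (veronese s) *s veronese t) = (\<Sum>t\<in>T. if t = s then veronese t else 0)"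
      by (intro sum.cong refl) (use s in \<open>simp add: dot_quad_veronese \<phi>\<close>)
    then show ?thesis using s finT by simp
  qed
  then have "vec.span (veronese ` T) \<subseteq> ?S" by (intro vec.span_minimal sub) auto
  with x(2) have "veronese x \<in> ?S" by blast
  then have exp: "veronese x = (\<Sum>t\<in>T. (dot (\<phi> t) x * dot (\<phi> t) x) *s veronese t)"
    by (simp add: dot_quad_veronese)
  have orth: "dot (\<phi> s) x * dot (\<phi> t) x = 0" if "s \<in> T" "t \<in> T" "s \<noteq> t" for s t
  proof -
    have "dot (quad (\<phi> s) (\<phi> t)) (veronese x) = 0"
      by (rule dot_span_zero[OF _ x(2)]) (use that in \<open>auto simp: dot_quad_veronese \<phi>\<close>)
    then show ?thesis by (simp add: dot_quad_veronese)
  qed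
  have "\<exists>t\<in>T. dot (\<phi> t) x \<noteq> 0"
  proof (rule ccontr)
    assume "\<not> ?thesis"
    then have "veronese x = 0" by (subst exp) (simp add: sum.neutral)
    then show False using x(1) by simp
  qed
  then obtain t where t: "t \<in> T" "dot (\<phi> t) x \<noteq> 0" by blast
  have "veronese x = (\<Sum>s\<in>T. if s = t then (dot (\<phi> t) x * dot (\<phi> t) x) *s veronese t else 0)"
  proof (subst exp, intro sum.cong refl)
    fix s assume "s \<in> T"
    then have "s \<noteq> t \<Longrightarrow> dot (\<phi> s) x = 0" using orth[of s t] t by simp
    then show "(dot (\<phi> s) x * dot (\<phi> s) x) *s veronese s =
      (if s = t then (dot (\<phi> t) x * dot (\<phi> t) x) *s veronese t else 0)" by auto
  qed
  also have "\<dots> = (dot (\<phi> t) x * dot (\<phi> t) x) *s veronese t" using t finT by simp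
  finally show ?thesis using t span_singleton_scale[of "dot (\<phi> t) x * dot (\<phi> t) x" "veronese t"] by auto
qed

text \<open>Passing from the scheme to its points: saturation adds no zeros and loses none, because
  at each point a power of a nonzero coordinate can be cancelled.\<close>

lemma conic_points:
  assumes "conic (C :: ('n::finite, 'k::field) point set)"
  obtains W Q where "vec.subspace W" "vec.dim W = 3" "homogeneous 2 Q" "Q \<notin> vanishing_ideal (proj W)"
    "C = {L \<in> proj W. vanishes_at Q L}" "zariski_closed C"
proof -
  from assms obtain W Q where W: "vec.subspace W" "vec.dim W = 3" "homogeneous 2 Q"
    "Q \<notin> vanishing_ideal (proj W)" and closed: "zariski_closed C"
    and same: "saturation (scheme_inter (vanishing_ideal (proj W)) (ideal_gen {Q})) = vanishing_ideal C"
    unfolding conic_def variety_def same_subscheme_def by auto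
  let ?S = "scheme_inter (vanishing_ideal (proj W)) (ideal_gen {Q})"
  have S: "?S \<subseteq> vanishing_ideal C"
    unfolding same[symmetric] by (rule saturation_superset) (simp add: scheme_inter_def)
  have "L \<in> proj W \<and> vanishes_at Q L" if L: "L \<in> C" for L
  proof
    have "Q \<in> ?S" by (simp add: scheme_inter_def ideal_gen_base)
    then show "vanishes_at Q L" using S L by (auto simp: vanishing_ideal_def)
    have "L \<in> proj UNIV" using L closed zariski_closed_subset by blast
    then obtain v where v: "v \<noteq> 0" "L = vec.span {v}" by (rule proj_UNIV_E)
    have "v \<in> W"
    proof (rule ccontr)
      assume "v \<notin> W"
      then obtain c where c: "\<And>u. u \<in> W \<Longrightarrow> dot c u = 0" "dot c v = 1"
        using vec_separate[OF W(1)] by blast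
      have "lin_form c \<in> vanishing_ideal (proj W)"
        unfolding vanishing_ideal_def using W(1) c(1)
        by (auto simp: proj_iff vanishes_at_form[OF homogeneous_lin_form])
      then have "lin_form c \<in> ?S" by (simp add: scheme_inter_def ideal_gen_base)
      then have "mpol_eval (lin_form c) v = 0" using S L v vanishing_idealD by blast
      then show False using c(2) by simp
    qed
    then show "L \<in> proj W" using v proj_iff[OF W(1)] by blast
  qed
  moreover have "L \<in> C" if L: "L \<in> proj W" "vanishes_at Q L" for L
  proof -
    obtain v where v: "v \<noteq> 0" "v \<in> W" "L = vec.span {v}" using L(1) proj_iff[OF W(1)] by blast
    let ?Z = "{F. mpol_eval F v = 0}"
    have "is_ideal ?Z" by (rule is_idealI) auto
    moreover have "vanishing_ideal (proj W) \<subseteq> ?Z" using L(1) v vanishing_idealD by blast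
    moreover have "ideal_gen {Q} \<subseteq> ?Z"
      by (rule ideal_gen_minimal[OF _ \<open>is_ideal ?Z\<close>]) (use L(2) v vanishes_at_form[OF W(3)] in auto)
    ultimately have Z: "?S \<subseteq> ?Z" unfolding scheme_inter_def by (intro ideal_gen_minimal) auto
    show "L \<in> C"
      unfolding v(3)
    proof (rule zariski_closed_mem[OF closed v(1)])
      fix d F assume "F \<in> vanishing_ideal C"
      then obtain k where k: "\<And>G. homogeneous k G \<Longrightarrow> G * F \<in> ?S"
        unfolding same[symmetric] by (auto simp: saturation_def)
      obtain i where i: "v $ i \<noteq> 0" using v(1) by (auto simp: vec_eq_iff)
      have "homogeneous k (mvar i ^ k :: ('n, 'k) mpol)"
        using homogeneous_power[of 1 "mvar i" k] homogeneous_var[of i] by simp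
      then have "mvar i ^ k * F \<in> ?Z" using k Z by blast
      then show "mpol_eval F v = 0" using i by simp
    qed
  qed
  ultimately have "C = {L \<in> proj W. vanishes_at Q L}" by blast
  then show thesis using that W closed by blast
qed

text \<open>Every line through a point off the quadric contains a point of the conic.\<close>

lemma conic_infinite:
  assumes "conic (C :: ('n::finite, 'k::{alg_closed_field, field_char_0}) point set)"
  shows "infinite C"
proof
  assume fin: "finite C"
  obtain W Q where W: "vec.subspace W" "vec.dim W = 3" and Q: "homogeneous 2 Q"
    "Q \<notin> vanishing_ideal (proj W)" and C: "C = {L \<in> proj W. vanishes_at Q L}"
    using conic_points[OF assms] by blast
  obtain L where L: "L \<in> proj W" "\<not> vanishes_at Q L" using Q(2) by (auto simp: vanishing_ideal_def)
  then obtain u where "u \<noteq> 0" "u \<in> W" "L = vec.span {u}" unfolding proj_iff[OF W(1)] by blast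
  then have u: "u \<noteq> 0" "u \<in> W" "mpol_eval Q u \<noteq> 0"
    using L(2) vanishes_at_form[OF Q(1)] by auto
  have "vec.independent {u}" using u(1) by simp
  then obtain B where B: "{u} \<subseteq> B" "B \<subseteq> W" "vec.independent B" "W \<subseteq> vec.span B"
    using vec.maximal_independent_subset_extend[of "{u}" W] u(2) by blast
  have "card B = 3" using vec.basis_card_eq_dim[OF B(2,4,3)] W(2) by simp
  then have "card (B - {u}) = 2" using B(1) by simp
  then obtain w1 w2 where w: "B - {u} = {w1, w2}" "w1 \<noteq> w2" by (auto simp: card_2_iff)
  then have Bw: "B = {u, w1, w2}" "w1 \<noteq> u" "w2 \<noteq> u" using B(1) by auto
  obtain \<phi> where \<phi>: "\<And>s t. s \<in> B \<Longrightarrow> t \<in> B \<Longrightarrow> dot (\<phi> s) t = (if s = t then 1 else 0)"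
    using dual_basis[OF B(3)] by blast
  have "\<exists>r. mpol_eval Q (w1 + c *s w2 + r *s u) = 0" for c
  proof (rule ccontr)
    assume nz: "\<nexists>r. mpol_eval Q (w1 + c *s w2 + r *s u) = 0"
    define p where "p = mpol_path (\<lambda>i. [:(w1 + c *s w2) $ i, u $ i:]) Q"
    \<comment> \<open>The same line read from its other end. A polynomial \<open>p\<close> without
      roots is a constant \<open>e\<close>, and homogeneity of degree 2 then makes \<open>p'\<close>
      equal to \<open>monom e 2\<close>, contradicting its nonzero value at 0, which is the value of
      \<open>Q\<close> at \<open>u\<close>.\<close>
    define p' where "p' = mpol_path (\<lambda>i. [:u $ i, (w1 + c *s w2) $ i:]) Q"
    have p: "poly p r = mpol_eval Q (w1 + c *s w2 + r *s u)" for r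
      unfolding p_def poly_mpol_path by (rule arg_cong[where f = "mpol_eval Q"]) (simp add: vec_eq_iff)
    have p': "poly p' r = mpol_eval Q (u + r *s (w1 + c *s w2))" for r
      unfolding p'_def poly_mpol_path by (rule arg_cong[where f = "mpol_eval Q"]) (simp add: vec_eq_iff)
    have "degree p = 0" using alg_closed_imp_poly_has_root[of p] nz p by auto
    then obtain e where e: "p = [:e:]" by (rule degree_eq_zeroE)
    have "poly (p' - monom e 2) r = 0" if "r \<noteq> 0" for r
    proof -
      have "u + r *s (w1 + c *s w2) = r *s (w1 + c *s w2 + inverse r *s u)"
        using that by (simp add: vec_eq_iff algebra_simps)
      then have "poly p' r = r\<^sup>2 * poly p (inverse r)"
        unfolding p p' by (simp only: homogeneous_scale[OF Q(1)])
      then show ?thesis by (simp add: e poly_monom)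
    qed
    then have "p' - monom e 2 = 0" by (rule poly1_eq_0)
    then have "poly p' 0 = poly (monom e 2) 0" by simp
    then show False using u(3) by (simp add: p' poly_monom)
  qed
  then obtain r where r: "\<And>c. mpol_eval Q (w1 + c *s w2 + r c *s u) = 0" by metis
  define v where "v c = w1 + c *s w2 + r c *s u" for c
  have \<phi>v: "dot (\<phi> w1) (v c) = 1" "dot (\<phi> w2) (v c) = c" for c
    using Bw w(2) by (simp_all add: v_def dot_add_right dot_scale_right \<phi>)
  have vC: "vec.span {v c} \<in> C" for c
  proof -
    have "v c \<noteq> 0" using \<phi>v(1)[of c] by auto
    moreover have "v c \<in> W"
      unfolding v_def using B(2) Bw by (intro vec.subspace_add[OF W(1)] vec.subspace_scale[OF W(1)]) auto
    ultimately show ?thesis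
      unfolding C using r[of c] by (auto simp: proj_iff[OF W(1)] vanishes_at_form[OF Q(1)] v_def)
  qed
  have inj: "inj (\<lambda>c. vec.span {v c})"
  proof (rule injI)
    fix c d assume "vec.span {v c} = vec.span {v d}"
    moreover have "v c \<noteq> 0" using \<phi>v(1)[of c] by auto
    ultimately obtain e where e: "v c = e *s v d" by (rule span_singleton_eqD)
    have "dot (\<phi> w1) (v c) = e * dot (\<phi> w1) (v d)" "dot (\<phi> w2) (v c) = e * dot (\<phi> w2) (v d)"
      unfolding e by (simp_all only: dot_scale_right)
    then show "c = d" by (simp add: \<phi>v)
  qed
  have "finite (range (\<lambda>c. vec.span {v c}))"
    by (rule finite_subset[OF _ fin]) (use vC in auto)
  then have "finite (UNIV :: 'k set)" using inj by (rule finite_imageD)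
  then show False using infinite_UNIV_char_0 by blast
qed

lemma third_point:
  fixes x y z :: "'k::field ^ 4"
  assumes "z \<in> vec.span {x, y}" "z \<noteq> 0" "vec.span {veronese z} \<noteq> vec.span {veronese x}"
    "vec.span {veronese z} \<noteq> vec.span {veronese y}"
  obtains s t where "z = s *s x + t *s y" "s \<noteq> 0" "t \<noteq> 0"
proof -
  from assms(1) obtain s t where z: "z = s *s x + t *s y"
    by (auto simp: vec.span_breakdown_eq algebra_simps)
  have "s \<noteq> 0"
  proof
    assume "s = 0"
    then have "veronese z = t\<^sup>2 *s veronese y" "t\<^sup>2 \<noteq> 0" using z assms(2) by (auto simp: veronese_scale)
    then show False using assms(4) span_singleton_scale[of "t\<^sup>2" "veronese y"] by simp
  qed
  moreover have "t \<noteq> 0"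
  proof
    assume "t = 0"
    then have "veronese z = s\<^sup>2 *s veronese x" "s\<^sup>2 \<noteq> 0" using z assms(2) by (auto simp: veronese_scale)
    then show False using assms(3) span_singleton_scale[of "s\<^sup>2" "veronese x"] by simp
  qed
  ultimately show thesis using z that by blast
qed

text \<open>Take three points of \<open>C\<close>. If their preimages were independent, the plane
  \<open>W\<close> would be spanned by the three images and contain no further point of the variety,
  yet \<open>C\<close> is infinite. So the preimages lie on a line, \<open>W\<close> is the plane of
  its image, and \<open>C\<close> is an infinite closed subset of that smooth conic. In particular,
  reducible conics do not occur.\<close>

lemma conic_on_veronese_variety:
  fixes C :: "(4 uprod, 'k::{alg_closed_field, field_char_0}) point set"
  assumes "conic C" "C \<subseteq> veronese_variety"
  obtains x0 x1 \<phi>0 \<phi>1 where "veronese_conic x0 x1 \<phi>0 \<phi>1" "C = veronese_conic.Cset x0 x1"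
proof -
  have inf: "infinite C" using assms(1) by (rule conic_infinite)
  obtain W Q where W: "vec.subspace W" "vec.dim W = 3" and C: "C = {L \<in> proj W. vanishes_at Q L}"
    and closed: "zariski_closed C"
    using conic_points[OF assms(1)] by blast
  obtain D where D: "D \<subseteq> C" "finite D" "card D = 3" using infinite_arbitrarily_large[OF inf] by blast
  then obtain p0 p1 p2 where "D = {p0, p1, p2}" "p0 \<noteq> p1" "p0 \<noteq> p2" "p1 \<noteq> p2"
    by (auto simp: card_3_iff)
  then have p: "p0 \<in> C" "p1 \<in> C" "p2 \<in> C" "p0 \<noteq> p1" "p0 \<noteq> p2" "p1 \<noteq> p2" using D(1) by auto
  have vc: "\<exists>x. x \<noteq> 0 \<and> L = vec.span {veronese x}" if "L \<in> C" for L
    using that assms(2) veronese_variety_E by blast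
  have inW: "veronese x \<in> W" if "vec.span {veronese x} \<in> C" for x
    using that vec.span_base[of "veronese x" "{veronese x}"] by (auto simp: C proj_def)
  obtain z0 z1 z2 where z: "z0 \<noteq> 0" "z1 \<noteq> 0" "z2 \<noteq> 0"
    "p0 = vec.span {veronese z0}" "p1 = vec.span {veronese z1}" "p2 = vec.span {veronese z2}"
    using vc p(1-3) by metis
  have zW: "veronese z0 \<in> W" "veronese z1 \<in> W" "veronese z2 \<in> W" using inW p(1-3) z by auto
  have ne: "z0 \<noteq> z1" and ind: "vec.independent {z0, z1}"
    using veronese_span_independent[of z0 z1] z p by auto
  obtain \<phi>0 \<phi>1 where vcon: "veronese_conic z0 z1 \<phi>0 \<phi>1"
    using veronese_conic_exists[OF ne ind] by blast
  then interpret veronese_conic z0 z1 \<phi>0 \<phi>1 .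
  have "z2 \<in> vec.span {z0, z1}"
  proof (rule ccontr)
    let ?T = "{z2, z0, z1}"
    assume "z2 \<notin> vec.span {z0, z1}"
    then have T: "vec.independent ?T" using ind by (rule vec.independent_insertI)
    have "z2 \<noteq> z0" "z2 \<noteq> z1" using p z by auto
    then have "card ?T = 3" using ne by simp
    then have "card (veronese ` ?T) = 3"
      using card_image[OF veronese_image_independent(1)[OF T]] by simp
    then have W': "W \<subseteq> vec.span (veronese ` ?T)"
      using zW W(2) veronese_image_independent(2)[OF T]
      by (intro vec.card_ge_dim_independent) auto
    have "C \<subseteq> (\<lambda>t. vec.span {veronese t}) ` ?T"
    proof
      fix L assume L: "L \<in> C"
      then obtain x where x: "x \<noteq> 0" "L = vec.span {veronese x}" using vc by blast
      then have "veronese x \<in> vec.span (veronese ` ?T)" using inW W' L by blast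
      then show "L \<in> (\<lambda>t. vec.span {veronese t}) ` ?T"
        using veronese_in_span_independent[OF T x(1)] x(2) by blast
    qed
    then have "finite C" by (rule finite_subset) simp
    then show False using inf by blast
  qed
  then obtain s t where st: "z2 = s *s z0 + t *s z1" "s \<noteq> 0" "t \<noteq> 0"
    using third_point[of z2 z0 z1] z p by metis
  have "plane \<subseteq> W"
    using plane_subset[OF W(1) zW(1,2) _ st(2,3)] zW(3) st(1) by (simp add: cone_def)
  then have W': "plane = W"
    using vec.subspace_dim_equal[OF subspace_plane W(1)] W(2) dim_plane by simp
  have "C \<subseteq> Cset"
  proof
    fix L assume L: "L \<in> C"
    then obtain x where x: "x \<noteq> 0" "L = vec.span {veronese x}" using vc by blast
    have "mpol_eval qform (veronese x) = 0" unfolding qform_minor by (rule minor_veronese)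
    then show "L \<in> Cset" unfolding x(2)
      using inW L x W' by (intro Cset_if_qform) auto
  qed
  then have "C = Cset" by (rule infinite_closed_eq_Cset[OF closed inf])
  then show thesis using that vcon by blast
qed

text \<open>Modulo the linear forms vanishing at \<open>v\<close> each polynomial becomes a
  polynomial in one linear form with value 1 at \<open>v\<close>, and this is zero if it vanishes at
  all nonzero multiples of \<open>v\<close>. Since \<open>J\<close> may be larger than the ideal of
  the point, the lemma also applies to sums and to colon ideals.\<close>

lemma point_ideal:
  fixes v :: "'k::field_char_0 ^ 'n::finite"
  assumes v: "v \<noteq> 0" and J: "is_ideal J" "\<And>c. dot c v = 0 \<Longrightarrow> lin_form c \<in> J"
    and F: "F \<in> vanishing_ideal {vec.span {v}}"
  shows "F \<in> J"
proof -
  let ?L = "ideal_gen {lin_form c | c. dot c v = 0}"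
  have L: "is_ideal ?L" "\<And>c. dot c v = 0 \<Longrightarrow> lin_form c \<in> ?L"
    by (auto intro: ideal_gen_base)
  have LI: "?L \<subseteq> vanishing_ideal {vec.span {v}}"
    by (rule ideal_gen_minimal[OF _ is_ideal_vanishing_ideal]) (use v in \<open>auto simp: vanishing_ideal_def vanishes_at_form[OF homogeneous_lin_form]\<close>)
  have "v \<notin> {0}" using v by simp
  then obtain d where d: "dot d v = 1"
    using vec_separate[OF vec.subspace_single_0] by blast
  have ex: "\<exists>A. F - poly1 (lin_form d) A \<in> ?L" for F
  proof (induction F rule: mpol_induct)
    case (const c)
    show ?case by (intro exI[of _ "[:c:]"]) (simp add: ideal_zero[OF L(1)])
  next
    case (var i)
    have "dot (axis i 1 - v $ i *s d) v = dot (axis i 1) v - v $ i * dot d v"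
      by (simp add: dot_def left_diff_distrib sum_subtractf sum_distrib_left mult.assoc)
    also have "dot (axis i 1) v = v $ i"
      by (simp add: dot_def axis_def if_distrib if_distribR cong: if_cong)
    finally have "dot (axis i 1 - v $ i *s d) v = 0" by (simp add: d)
    then have "lin_form (axis i 1 - v $ i *s d) \<in> ?L" by (rule L(2))
    then show ?case
      by (intro exI[of _ "[:0, v $ i:]"]) (simp add: lin_form_diff lin_form_scale lin_form_axis mult.commute)
  next
    case (add F G)
    then obtain A B where "F - poly1 (lin_form d) A \<in> ?L" "G - poly1 (lin_form d) B \<in> ?L" by blast
    then have "(F - poly1 (lin_form d) A) + (G - poly1 (lin_form d) B) \<in> ?L" by (rule ideal_add[OF L(1)])
    then show ?case by (intro exI[of _ "A + B"]) (simp add: poly1_hom.hom_add algebra_simps)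
  next
    case (mult F G)
    then obtain A B where "F - poly1 (lin_form d) A \<in> ?L" "G - poly1 (lin_form d) B \<in> ?L" by blast
    from normal_form_mult[OF L(1) this] show ?case
      by (intro exI[of _ "A * B"]) (simp add: poly1_hom.hom_mult)
  qed
  obtain A where A: "F - poly1 (lin_form d) A \<in> ?L" using ex by blast
  have "F - (F - poly1 (lin_form d) A) \<in> vanishing_ideal {vec.span {v}}"
    by (rule ideal_diff[OF is_ideal_vanishing_ideal F subsetD[OF LI A]])
  then have I: "poly1 (lin_form d) A \<in> vanishing_ideal {vec.span {v}}" by simp
  have "poly A a = 0" if "a \<noteq> 0" for a
  proof -
    have "vec.span {a *s v} = vec.span {v}" "a *s v \<noteq> 0"
      using span_singleton_scale[OF that] v that by auto
    then have "mpol_eval (poly1 (lin_form d) A) (a *s v) = 0"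
      using vanishing_idealD[OF I, of "a *s v"] by simp
    then show ?thesis by (simp add: dot_scale_right d)
  qed
  then have "A = 0" by (rule poly1_eq_0)
  then have "F \<in> ?L" using A by simp
  moreover have "?L \<subseteq> J" by (rule ideal_gen_minimal[OF _ J(1)]) (use J(2) in auto)
  ultimately show ?thesis by blast
qed

section \<open>Complete intersections on the Veronese variety\<close>

text \<open>The number of ones is expressed through positions so as to match
  \<open>deg_idx 1\<close>.\<close>

lemma sorted_degrees:
  fixes a :: "nat list"
  assumes "sorted a" "\<And>x. x \<in> set a \<Longrightarrow> 1 \<le> x"
  shows "\<exists>b. a = replicate (card {i. i < length a \<and> a ! i = 1}) 1 @ b \<and> sorted b \<and> (\<forall>x\<in>set b. 2 \<le> x)"
proof -
  have "\<exists>b. a = replicate (length (filter (\<lambda>x. x = 1) a)) 1 @ b \<and> sorted b \<and> (\<forall>x\<in>set b. 2 \<le> x)"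
    using assms
  proof (induction a)
    case (Cons x xs)
    show ?case
    proof (cases "x = 1")
      case True
      obtain b where "xs = replicate (length (filter (\<lambda>x. x = 1) xs)) 1 @ b" "sorted b" "\<forall>x\<in>set b. 2 \<le> x"
        using Cons by auto
      then show ?thesis using True by (intro exI[of _ b]) simp
    next
      case False
      then have "2 \<le> x" using Cons.prems(2)[of x] by simp
      then have ge: "\<forall>y\<in>set (x # xs). 2 \<le> y" using Cons.prems(1) by auto
      then have "filter (\<lambda>x. x = 1) (x # xs) = []" by (auto simp: filter_empty_conv)
      then show ?thesis using ge Cons.prems(1) by (intro exI[of _ "x # xs"]) simp
    qed
  qed simp
  then show ?thesis by (simp add: length_filter_conv_card)
qed

text \<open>The generators are as many linear forms as the codimension of \<open>W\<close>, followed
  by \<open>fs\<close>. Their choice stays hidden: \<open>gen\<close> quantifies over every ideal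
  \<open>J\<close> below the vanishing ideal that contains \<open>fs\<close> and all linear forms
  vanishing on \<open>W\<close>.\<close>

lemma complete_intersectionI:
  fixes X :: "('n::finite, 'k::field) point set"
  assumes W: "vec.subspace W" and codim: "has_codim X (length a)"
    and a: "a = replicate (CARD('n) - vec.dim W) 1 @ b" "\<And>x. x \<in> set b \<Longrightarrow> 1 \<le> x"
    and fs: "length fs = length b" "\<And>i. i < length b \<Longrightarrow> homogeneous (b ! i) (fs ! i)"
    and lin: "\<And>c. (\<And>w. w \<in> W \<Longrightarrow> dot c w = 0) \<Longrightarrow> lin_form c \<in> vanishing_ideal X"
    and sub: "set fs \<subseteq> vanishing_ideal X"
    and gen: "\<And>J. is_ideal J \<Longrightarrow> (\<And>c. (\<And>w. w \<in> W \<Longrightarrow> dot c w = 0) \<Longrightarrow> lin_form c \<in> J) \<Longrightarrow> set fs \<subseteq> J \<Longrightarrow>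
      J \<subseteq> vanishing_ideal X \<Longrightarrow> vanishing_ideal X \<subseteq> J"
  shows "complete_intersection X a"
proof -
  obtain cs where cs: "length cs = CARD('n) - vec.dim W" "\<And>c w. c \<in> set cs \<Longrightarrow> w \<in> W \<Longrightarrow> dot c w = 0"
    "\<And>c. (\<And>w. w \<in> W \<Longrightarrow> dot c w = 0) \<Longrightarrow> c \<in> vec.span (set cs)"
    using annihilator_generators[OF W] by blast
  define f where "f = map lin_form cs @ fs"
  have "ideal_gen (set f) \<subseteq> vanishing_ideal X"
    by (rule ideal_gen_minimal[OF _ is_ideal_vanishing_ideal]) (use sub lin cs(2) in \<open>auto simp: f_def\<close>)
  moreover have "vanishing_ideal X \<subseteq> ideal_gen (set f)"
  proof (rule gen)
    show "lin_form c \<in> ideal_gen (set f)" if "\<And>w. w \<in> W \<Longrightarrow> dot c w = 0" for c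
      by (rule lin_form_in_span[OF is_ideal_gen _ cs(3)[OF that]]) (auto simp: f_def intro: ideal_gen_base)
    show "set fs \<subseteq> ideal_gen (set f)" by (auto simp: f_def intro: ideal_gen_base)
  qed (use calculation in simp_all)
  ultimately have "vanishing_ideal X = ideal_gen (set f)" by simp
  moreover have "length f = length a" by (simp add: f_def a cs fs)
  moreover have "\<forall>i<length a. 1 \<le> a ! i" using a(2) by (auto simp: a(1) nth_append)
  moreover have "\<forall>i<length a. homogeneous (a ! i) (f ! i)"
  proof (intro allI impI)
    fix i assume "i < length a"
    then show "homogeneous (a ! i) (f ! i)"
      using fs(2)[of "i - length cs"] homogeneous_lin_form
      by (cases "i < length cs") (auto simp: a(1) f_def nth_append cs(1)[symmetric])
  qed
  ultimately show ?thesis using codim unfolding complete_intersection_def by blast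
qed

section \<open>Generators for the listed sets\<close>

context veronese_conic
begin

lemma complete_intersection_Cset: "complete_intersection Cset (replicate 7 1 @ [2])"
proof (rule complete_intersectionI[where fs = "[qform]" and b = "[2]", OF subspace_plane])
  show "has_codim Cset (length (replicate 7 1 @ [2]))"
    by (simp add: has_codim_def proj_dim_Cset CARD_4_uprod one_enat_def)
  show "replicate 7 1 @ [2] = replicate (CARD(4 uprod) - vec.dim plane) 1 @ [2]"
    unfolding CARD_4_uprod dim_plane by simp
  show "set [qform] \<subseteq> vanishing_ideal Cset" by (simp add: qform_in_vanishing_ideal)
  show "vanishing_ideal Cset \<subseteq> J" if "is_ideal J" "\<And>c. (\<And>w. w \<in> plane \<Longrightarrow> dot c w = 0) \<Longrightarrow> lin_form c \<in> J"
    "set [qform] \<subseteq> J" "J \<subseteq> vanishing_ideal Cset" for J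
    using ideal_eq_vanishing_ideal_Cset[OF _ that(4)] that(1-3) by (simp add: conic_ideal_def)
qed (auto simp: homogeneous_qform intro: lin_form_in_vanishing_ideal)

text \<open>If \<open>H\<close> vanished on the conic, \<open>X\<close> would be the whole conic,
  against its dimension 0. Otherwise the sum of ideals is saturated, and equality of subschemes
  becomes equality of ideals.\<close>

lemma complete_intersection_section:
  assumes X: "variety X" "proj_dim X = 0" and H: "homogeneous b H" and b: "2 \<le> b"
    and same: "same_subscheme (vanishing_ideal X) (scheme_inter (vanishing_ideal Cset) (ideal_gen {H}))"
  shows "complete_intersection X (replicate 7 1 @ [2, b])"
proof -
  have HC: "H \<notin> vanishing_ideal Cset"
  proof
    assume H: "H \<in> vanishing_ideal Cset"
    have "scheme_inter (vanishing_ideal Cset) (ideal_gen {H}) = vanishing_ideal Cset"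
      unfolding scheme_inter_def
    proof (rule subset_antisym)
      show "ideal_gen (vanishing_ideal Cset \<union> ideal_gen {H}) \<subseteq> vanishing_ideal Cset"
        using ideal_gen_minimal[of "{H}" "vanishing_ideal Cset"] H by (intro ideal_gen_minimal) auto
    qed (auto intro: ideal_gen_base)
    then have I: "vanishing_ideal X = vanishing_ideal Cset"
      using same by (simp add: same_subscheme_def)
    have cX: "zariski_closed X" using X(1) by (simp add: variety_def)
    have "X = Cset"
      using zariski_closed_subset_iff[OF cX Cset_subset_UNIV]
        zariski_closed_subset_iff[OF zariski_closed_Cset zariski_closed_subset[OF cX]] I by auto
    then show False using X(2) proj_dim_Cset by simp
  qed
  have I: "vanishing_ideal X = scheme_inter (vanishing_ideal Cset) (ideal_gen {H})"
    using same saturation_hypersurface_section[OF HC] by (simp add: same_subscheme_def)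
  have CX: "vanishing_ideal Cset \<subseteq> vanishing_ideal X" and HX: "H \<in> vanishing_ideal X"
    unfolding I scheme_inter_def by (auto intro: ideal_gen_base)
  show ?thesis
  proof (rule complete_intersectionI[where fs = "[qform, H]" and b = "[2, b]", OF subspace_plane])
    show "has_codim X (length (replicate 7 1 @ [2, b]))"
      by (simp add: has_codim_def X(2) CARD_4_uprod)
    show "replicate 7 1 @ [2, b] = replicate (CARD(4 uprod) - vec.dim plane) 1 @ [2, b]"
      unfolding CARD_4_uprod dim_plane by simp
    show "homogeneous ([2, b] ! i) ([qform, H] ! i)" if "i < length [2, b]" for i
      using that H homogeneous_qform by (cases i) auto
    show "lin_form c \<in> vanishing_ideal X" if "\<And>w. w \<in> plane \<Longrightarrow> dot c w = 0" for c
      using CX lin_form_in_vanishing_ideal[OF that] by blast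
    show "set [qform, H] \<subseteq> vanishing_ideal X" using CX HX qform_in_vanishing_ideal by auto
    show "vanishing_ideal X \<subseteq> J" if J: "is_ideal J" "\<And>c. (\<And>w. w \<in> plane \<Longrightarrow> dot c w = 0) \<Longrightarrow> lin_form c \<in> J"
      "set [qform, H] \<subseteq> J" "J \<subseteq> vanishing_ideal X" for J
    proof -
      \<comment> \<open>\<open>J\<close> contains \<open>H\<close> and need not lie below the ideal
        of the conic. The intersection does, and it still contains the equations of the
        conic.\<close>
      let ?J = "J \<inter> vanishing_ideal Cset"
      have "is_ideal ?J"
        using J(1) is_ideal_vanishing_ideal[of Cset] unfolding is_ideal_def
        by (rule ring_mod.subspace_inter)
      then have "conic_ideal ?J"
        using J conic_ideal_Cset by (simp add: conic_ideal_def)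
      then have "?J = vanishing_ideal Cset" by (rule ideal_eq_vanishing_ideal_Cset) simp
      then have "vanishing_ideal Cset \<subseteq> J" by blast
      moreover have "ideal_gen {H} \<subseteq> J" using J by (intro ideal_gen_minimal) auto
      ultimately show ?thesis unfolding I scheme_inter_def by (intro ideal_gen_minimal J(1)) auto
    qed
  qed (use b in auto)
qed

end

lemma complete_intersection_point:
  assumes p: "p \<in> (proj UNIV :: (4 uprod, 'k::field_char_0) point set)"
  shows "complete_intersection {p} (replicate 9 1)"
proof -
  obtain v where v: "v \<noteq> 0" "p = vec.span {v}" using p by (rule proj_UNIV_E)
  have lin: "lin_form c \<in> vanishing_ideal {p}" if "dot c v = 0" for c
    using that v by (simp add: vanishing_ideal_def vanishes_at_form[OF homogeneous_lin_form])
  show ?thesis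
  proof (rule complete_intersectionI[where fs = "[]" and b = "[]" and W = "vec.span {v}"])
    show "has_codim {p} (length (replicate 9 1))"
      using proj_dim_finite[of "{p}"] p by (simp add: has_codim_def CARD_4_uprod)
    show "replicate 9 1 = replicate (CARD(4 uprod) - vec.dim (vec.span {v})) 1 @ []"
      using v by (simp only: CARD_4_uprod vec.dim_span vec.dim_singleton) simp
    show "lin_form c \<in> vanishing_ideal {p}" if "\<And>w. w \<in> vec.span {v} \<Longrightarrow> dot c w = 0" for c
      by (rule lin, rule that) (simp add: vec.span_base)
    show "vanishing_ideal {p} \<subseteq> J" if "is_ideal J" "\<And>c. (\<And>w. w \<in> vec.span {v} \<Longrightarrow> dot c w = 0) \<Longrightarrow> lin_form c \<in> J"
      "set [] \<subseteq> J" "J \<subseteq> vanishing_ideal {p}" for J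
    proof
      fix F assume "F \<in> vanishing_ideal {p}"
      then show "F \<in> J" unfolding v(2)
      proof (rule point_ideal[OF v(1) that(1), rotated])
        fix c assume c: "dot c v = 0"
        show "lin_form c \<in> J" by (rule that(2)) (rule dot_span_zero[of "{v}"], use c in auto)
      qed
    qed
  qed simp_all
qed

text \<open>Let \<open>z\<close> vanish at \<open>v\<close> and \<open>y\<close> at
  \<open>w\<close>. The ideal of the point \<open>v\<close> lies in \<open>J\<close> + (z), so F = x
  + G z with \<open>x\<close> in \<open>J\<close>. As \<open>z\<close> is nonzero at
  \<open>w\<close>, G vanishes there. The colon ideal of \<open>J\<close> by \<open>z\<close>
  contains \<open>y\<close> and hence the ideal of \<open>w\<close>, so it contains G.\<close>

lemma complete_intersection_two_points:
  fixes X :: "(4 uprod, 'k::field_char_0) point set"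
  assumes X: "X \<subseteq> proj UNIV" "card X = 2"
  shows "complete_intersection X (replicate 8 1 @ [2])"
proof -
  obtain p q where pq: "X = {p, q}" "p \<noteq> q" using X(2) by (auto simp: card_2_iff)
  have "p \<in> proj UNIV" "q \<in> proj UNIV" using X(1) pq by auto
  then obtain v w where v: "v \<noteq> 0" "p = vec.span {v}" and w: "w \<noteq> 0" "q = vec.span {w}"
    using proj_UNIV_E by metis
  have "v \<notin> vec.span {w}" using span_singleton_mem[of v w] v w pq(2) by auto
  then have ind: "vec.independent {v, w}" using w(1) vec.independent_insertI[of v "{w}"] by simp
  have "v \<noteq> w" using pq v w by auto
  obtain \<phi> where \<phi>: "\<And>s t. s \<in> {v, w} \<Longrightarrow> t \<in> {v, w} \<Longrightarrow> dot (\<phi> s) t = (if s = t then 1 else 0)"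
    using dual_basis[OF ind] by blast
  define y where "y = \<phi> v"
  define z where "z = \<phi> w"
  have d: "dot y v = 1" "dot y w = 0" "dot z v = 0" "dot z w = 1"
    using \<phi> \<open>v \<noteq> w\<close> by (auto simp: y_def z_def)
  define W where "W = vec.span {v, w}"
  have dimW: "vec.dim W = 2"
    using ind \<open>v \<noteq> w\<close> by (simp add: W_def vec.dim_eq_card_independent)
  have annW: "dot c u = 0" if "dot c v = 0" "dot c w = 0" "u \<in> W" for c u
    by (rule dot_span_zero[of "{v, w}"]) (use that in \<open>auto simp: W_def\<close>)
  have Wvw: "v \<in> W" "w \<in> W" by (auto simp: W_def intro: vec.span_base)
  let ?Q = "lin_form y * lin_form z"
  have hQ: "homogeneous 2 ?Q"
    using homogeneous_mult[OF homogeneous_lin_form homogeneous_lin_form] by (simp add: numeral_2_eq_2)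
  show ?thesis
  proof (rule complete_intersectionI[where fs = "[?Q]" and b = "[2]" and W = W])
    show "vec.subspace W" by (simp add: W_def)
    have "finite X" "X \<noteq> {}" using X(2) by (auto intro: card_ge_0_finite)
    then show "has_codim X (length (replicate 8 1 @ [2]))"
      using proj_dim_finite[OF _ _ X(1)] by (simp add: has_codim_def CARD_4_uprod)
    show "replicate 8 1 @ [2] = replicate (CARD(4 uprod) - vec.dim W) 1 @ [2]"
      unfolding CARD_4_uprod dimW by simp
    show "homogeneous ([2] ! i) ([?Q] ! i)" if "i < length [2]" for i using hQ that by simp
    show "lin_form c \<in> vanishing_ideal X" if "\<And>u. u \<in> W \<Longrightarrow> dot c u = 0" for c
      using that[of v] that[of w] v w Wvw
      by (simp add: pq vanishing_ideal_def vanishes_at_form[OF homogeneous_lin_form])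
    show "set [?Q] \<subseteq> vanishing_ideal X"
      using v w d by (simp add: pq vanishing_ideal_def vanishes_at_form[OF hQ])
    show "vanishing_ideal X \<subseteq> J" if J: "is_ideal J" "\<And>c. (\<And>u. u \<in> W \<Longrightarrow> dot c u = 0) \<Longrightarrow> lin_form c \<in> J"
      "set [?Q] \<subseteq> J" "J \<subseteq> vanishing_ideal X" for J
    proof
      have lin: "lin_form c \<in> J" if "dot c v = 0" "dot c w = 0" for c
        using J(2) annW that by blast
      have colon: "is_ideal {F. G * F \<in> J}" for G
        by (rule is_idealI) (use J(1) in \<open>auto simp: ideal_zero ideal_add distrib_left
            mult.left_commute[of G] intro: ideal_mult\<close>)
      fix F assume F: "F \<in> vanishing_ideal X"
      let ?Z = "ideal_gen (J \<union> ideal_gen {lin_form z})"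
      have "F \<in> ?Z"
      proof (rule point_ideal[OF v(1) is_ideal_gen])
        show "F \<in> vanishing_ideal {vec.span {v}}" using F by (simp add: vanishing_ideal_def pq v)
        fix c assume c: "dot c v = 0"
        let ?c = "c - dot c w *s z"
        have "dot ?c u = dot c u - dot c w * dot z u" for u
          by (simp add: dot_def left_diff_distrib sum_subtractf sum_distrib_left mult.assoc)
        then have "lin_form ?c \<in> J" by (intro lin) (simp_all add: c d)
        then have "lin_form c - mconst (dot c w) * lin_form z \<in> J"
          by (simp add: lin_form_diff lin_form_scale)
        then show "lin_form c \<in> ?Z"
          unfolding ideal_gen_Un_singleton[OF J(1)]
          by (intro CollectI exI[of _ "lin_form c - mconst (dot c w) * lin_form z"]
              exI[of _ "mconst (dot c w)"]) simp
      qed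
      then obtain x G where G: "F = x + G * lin_form z" "x \<in> J"
        unfolding ideal_gen_Un_singleton[OF J(1)] by blast
      have I: "G * lin_form z \<in> vanishing_ideal X"
        using ideal_diff[OF is_ideal_vanishing_ideal F subsetD[OF J(4) G(2)]] by (simp add: G(1))
      have "G \<in> {F. lin_form z * F \<in> J}"
      proof (rule point_ideal[OF w(1) colon])
        have "mpol_eval G (c *s w) = 0" if "c \<noteq> 0" for c
        proof -
          have "vec.span {c *s w} \<in> X" "c *s w \<noteq> 0"
            using span_singleton_scale[OF that, of w] w that by (auto simp: pq)
          from vanishing_idealD[OF I this] show ?thesis using that by (simp add: dot_scale_right d)
        qed
        then show "G \<in> vanishing_ideal {vec.span {w}}"
          using w(1) by (simp add: vanishing_ideal_def vanishes_at_span)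
        fix c assume c: "dot c w = 0"
        let ?c = "c - dot c v *s y"
        have "dot ?c u = dot c u - dot c v * dot y u" for u
          by (simp add: dot_def left_diff_distrib sum_subtractf sum_distrib_left mult.assoc)
        then have "lin_form ?c \<in> J" by (intro lin) (simp_all add: c d)
        from ideal_mult[OF J(1) this] ideal_mult[OF J(1), of ?Q]
        have "lin_form z * lin_form ?c + mconst (dot c v) * ?Q \<in> J"
          using J(3) by (intro ideal_add[OF J(1)]) simp_all
        then show "lin_form c \<in> {F. lin_form z * F \<in> J}"
          by (simp add: lin_form_diff lin_form_scale algebra_simps)
      qed
      then show "F \<in> J" using G J(1) by (simp add: ideal_add mult.commute)
    qed
  qed auto
qed

section \<open>From generators to the list of types\<close>

lemma span_Union_veronese:
  fixes X :: "(4 uprod, 'k::field) point set"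
  assumes "X \<subseteq> veronese_variety"
  shows "vec.span (\<Union>X) = vec.span (veronese ` {x. x \<noteq> 0 \<and> vec.span {veronese x} \<in> X})"
    (is "_ = vec.span (veronese ` ?P)")
proof -
  have "\<Union>X \<subseteq> vec.span (veronese ` ?P)"
  proof
    fix v assume "v \<in> \<Union>X"
    then obtain L where L: "L \<in> X" "v \<in> L" by blast
    then obtain x where x: "x \<noteq> 0" "L = vec.span {veronese x}" using assms veronese_variety_E by blast
    then have "{veronese x} \<subseteq> veronese ` ?P" using L(1) by auto
    then have "vec.span {veronese x} \<subseteq> vec.span (veronese ` ?P)" by (rule vec.span_mono)
    then show "v \<in> vec.span (veronese ` ?P)" using L(2) x(2) by blast
  qed
  moreover have "veronese ` ?P \<subseteq> \<Union>X" using vec.span_base by auto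
  ultimately show ?thesis
    by (meson vec.span_minimal vec.span_mono vec.subspace_span subset_antisym)
qed

text \<open>Three counts fix the degrees: at least 10 - dim N generators are linear, the dimension
  of \<open>X\<close> gives a total of 9 for finite \<open>X\<close> and of 8 for the conic, and a
  second point of \<open>X\<close> forces a quadric generator.\<close>

lemma complete_intersection_classification:
  fixes X :: "(4 uprod, 'k::{alg_closed_field, field_char_0}) point set" and a :: "nat list"
  assumes X: "variety X" "X \<subseteq> veronese_variety" and a: "sorted a" and ci: "complete_intersection X a"
  shows "a = replicate 9 1 \<and> (\<exists>p. X = {p})
    \<or> a = replicate 8 1 @ [2] \<and> card X = 2
    \<or> (\<exists>b\<ge>2. a = replicate 7 1 @ [2, b] \<and> proj_dim X = 0 \<and>
        (\<exists>C H. conic C \<and> C \<subseteq> veronese_variety \<and> homogeneous b H \<and> H \<noteq> 0 \<and>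
          same_subscheme (vanishing_ideal X)
            (scheme_inter (vanishing_ideal C) (ideal_gen {H}))))
    \<or> a = replicate 7 1 @ [2] \<and> conic X"
proof -
  from ci obtain f where f: "length f = length a" "\<forall>i<length a. 1 \<le> a ! i"
    "\<forall>i<length a. homogeneous (a ! i) (f ! i)" "vanishing_ideal X = ideal_gen (set f)"
    and codim: "has_codim X (length a)"
    unfolding complete_intersection_def by blast
  interpret ideal_generators X a f by unfold_locales (use f in auto)
  have closed: "zariski_closed X" and ne: "X \<noteq> {}" using X(1) by (auto simp: variety_def)
  have XU: "X \<subseteq> proj UNIV" using closed by (rule zariski_closed_subset)
  have codim9: "proj_dim X + enat (length a) = 9"
    using codim by (simp add: has_codim_def CARD_4_uprod numeral_eq_enat)
  then have r9: "length a \<le> 9" by (cases "proj_dim X") (auto simp: numeral_eq_enat)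
  define N where "N = vec.span (\<Union>X)"
  have D1: "10 \<le> card (deg_idx 1) + vec.dim N"
    using card_linear_generators by (simp add: N_def CARD_4_uprod)
  define P where "P = {x. x \<noteq> 0 \<and> vec.span {veronese x} \<in> X}"
  have NP: "N = vec.span (veronese ` P)" unfolding N_def P_def by (rule span_Union_veronese[OF X(2)])
  have ptP: "\<exists>x\<in>P. p = vec.span {veronese x}" if "p \<in> X" for p
    using that X(2) veronese_variety_E unfolding P_def by blast
  have PN: "veronese x \<in> N" if "x \<in> P" for x unfolding NP using that by (intro vec.span_base) auto
  have dimP: "vec.dim P \<le> 2"
  proof (rule dim_le_2_if_few_quadrics)
    have "card (deg_idx 2) < vec.dim N" using D1 card_deg_idx_le r9 by linarith
    then show "card (deg_idx 2) < vec.dim (veronese ` P)" by (simp add: NP)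
    fix \<alpha> \<beta> \<gamma> \<delta> :: "'k ^ 4"
    obtain k where k: "\<And>v. v \<in> N \<Longrightarrow>
        mpol_eval (minor \<alpha> \<beta> \<gamma> \<delta>) v = (\<Sum>i\<in>deg_idx 2. k i * mpol_eval (f ! i) v)"
      using quadric_in_ideal[OF minor_in_vanishing_ideal[OF X(2)] homogeneous_minor, of \<alpha> \<beta> \<gamma> \<delta>]
      unfolding N_def by blast
    show "\<exists>\<kappa>. \<forall>v\<in>vec.span (veronese ` P).
      mpol_eval (minor \<alpha> \<beta> \<gamma> \<delta>) v = (\<Sum>i\<in>deg_idx 2. \<kappa> i * mpol_eval (f ! i) v)"
      by (intro exI[of _ k] ballI k) (simp add: NP)
  qed simp
  have fin0: "length a = 9" if "finite X"
    using codim9 proj_dim_finite[OF that ne XU] by (simp add: numeral_eq_enat)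
  obtain a' where a': "a = replicate (card (deg_idx 1)) 1 @ a'" "sorted a'" "\<forall>x\<in>set a'. 2 \<le> x"
    using sorted_degrees[OF a] pos unfolding deg_idx_def by (metis in_set_conv_nth)
  have len_a': "length a = card (deg_idx 1) + length a'" by (subst a'(1)) simp
  obtain p where p: "p \<in> X" using ne by blast
  obtain x0 where x0: "x0 \<in> P" "p = vec.span {veronese x0}" using ptP p by blast
  show ?thesis
  proof (cases "X = {p}")
    case True
    have "N \<subseteq> p"
      unfolding N_def using True x0(2) by (intro vec.span_minimal) auto
    then have "vec.dim N \<le> 1"
      using vec.dim_le_card[of N "{veronese x0}"] x0(2) by simp
    then have "length a' = 0" "card (deg_idx 1) = 9" using D1 len_a' r9 by linarith+
    then show ?thesis using a'(1) True by simp
  next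
    case False
    then obtain p1 where p1: "p1 \<in> X" "p1 \<noteq> p" using p by blast
    obtain x1 where x1: "x1 \<in> P" "p1 = vec.span {veronese x1}" using ptP p1(1) by blast
    have x01: "x0 \<noteq> x1" and ind: "vec.independent {x0, x1}"
      using veronese_span_independent[of x0 x1] x0 x1 p1(2) by (auto simp: P_def)
    obtain \<phi>0 \<phi>1 where vcon: "veronese_conic x0 x1 \<phi>0 \<phi>1"
      using veronese_conic_exists[OF x01 ind] by blast
    then interpret veronese_conic x0 x1 \<phi>0 \<phi>1 .
    have Pspan: "P \<subseteq> vec.span {x0, x1}"
      using ind dimP x0(1) x1(1) x01 by (intro vec.card_ge_dim_independent) auto
    have Pcone: "\<exists>s t. x = s *s x0 + t *s x1" if "x \<in> P" for x
      using that Pspan by (auto simp: vec.span_breakdown_eq algebra_simps dest!: subsetD)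
    have XC: "X \<subseteq> Cset"
    proof
      fix L assume "L \<in> X"
      then obtain x where x: "x \<in> P" "L = vec.span {veronese x}" using ptP by blast
      obtain s t where st: "x = s *s x0 + t *s x1" using Pcone[OF x(1)] by blast
      have "x \<noteq> 0" using x(1) by (simp add: P_def)
      then have "s \<noteq> 0 \<or> t \<noteq> 0" using st by auto
      then show "L \<in> Cset" using Cset_cone[of s t] x(2) st by (simp add: cone_def)
    qed
    have CX: "vanishing_ideal Cset \<subseteq> vanishing_ideal X" using XC by (auto simp: vanishing_ideal_def)
    have Np: "N \<subseteq> plane"
      unfolding NP
    proof (rule vec.span_minimal[OF _ subspace_plane], rule subsetI)
      fix v assume "v \<in> veronese ` P"
      then obtain s t where "v = cone s t" using Pcone unfolding cone_def by blast
      then show "v \<in> plane" by (simp add: cone_in_plane)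
    qed
    have N3: "vec.dim N \<le> 3" using vec.dim_subset[OF Np] dim_plane by simp
    obtain \<kappa> where \<kappa>: "\<And>v. v \<in> N \<Longrightarrow> mpol_eval qform v = (\<Sum>i\<in>deg_idx 2. \<kappa> i * mpol_eval (f ! i) v)"
      using quadric_in_ideal[OF subsetD[OF CX qform_in_vanishing_ideal] homogeneous_qform]
      unfolding N_def by blast
    \<comment> \<open>At this vector \<open>qform\<close> has the value 1, so some quadric generator
      must enter its expression with a nonzero coefficient.\<close>
    have "veronese x0 + veronese x1 \<in> N"
      using PN x0(1) x1(1) by (simp add: N_def vec.span_add)
    from \<kappa>[OF this] have "(\<Sum>i\<in>deg_idx 2. \<kappa> i * mpol_eval (f ! i) (veronese x0 + veronese x1)) \<noteq> 0"
      by (simp add: dot_add_right)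
    then obtain j where "j \<in> deg_idx 2" "\<kappa> j * mpol_eval (f ! j) (veronese x0 + veronese x1) \<noteq> 0"
      by (rule sum.not_neutral_contains_not_neutral)
    then have j: "j < length a" "a ! j = 2" "\<kappa> j \<noteq> 0" by (auto simp: deg_idx_def)
    have "2 \<in> set a'"
    proof -
      have "2 \<in> set a" using j by (metis nth_mem)
      then show ?thesis by (subst (asm) a'(1)) auto
    qed
    then have len1: "1 \<le> length a'" by (cases a') auto
    show ?thesis
    proof (cases "finite X")
      case False
      then have XCset: "X = Cset" using infinite_closed_eq_Cset[OF closed _ XC] by blast
      then have "length a = 8"
        using codim9 proj_dim_Cset by (cases "length a") (auto simp: numeral_eq_enat one_enat_def)
      then have "length a' = 1" "card (deg_idx 1) = 7" using D1 N3 len_a' len1 by linarith+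
      then have "a' = [2]" using \<open>2 \<in> set a'\<close> by (auto simp: length_Suc_conv)
      then show ?thesis using a'(1) \<open>card (deg_idx 1) = 7\<close> conic_Cset XCset by simp
    next
      case True
      have r: "length a = 9" using fin0[OF True] .
      have card2: "2 \<le> card X"
        using card_mono[OF True, of "{p, p1}"] p p1 by simp
      show ?thesis
      proof (cases "card X = 2")
        case True
        have "X = {p, p1}"
          using card_seteq[OF \<open>finite X\<close>, of "{p, p1}"] p p1 True by auto
        then have "N \<subseteq> vec.span {veronese x0, veronese x1}"
          unfolding N_def x0(2) x1(2)
          by (intro vec.span_minimal) (auto dest: subsetD[OF vec.span_mono, rotated])
        then have "vec.dim N \<le> card {veronese x0, veronese x1}" by (rule vec.dim_le_card) simp
        also have "\<dots> \<le> 2" by (simp add: card_insert_if)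
        finally have "length a' = 1" "card (deg_idx 1) = 8" using D1 r len_a' len1 by linarith+
        then have "a' = [2]" using \<open>2 \<in> set a'\<close> by (auto simp: length_Suc_conv)
        then show ?thesis using a'(1) \<open>card (deg_idx 1) = 8\<close> True by simp
      next
        case False
        then have "\<not> X \<subseteq> {p, p1}"
          using card_mono[of "{p, p1}" X] card2 p1(2) by auto
        then obtain p2 where p2: "p2 \<in> X" "p2 \<noteq> p" "p2 \<noteq> p1" by blast
        obtain x2 where x2: "x2 \<in> P" "p2 = vec.span {veronese x2}" using ptP p2(1) by blast
        obtain s t where st: "x2 = s *s x0 + t *s x1" "s \<noteq> 0" "t \<noteq> 0"
          using third_point[of x2 x0 x1] x2 p2 x0(2) x1(2) Pspan by (auto simp: P_def)
        \<comment> \<open>A third point makes the span of the cone equal to the full plane, so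
          identities known on \<open>N\<close> hold on all of the conic.\<close>
        have "plane \<subseteq> N"
        proof (rule plane_subset[of N s t])
          show "cone s t \<in> N" using PN[OF x2(1)] st(1) by (simp add: cone_def)
        qed (use PN x0(1) x1(1) st in \<open>auto simp: N_def\<close>)
        then have Nplane: "N = plane" using Np by blast
        \<comment> \<open>On the plane this combination takes the values of \<open>qform\<close>,
          hence it vanishes on the conic.\<close>
        have combC: "(\<Sum>i\<in>deg_idx 2. mconst (\<kappa> i) * f ! i) \<in> vanishing_ideal Cset"
          unfolding vanishing_ideal_Cset
        proof (intro allI impI)
          fix s t
          have "mpol_eval (\<Sum>i\<in>deg_idx 2. mconst (\<kappa> i) * f ! i) (cone s t) = mpol_eval qform (cone s t)"
            by (subst \<kappa>) (simp_all add: Nplane cone_in_plane)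
          then show "mpol_eval (\<Sum>i\<in>deg_idx 2. mconst (\<kappa> i) * f ! i) (cone s t) = 0"
            by (simp add: power2_eq_square)
        qed
        have lin: "f ! i \<in> vanishing_ideal Cset" if "i \<in> deg_idx 1" for i
          using that generator_linear[of i] cone_in_plane unfolding N_def[symmetric] Nplane vanishing_ideal_Cset
          by (auto simp: deg_idx_def)
        have notall: "\<not> set f \<subseteq> vanishing_ideal Cset"
        proof
          assume "set f \<subseteq> vanishing_ideal Cset"
          then have "vanishing_ideal X \<subseteq> vanishing_ideal Cset"
            unfolding gen by (rule ideal_gen_minimal) simp
          then have "Cset \<subseteq> X" by (rule zariski_closed_subset_iff[OF closed Cset_subset_UNIV])
          then show False using \<open>finite X\<close> infinite_Cset finite_subset by blast
        qed
        let ?I = "\<lambda>H. ideal_gen (vanishing_ideal Cset \<union> ideal_gen {H})"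
        \<comment> \<open>The coefficient of \<open>f ! j\<close> in the combination is invertible,
          so modulo the ideal of the conic \<open>f ! j\<close> is a combination of the other
          quadric generators.\<close>
        have fj: "f ! j \<in> J" if J: "is_ideal J" "vanishing_ideal Cset \<subseteq> J"
          "\<And>i. i \<in> deg_idx 2 - {j} \<Longrightarrow> f ! i \<in> J" for J
        proof -
          have jd: "j \<in> deg_idx 2" using j by (simp add: deg_idx_def)
          have "(\<Sum>i\<in>deg_idx 2. mconst (\<kappa> i) * f ! i) - (\<Sum>i\<in>deg_idx 2 - {j}. mconst (\<kappa> i) * f ! i) \<in> J"
            by (rule ideal_diff[OF J(1) subsetD[OF J(2) combC]]) (intro ideal_sum[OF J(1)] ideal_mult[OF J(1)] J(3))
          then have "mconst (\<kappa> j) * f ! j \<in> J" by (simp add: sum.remove[OF finite_deg_idx jd])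
          then have "mconst (inverse (\<kappa> j)) * (mconst (\<kappa> j) * f ! j) \<in> J" by (rule ideal_mult[OF J(1)])
          then show ?thesis using j(3) by (simp flip: mult.assoc add: mult_single)
        qed
        have d7: "7 \<le> card (deg_idx 1)" using D1 dim_plane by (simp add: Nplane)
        have nth_lin: "i \<in> deg_idx 1" if "i < card (deg_idx 1)" for i
          using that len_a' by (subst deg_idx_def, subst (2) a'(1)) (simp add: nth_append)
        have idx1: "i < card (deg_idx 1)" if "i < length a" "a ! i = 1" for i
        proof (rule ccontr)
          assume "\<not> ?thesis"
          then have "a ! i = a' ! (i - card (deg_idx 1))" "i - card (deg_idx 1) < length a'"
            using that(1) len_a' by (subst a'(1), auto simp: nth_append)
          then have "2 \<le> a ! i" using a'(3) by simp
          then show False using that(2) by simp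
        qed
        have j7: "card (deg_idx 1) \<le> j"
        proof (rule ccontr)
          assume "\<not> ?thesis"
          then have "j \<in> deg_idx 1" using nth_lin by simp
          then show False using j(2) by (simp add: deg_idx_def)
        qed
        \<comment> \<open>With eight linear generators \<open>f ! j\<close> would be the only other
          one and would itself vanish on the conic. Then all generators would, and the finite set
          \<open>X\<close> would contain the conic.\<close>
        have "card (deg_idx 1) = 7"
        proof (rule ccontr)
          assume "card (deg_idx 1) \<noteq> 7"
          then have "card (deg_idx 1) = 8" using d7 len_a' len1 r by linarith
          then have all: "i = j \<or> i \<in> deg_idx 1" if "i < length a" for i
          proof (cases "i < card (deg_idx 1)")
            case False
            with that j7 j(1) r \<open>card (deg_idx 1) = 8\<close> have "i = j" by linarith
            then show ?thesis ..
          qed (use nth_lin in blast)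
          have "f ! j \<in> vanishing_ideal Cset"
          proof (rule fj)
            fix i assume "i \<in> deg_idx 2 - {j}"
            then show "f ! i \<in> vanishing_ideal Cset" using all lin by (auto simp: deg_idx_def)
          qed simp_all
          then have "f ! i \<in> vanishing_ideal Cset" if "i < length a" for i
            using all[OF that] lin[of i] by (elim disjE) simp_all
          then have "set f \<subseteq> vanishing_ideal Cset"
            using len by (auto simp: in_set_conv_nth)
          then show False using notall by blast
        qed
        then have "length a' = 2" using len_a' r by simp
        then obtain c b where cb: "a' = [c, b]" by (auto simp: numeral_2_eq_2 length_Suc_conv)
        have c: "c = 2" "2 \<le> b" using \<open>2 \<in> set a'\<close> a'(2,3) cb by auto
        have a_eq: "a = replicate 7 1 @ [2, b]" using a'(1) \<open>card (deg_idx 1) = 7\<close> cb c by simp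
        \<comment> \<open>The position of the other generator that is not linear. The case j = 8
          arises only for b = 2, when the two quadrics exchange roles; the generator at
          \<open>j'\<close> has degree \<open>b\<close> in either case.\<close>
        define j' where "j' = (if j = 7 then 8 else (7::nat))"
        have j78: "j = 7 \<or> j = 8" using j7 j(1) r \<open>card (deg_idx 1) = 7\<close> by auto
        then have j': "j' < length a" "a ! j' = b"
          using j(2) r by (auto simp: j'_def a_eq nth_append)
        have all: "i = j \<or> i = j' \<or> i \<in> deg_idx 1" if "i < length a" for i
        proof (cases "i < card (deg_idx 1)")
          case False
          with that r \<open>card (deg_idx 1) = 7\<close> have "i = 7 \<or> i = 8" by linarith
          then show ?thesis using j78 by (auto simp: j'_def)
        qed (use nth_lin in blast)
        define H where "H = f ! j'"
        have HI: "H \<in> ?I H" by (auto intro: ideal_gen_base)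
        have CI: "vanishing_ideal Cset \<subseteq> ?I H" by (auto intro: ideal_gen_base)
        have "f ! j \<in> ?I H"
        proof (rule fj[OF is_ideal_gen CI])
          fix i assume "i \<in> deg_idx 2 - {j}"
          then have "i < length a" "i \<noteq> j" "i \<notin> deg_idx 1" by (auto simp: deg_idx_def)
          then have "i = j'" using all[of i] by blast
          then show "f ! i \<in> ?I H" using HI by (simp add: H_def)
        qed
        then have "f ! i \<in> ?I H" if "i < length a" for i
          using all[OF that] subsetD[OF CI lin[of i]] HI by (elim disjE) (simp_all add: H_def)
        then have fI: "set f \<subseteq> ?I H"
          using len by (auto simp: in_set_conv_nth)
        have "vanishing_ideal X = ?I H"
        proof (rule subset_antisym)
          show "vanishing_ideal X \<subseteq> ?I H" unfolding gen by (rule ideal_gen_minimal[OF fI]) simp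
          have "ideal_gen {H} \<subseteq> vanishing_ideal X"
            by (rule ideal_gen_minimal) (use generator_in_ideal j' in \<open>auto simp: H_def\<close>)
          then show "?I H \<subseteq> vanishing_ideal X" using CX by (intro ideal_gen_minimal) auto
        qed
        then have "same_subscheme (vanishing_ideal X) (scheme_inter (vanishing_ideal Cset) (ideal_gen {H}))"
          by (simp add: same_subscheme_def scheme_inter_def)
        moreover have "H \<noteq> 0"
        proof
          assume "H = 0"
          then have "?I H \<subseteq> vanishing_ideal Cset"
            using ideal_gen_minimal[of "{0}" "vanishing_ideal Cset"] ideal_zero[of "vanishing_ideal Cset"]
            by (intro ideal_gen_minimal) auto
          then show False using fI notall by blast
        qed
        moreover have "homogeneous b H" using hom[OF j'(1)] j'(2) by (simp add: H_def)
        moreover have "proj_dim X = 0" using proj_dim_finite[OF \<open>finite X\<close> ne XU] .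
        ultimately show ?thesis using a_eq c(2) conic_Cset Cset_subset_veronese by blast
      qed
    qed
  qed
qed

theorem proposition5p1:
  fixes X :: "(4 uprod, 'k::{alg_closed_field, field_char_0}) point set"
    and a :: "nat list"
  assumes "variety X"
    and "X \<subseteq> veronese_variety"
    and "sorted a"
  shows "complete_intersection X a \<longleftrightarrow>
      a = replicate 9 1 \<and> (\<exists>p. X = {p})
    \<or> a = replicate 8 1 @ [2] \<and> card X = 2
    \<or> (\<exists>b\<ge>2. a = replicate 7 1 @ [2, b] \<and> proj_dim X = 0 \<and>
        (\<exists>C H. conic C \<and> C \<subseteq> veronese_variety \<and> homogeneous b H \<and> H \<noteq> 0 \<and>
          same_subscheme (vanishing_ideal X)
            (scheme_inter (vanishing_ideal C) (ideal_gen {H}))))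
    \<or> a = replicate 7 1 @ [2] \<and> conic X" (is "?L \<longleftrightarrow> ?R")
proof
  assume ?L
  with assms show ?R by (rule complete_intersection_classification)
next
  have XU: "X \<subseteq> proj UNIV" using assms(2) veronese_variety_subset by blast
  assume ?R
  then consider p where "a = replicate 9 1" "X = {p}" | "a = replicate 8 1 @ [2]" "card X = 2"
    | b C H where "2 \<le> b" "a = replicate 7 1 @ [2, b]" "proj_dim X = 0" "conic C" "C \<subseteq> veronese_variety"
      "homogeneous b H" "same_subscheme (vanishing_ideal X) (scheme_inter (vanishing_ideal C) (ideal_gen {H}))"
    | "a = replicate 7 1 @ [2]" "conic X" by blast
  then show ?L
  proof cases
    case 1
    then show ?thesis using complete_intersection_point[of p] XU by simp
  next
    case 2
    then show ?thesis using complete_intersection_two_points[OF XU] by simp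
  next
    case 3
    obtain x0 x1 \<phi>0 \<phi>1 where vc: "veronese_conic x0 x1 \<phi>0 \<phi>1" "C = veronese_conic.Cset x0 x1"
      using conic_on_veronese_variety[OF 3(4,5)] by blast
    show ?thesis unfolding 3(2)
      by (rule veronese_conic.complete_intersection_section[OF vc(1) assms(1) 3(3,6,1)])
        (use 3(7) vc(2) in simp)
  next
    case 4
    obtain x0 x1 \<phi>0 \<phi>1 where vc: "veronese_conic x0 x1 \<phi>0 \<phi>1" "X = veronese_conic.Cset x0 x1"
      using conic_on_veronese_variety[OF 4(2) assms(2)] by blast
    show ?thesis unfolding 4(1) vc(2)
      by (rule veronese_conic.complete_intersection_Cset[OF vc(1)])
  qed
qed

end
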